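(* Let $\Lambda$ be a finite set and let $\tau:\Lambda^{\mathbb{N}_0}\to\Lambda^{\mathbb{N}_0}$ be a bi-permutative cellular automaton. Then there exists a bijective correspondence between the collection of shift-invariant Borel probability measures $\mu$ on $\Lambda^{\mathbb{N}_0}$ that are also invariant relative to $\tau$, ergodic relative to the joint action of the shift and $\tau$, and satisfy $h_{(\pi_\mu)_*\mu}(\sigma)=0$, and the collection of shift-invariant Borel probability measures $\nu$ on $Z_\tau$ that are also invariant relative to $\tau'$, ergodic relative to the joint action of the shift and $\tau'$, and satisfy $h_\nu(\sigma)=0$.
   Context: $\mathbb{N}_0$ is the set of non-negative integers; $\sigma$ denotes the left shift on any of the shift spaces involved; $2^\Lambda$ is the set of subsets of $\Lambda$; $h$ denotes measure-theoretical entropy. A bi-permutative cellular automaton is a map $\tau:\Lambda^{\mathbb{N}_0}\to\Lambda^{\mathbb{N}_0}$ of the form $(\tau(x))_i=r(x_i,x_{i+1})$ for some $r:\Lambda^2\to\Lambda$ such that for every fixed $a\in\Lambda$ both $r(\cdot,a)$ and $r(a,\cdot)$ are bijections of $\Lambda$. For $\mu$ a Borel probability measure on $\Lambda^{\mathbb{N}_0}$ invariant under $\sigma$ and $\tau$, with $\mathcal{B}$ the Borel $\sigma$-algebra of $\Lambda^{\mathbb{N}_0}$ and $\mu_x^{\sigma^{-1}\mathcal{B}}$ the conditional probability of $\mu$ given $\sigma^{-1}\mathcal{B}$ at $x$, put $\Lambda_{\mu,x}=\{a\in\Lambda:\mu_x^{\sigma^{-1}\mathcal{B}}(\{(a,x_1,x_2,\dots)\})>0\}$;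 the map $\pi_\mu:\Lambda^{\mathbb{N}_0}\to(2^\Lambda)^{\mathbb{N}_0}$ is the ($\mu$-almost-surely defined) shift-equivariant map with $(\pi_\mu(x))_0=\Lambda_{\mu,x}$, i.e. $(\pi_\mu(x))_i=\Lambda_{\mu,\sigma^i(x)}$. The cellular automaton $\tau':(2^\Lambda)^{\mathbb{N}_0}\to(2^\Lambda)^{\mathbb{N}_0}$ is $(\tau'(A_0,A_1,\dots))_i=\{(\tau(a_0,a_1,\dots))_i:a_j\in A_j\ \text{for all }j\}$. For $1\le k\le|\Lambda|$, $Z_{\tau,k}\subseteq(2^\Lambda)^{\mathbb{N}_0}$ is the subshift of all points $(A_0,A_1,\dots)$ with $|A_i|=k$ for all $i$ and $|((\tau')^n(A_0,A_1,\dots))_i|=k$ for all $n>0$ and all indices $i$; and $Z_\tau=\bigcup_{k=1}^{|\Lambda|}Z_{\tau,k}$. *)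

theory Defs
  imports "HOL-Probability.Probability"
begin

definition seq_topology :: "(nat \<Rightarrow> 'b) topology" where
  "seq_topology = product_topology (\<lambda>_. discrete_topology UNIV) UNIV"

definition seq_borel :: "(nat \<Rightarrow> 'b) measure" where
  "seq_borel = sigma UNIV {U. openin seq_topology U}"

definition shift :: "(nat \<Rightarrow> 'b) \<Rightarrow> nat \<Rightarrow> 'b" where
  "shift x = (\<lambda>i. x (Suc i))"

lemma space_seq_borel [simp]: "space seq_borel = UNIV"
  by (simp add: seq_borel_def)

lemma sets_seq_borel_PiM:
  "sets (seq_borel :: (nat \<Rightarrow> 'b::finite) measure) = sets (PiM UNIV (\<lambda>_. count_space UNIV))"
proof -
  let ?P = "PiM UNIV (\<lambda>_. count_space UNIV) :: (nat \<Rightarrow> 'b) measure"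
  have cyl: "{x. \<forall>i<n. x i = w i} \<in> sets ?P" for n :: nat and w :: "nat \<Rightarrow> 'b"
  proof -
    have "{x \<in> space ?P. \<forall>i\<in>{..<n}. x i = w i} \<in> sets ?P"
      by measurable
    then show ?thesis by (simp add: space_PiM lessThan_def)
  qed
  have open_meas: "U \<in> sets ?P" if U: "openin seq_topology U" for U :: "(nat \<Rightarrow> 'b) set"
  proof -
    define C where "C = {V. V \<subseteq> U \<and> (\<exists>l::'b list. V = {x. \<forall>i<length l. x i = l ! i})}"
    have sub: "C \<subseteq> range (\<lambda>l::'b list. {x. \<forall>i<length l. x i = l ! i})"
      by (auto simp: C_def)
    have cnt: "countable C"
      by (rule countable_subset[OF sub]) simp
    have "x \<in> \<Union>C" if "x \<in> U" for x
    proof -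
      obtain W where W: "finite {i. W i \<noteq> UNIV}" "x \<in> Pi\<^sub>E UNIV W" "Pi\<^sub>E UNIV W \<subseteq> U"
        using U[unfolded seq_topology_def openin_product_topology_alt, rule_format, OF \<open>x \<in> U\<close>]
        by (auto simp del: PiE_UNIV_domain)
      obtain n where n: "\<And>i. W i \<noteq> UNIV \<Longrightarrow> i < n"
        using W(1) unfolding finite_nat_set_iff_bounded by blast
      have "{y. \<forall>i<n. y i = x i} \<subseteq> U"
      proof
        fix y assume y: "y \<in> {y. \<forall>i<n. y i = x i}"
        have "y i \<in> W i" for i
          using n[of i] y W(2) by (cases "W i = UNIV") (auto simp: PiE_iff)
        then show "y \<in> U" using W(3) by (auto simp: PiE_iff)
      qed
      moreover have "{y. \<forall>i<n. y i = x i} = {y. \<forall>i<length (map x [0..<n]). y i = map x [0..<n] ! i}"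
        by simp
      ultimately have "{y. \<forall>i<n. y i = x i} \<in> C"
        unfolding C_def by blast
      then show ?thesis by blast
    qed
    then have "U = \<Union>C" by (auto simp: C_def)
    moreover have "C \<subseteq> sets ?P" using cyl by (auto simp: C_def)
    ultimately show ?thesis using cnt by (simp add: sets.countable_Union)
  qed
  show ?thesis
  proof
    have "sigma_sets (space ?P) {U. openin seq_topology U} \<subseteq> sets ?P"
      using open_meas by (intro sets.sigma_sets_subset) blast
    then show "sets (seq_borel :: (nat \<Rightarrow> 'b) measure) \<subseteq> sets ?P"
      by (simp add: seq_borel_def sets_measure_of space_PiM)
    have "openin seq_topology {f::nat \<Rightarrow> 'b. f i \<in> A}" for i A
      using openin_continuous_map_preimage[OF continuous_map_product_projection[of i UNIV
            "\<lambda>_. discrete_topology (UNIV::'b set)"], of A]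
      by (simp add: seq_topology_def)
    then show "sets ?P \<subseteq> sets (seq_borel :: (nat \<Rightarrow> 'b) measure)"
      unfolding sets_PiM_single seq_borel_def by (auto simp: sets_measure_of intro!: sigma_sets_mono)
  qed
qed

definition invariant_under :: "('b \<Rightarrow> 'b) \<Rightarrow> 'b measure \<Rightarrow> bool" where
  "invariant_under T M \<longleftrightarrow> T \<in> M \<rightarrow>\<^sub>M M \<and> distr M M T = M"

definition jointly_ergodic :: "('b \<Rightarrow> 'b) \<Rightarrow> ('b \<Rightarrow> 'b) \<Rightarrow> 'b measure \<Rightarrow> bool" where
  "jointly_ergodic S T M \<longleftrightarrow>
     (\<forall>A \<in> sets M. S -` A \<inter> space M = A \<longrightarrow> T -` A \<inter> space M = A \<longrightarrow>
        measure M A = 0 \<or> measure M A = 1)"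

definition partition_entropy :: "'b measure \<Rightarrow> 'b set set \<Rightarrow> real" where
  "partition_entropy M P = - (\<Sum>A\<in>P. measure M A * ln (measure M A))"

definition iterated_partition ::
  "'b measure \<Rightarrow> ('b \<Rightarrow> 'b) \<Rightarrow> 'b set set \<Rightarrow> nat \<Rightarrow> 'b set set" where
  "iterated_partition M T P n =
     common_refinement ((\<lambda>i. (\<lambda>A. (T ^^ i) -` A \<inter> space M) ` P) ` {..<n})"

text \<open>Kolmogorov--Sinai entropy, in nats. For invariant \<open>M\<close> the limit exists by subadditivity.\<close>

definition measure_entropy :: "'b measure \<Rightarrow> ('b \<Rightarrow> 'b) \<Rightarrow> ereal" where
  "measure_entropy M T =
     (SUP P \<in> {P. finite P \<and> P \<subseteq> sets M \<and> partition_on (space M) P}.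
        lim (\<lambda>n. ereal (partition_entropy M (iterated_partition M T P n) / real n)))"

definition is_cond_measure :: "'b measure \<Rightarrow> 'b measure \<Rightarrow> ('b \<Rightarrow> 'b measure) \<Rightarrow> bool" where
  "is_cond_measure M F \<kappa> \<longleftrightarrow>
     \<kappa> \<in> F \<rightarrow>\<^sub>M prob_algebra M \<and>
     (\<forall>B \<in> sets M. AE x in M. measure (\<kappa> x) B = real_cond_exp M F (indicator B) x)"

text \<open>Conditional measures on a sequence space over a finite alphabet exist and are unique up
  to null sets; a version is fixed once and for all.\<close>

definition cond_measure :: "'b measure \<Rightarrow> 'b measure \<Rightarrow> 'b \<Rightarrow> 'b measure" where
  "cond_measure M F = (SOME \<kappa>. is_cond_measure M F \<kappa>)"

definition shift_algebra :: "(nat \<Rightarrow> 'a) measure" where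
  "shift_algebra = vimage_algebra UNIV shift seq_borel"

text \<open>The point \<open>case_nat a (shift x)\<close> is the sequence $(a,x_1,x_2,\dots)$.\<close>

definition local_alphabet :: "(nat \<Rightarrow> 'a) measure \<Rightarrow> (nat \<Rightarrow> 'a) \<Rightarrow> 'a set" where
  "local_alphabet \<mu> x =
     {a. measure (cond_measure \<mu> shift_algebra x) {case_nat a (shift x)} > 0}"

definition alphabet_map :: "(nat \<Rightarrow> 'a) measure \<Rightarrow> (nat \<Rightarrow> 'a) \<Rightarrow> nat \<Rightarrow> 'a set" where
  "alphabet_map \<mu> x = (\<lambda>i. local_alphabet \<mu> ((shift ^^ i) x))"

definition bipermutative_ca :: "((nat \<Rightarrow> 'a) \<Rightarrow> nat \<Rightarrow> 'a) \<Rightarrow> bool" where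
  "bipermutative_ca \<tau> \<longleftrightarrow>
     (\<exists>r. (\<forall>x i. \<tau> x i = r (x i) (x (Suc i))) \<and>
          (\<forall>a. bij (\<lambda>b. r b a) \<and> bij (\<lambda>b. r a b)))"

definition set_ca :: "((nat \<Rightarrow> 'a) \<Rightarrow> nat \<Rightarrow> 'a) \<Rightarrow> (nat \<Rightarrow> 'a set) \<Rightarrow> nat \<Rightarrow> 'a set" where
  "set_ca \<tau> A = (\<lambda>i. {\<tau> a i | a. \<forall>j. a j \<in> A j})"

definition Zk :: "((nat \<Rightarrow> 'a) \<Rightarrow> nat \<Rightarrow> 'a) \<Rightarrow> nat \<Rightarrow> (nat \<Rightarrow> 'a set) set" where
  "Zk \<tau> k = {A. (\<forall>i. card (A i) = k) \<and> (\<forall>n>0. \<forall>i. card ((set_ca \<tau> ^^ n) A i) = k)}"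

definition Z :: "((nat \<Rightarrow> 'a::finite) \<Rightarrow> nat \<Rightarrow> 'a) \<Rightarrow> (nat \<Rightarrow> 'a set) set" where
  "Z \<tau> = (\<Union>k\<in>{1..CARD('a)}. Zk \<tau> k)"

definition zero_entropy_alphabet_measures ::
  "((nat \<Rightarrow> 'a::finite) \<Rightarrow> nat \<Rightarrow> 'a) \<Rightarrow> (nat \<Rightarrow> 'a) measure set" where
  "zero_entropy_alphabet_measures \<tau> =
     {\<mu>. prob_space \<mu> \<and> sets \<mu> = sets seq_borel \<and>
         invariant_under shift \<mu> \<and> invariant_under \<tau> \<mu> \<and> jointly_ergodic shift \<tau> \<mu> \<and>
         measure_entropy (distr \<mu> seq_borel (alphabet_map \<mu>)) shift = 0}"

definition zero_entropy_Z_measures ::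
  "((nat \<Rightarrow> 'a::finite) \<Rightarrow> nat \<Rightarrow> 'a) \<Rightarrow> (nat \<Rightarrow> 'a set) measure set" where
  "zero_entropy_Z_measures \<tau> =
     {\<nu>. prob_space \<nu> \<and> sets \<nu> = sets (restrict_space seq_borel (Z \<tau>)) \<and>
         invariant_under shift \<nu> \<and> invariant_under (set_ca \<tau>) \<nu> \<and>
         jointly_ergodic shift (set_ca \<tau>) \<nu> \<and>
         measure_entropy \<nu> shift = 0}"

end

theory Submission
  imports Defs
begin

text \<open>
  The correspondence sends \<open>\<mu>\<close> to the law of \<open>\<pi>\<^sub>\<mu>\<close>; its inverse sends \<open>\<nu>\<close> to the mixture, over \<open>A\<close> drawn
  from \<open>\<nu>\<close>, of the products of the uniform distributions on \<open>A\<^sub>0, A\<^sub>1, \<dots>\<close>.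

  For an invariant \<open>\<mu>\<close>, let \<open>p\<^sub>a(x)\<close> be the conditional probability of \<open>x\<^sub>0 = a\<close> given \<open>\<sigma> x\<close>. Invariance
  under \<open>\<tau>\<close> makes \<open>p\<close> evaluated at \<open>x\<^sub>0\<close> a \<open>\<tau>\<close>-invariant function. Since \<open>x\<^sub>0, \<dots>, x\<^sub>n\<close> and
  \<open>x\<^sub>0, (\<tau> x)\<^sub>0, \<dots>, (\<tau>\<^sup>n x)\<^sub>0\<close> determine each other, \<open>\<sigma>\<close> and \<open>\<tau>\<close> have the same entropy rate, also relative to a
  \<open>\<tau>\<close>-invariant event; such events therefore have zero \<open>\<sigma>\<close>-entropy and depend on \<open>\<sigma> x\<close> only. So \<open>p\<^sub>a\<close> is
  uniform on the local alphabet. When \<open>\<pi>\<^sub>\<mu>\<close> has zero entropy it is a function of the remote future, hence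
  given \<open>\<pi>\<^sub>\<mu>\<close> the coordinates are independent and uniform, and \<open>\<pi>\<^sub>\<mu> \<circ> \<tau> = \<tau>' \<circ> \<pi>\<^sub>\<mu>\<close>.

  Conversely, for a mixture of products over \<open>k\<close>-element sets, \<open>p\<^sub>a \<le> 1/k\<close>, while zero entropy of \<open>\<nu>\<close> bounds
  the entropy rate by \<open>ln k\<close>. This forces \<open>p\<^sub>a \<in> {0, 1/k}\<close>, so that the local alphabet recovers \<open>A\<^sub>0\<close>.
\<close>

section \<open>Entropy of finite-valued variables\<close>

text \<open>Entropy acts through conditional independence. An event that shares no information with
  x_0 given \<sigma> x is conditionally independent of x_0; but it is also a function of x_0 and
  \<sigma> x, so its truth cannot change when x_0 is replaced by another symbol of positive
  conditional probability. For the events p \<le> t this gives uniformity; for x_0 itself, when the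
  entropy is zero, it gives determinism. The comparison of entropies controls only the average of
  the mutual informations over growing blocks, so they are small merely along a subsequence of block
  lengths. This suffices because finite-block conditional probabilities converge in L^1 along all
  lengths. The other difficulty is null sets. Conditional measures, \<pi>_\<mu> and its equivariance
  are almost sure notions, while membership in Z_\<tau> and the invariant sets of joint ergodicity
  are strict. Hence the versions that are constant on fibres of \<open>shift\<close>, the repair of
  almost invariant sets, and the transport of measures between Z_\<tau> and the whole sequence
  space.\<close>

definition fiber_prob :: "'m measure \<Rightarrow> ('m \<Rightarrow> 'c) \<Rightarrow> 'm \<Rightarrow> real" where
  "fiber_prob M X x = measure M {y \<in> space M. X y = X x}"

text \<open>Shannon entropy in nats, written as the mean of the information function, so that
  comparing entropies reduces to comparing fibres point by point; \<open>ent_eq_sum\<close> gives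
  the usual sum.\<close>

definition ent :: "'m measure \<Rightarrow> ('m \<Rightarrow> 'c) \<Rightarrow> real" where
  "ent M X = (\<integral>x. - ln (fiber_prob M X x) \<partial>M)"

text \<open>The conditional mutual information I(X; Q | Y) = H(X | Y) + H(Q | Y) - H(X, Q |
  Y).\<close>

definition cond_mi :: "'m measure \<Rightarrow> ('m \<Rightarrow> 'c) \<Rightarrow> ('m \<Rightarrow> 'd) \<Rightarrow> ('m \<Rightarrow> 'e) \<Rightarrow> real" where
  "cond_mi M X Q Y = ent M (\<lambda>x. (X x, Y x)) + ent M (\<lambda>x. (Q x, Y x)) - ent M Y
     - ent M (\<lambda>x. (X x, Q x, Y x))"

lemma simple_function_fiber:
  "simple_function M X \<Longrightarrow> {x \<in> space M. X x = a} \<in> sets M"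
  using simple_functionD(2)[of M X "{a}"] by (simp add: vimage_def Int_def conj_commute)

lemma simple_function_countI:
  "X \<in> M \<rightarrow>\<^sub>M count_space UNIV \<Longrightarrow> finite (X ` space M) \<Longrightarrow> simple_function M X"
  unfolding simple_function_def by (auto intro: measurable_sets)

lemma simple_function_finite_type:
  fixes X :: "'m \<Rightarrow> 'c::finite"
  shows "simple_function M X \<longleftrightarrow> X \<in> M \<rightarrow>\<^sub>M count_space UNIV"
  by (metis finite simple_function_countI measurable_simple_function)

context prob_space
begin

lemma simple_function_integrable:
  fixes f :: "'a \<Rightarrow> real"
  assumes "simple_function M f"
  shows "integrable M f"
proof (rule integrable_const_bound[where B = "Max ((\<lambda>x. norm (f x)) ` space M)"])
  have "finite ((\<lambda>x. norm (f x)) ` space M)"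
    using simple_functionD(1)[OF simple_function_compose1[OF assms, of norm]] .
  then show "AE x in M. norm (f x) \<le> Max ((\<lambda>x. norm (f x)) ` space M)"
    by (intro AE_I2 Max_ge) auto
  show "f \<in> borel_measurable M" using assms by (rule borel_measurable_simple_function)
qed

lemma integral_simple:
  fixes \<psi> :: "'c \<Rightarrow> real"
  assumes X: "simple_function M X" and S: "finite S" "X ` space M \<subseteq> S"
  shows "(\<integral>x. \<psi> (X x) \<partial>M) = (\<Sum>a\<in>S. \<psi> a * prob {x \<in> space M. X x = a})"
proof -
  note [measurable] = simple_function_fiber[OF X]
  have "(\<integral>x. \<psi> (X x) \<partial>M) = (\<integral>x. (\<Sum>a\<in>S. \<psi> a * indicator {x \<in> space M. X x = a} x) \<partial>M)"
  proof (rule Bochner_Integration.integral_cong[OF refl])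
    fix x assume x: "x \<in> space M"
    have "(\<Sum>a\<in>S. \<psi> a * indicator {x \<in> space M. X x = a} x) = (\<Sum>a\<in>S. if a = X x then \<psi> a else 0)"
      using x by (intro sum.cong) (auto simp: indicator_def)
    also have "\<dots> = \<psi> (X x)" using S x by (subst sum.delta) auto
    finally show "\<psi> (X x) = (\<Sum>a\<in>S. \<psi> a * indicator {x \<in> space M. X x = a} x)" by simp
  qed
  also have "\<dots> = (\<Sum>a\<in>S. \<psi> a * prob {x \<in> space M. X x = a})"
    by (subst Bochner_Integration.integral_sum) (auto simp: integrable_real_mult_indicator emeasure_eq_measure)
  finally show ?thesis .
qed

lemma simple_function_fiber_prob:
  assumes "simple_function M X"
  shows "simple_function M (\<lambda>x. g (fiber_prob M X x))"
  unfolding fiber_prob_def by (rule simple_function_compose1[OF assms])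

lemma fiber_prob_pos:
  assumes X: "simple_function M X"
  shows "AE x in M. 0 < fiber_prob M X x"
proof -
  note [measurable] = simple_function_fiber[OF X]
  let ?N = "\<Union>a\<in>{a \<in> X ` space M. prob {x \<in> space M. X x = a} = 0}. {x \<in> space M. X x = a}"
  have "?N \<in> null_sets M"
    using simple_functionD(1)[OF X]
    by (intro null_sets_UN') (auto simp: null_sets_def emeasure_eq_measure intro: countable_finite)
  then show ?thesis
  proof (rule AE_I'[of ?N])
    show "{x \<in> space M. \<not> 0 < fiber_prob M X x} \<subseteq> ?N"
      unfolding fiber_prob_def using zero_less_measure_iff by fastforce
  qed
qed

lemma fiber_prob_le_1: "fiber_prob M X x \<le> 1"
  by (simp add: fiber_prob_def)

lemma ent_integrable:
  assumes "simple_function M X"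
  shows "integrable M (\<lambda>x. ln (fiber_prob M X x))"
  by (intro simple_function_integrable simple_function_fiber_prob assms)

lemma ent_mono:
  assumes X: "simple_function M X" and W: "simple_function M W"
    and f: "\<And>x y. x \<in> space M \<Longrightarrow> y \<in> space M \<Longrightarrow> X x = X y \<Longrightarrow> W x = W y"
  shows "ent M W \<le> ent M X"
  unfolding ent_def
proof (rule integral_mono_AE)
  show "integrable M (\<lambda>x. - ln (fiber_prob M W x))" "integrable M (\<lambda>x. - ln (fiber_prob M X x))"
    using ent_integrable[OF X] ent_integrable[OF W] by auto
  have "fiber_prob M X x \<le> fiber_prob M W x" if "x \<in> space M" for x
    unfolding fiber_prob_def
    by (rule finite_measure_mono) (use f that simple_function_fiber[OF W] in blast)+
  then show "AE x in M. - ln (fiber_prob M W x) \<le> - ln (fiber_prob M X x)"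
    using fiber_prob_pos[OF X] by (auto intro: ln_mono)
qed

text \<open>Only the partition into fibres matters, which lets tuples, lists and reorderings of the
  same data replace each other below.\<close>

lemma ent_cong:
  assumes f: "\<And>x y. x \<in> space M \<Longrightarrow> y \<in> space M \<Longrightarrow> X x = X y \<longleftrightarrow> W x = W y"
  shows "ent M W = ent M X"
  unfolding ent_def fiber_prob_def
  by (intro Bochner_Integration.integral_cong refl arg_cong[of _ _ "\<lambda>A. - ln (measure M A)"]) (use f in auto)

lemma ent_cong_AE:
  assumes X: "simple_function M X" and W: "simple_function M W" and eq: "AE x in M. X x = W x"
  shows "ent M X = ent M W"
proof -
  note [measurable] = simple_function_fiber[OF X] simple_function_fiber[OF W]
  have "prob {x \<in> space M. X x = a} = prob {x \<in> space M. W x = a}" for a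
    by (rule finite_measure_eq_AE) (use eq in auto)
  then have "AE x in M. - ln (fiber_prob M X x) = - ln (fiber_prob M W x)"
    unfolding fiber_prob_def using eq by auto
  then show ?thesis unfolding ent_def
    by (intro integral_cong_AE borel_measurable_integrable)
       (use ent_integrable[OF X] ent_integrable[OF W] in auto)
qed

lemma ent_nonneg:
  assumes X: "simple_function M X" shows "0 \<le> ent M X"
  unfolding ent_def
proof (rule Bochner_Integration.integral_nonneg_AE)
  show "AE x in M. 0 \<le> - ln (fiber_prob M X x)"
    using fiber_prob_pos[OF X] by eventually_elim (simp add: fiber_prob_le_1)
qed

lemma ent_eq_sum:
  assumes X: "simple_function M X" and S: "finite S" "X ` space M \<subseteq> S"
  shows "ent M X = (\<Sum>a\<in>S. - (prob {x \<in> space M. X x = a} * ln (prob {x \<in> space M. X x = a})))"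
  unfolding ent_def fiber_prob_def
  by (subst integral_simple[OF X S]) (simp add: mult.commute)

lemma sum_fibers:
  assumes X: "simple_function M X" and S: "finite S" "X ` space M \<subseteq> S" and E: "E \<in> sets M"
  shows "(\<Sum>a\<in>S. prob {x \<in> E. X x = a}) = prob E"
proof -
  note [measurable] = simple_function_fiber[OF X]
  have "(\<Sum>a\<in>S. prob {x \<in> E. X x = a}) = prob (\<Union>a\<in>S. {x \<in> E. X x = a})"
  proof (rule finite_measure_finite_Union[symmetric])
    have "{x \<in> E. X x = a} = E \<inter> {x \<in> space M. X x = a}" for a
      using sets.sets_into_space[OF E] by auto
    then show "(\<lambda>a. {x \<in> E. X x = a}) ` S \<subseteq> events" using E by auto
  qed (use S in \<open>auto simp: disjoint_family_on_def\<close>)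
  also have "(\<Union>a\<in>S. {x \<in> E. X x = a}) = E"
    using S sets.sets_into_space[OF E] by auto
  finally show ?thesis .
qed

lemma ent_distr:
  assumes T: "T \<in> M \<rightarrow>\<^sub>M N" and X: "simple_function N X"
  shows "ent (distr M N T) X = ent M (\<lambda>x. X (T x))"
proof -
  note [measurable] = T simple_function_fiber[OF X]
  have *: "fiber_prob (distr M N T) X (T x) = fiber_prob M (\<lambda>x. X (T x)) x" for x
    unfolding fiber_prob_def
    by (subst measure_distr[OF T]) (use T[THEN measurable_space] in \<open>auto intro!: arg_cong[of _ _ "measure M"]\<close>)
  interpret D: prob_space "distr M N T" by (rule prob_space_distr[OF T])
  have "simple_function (distr M N T) X" using X by (simp add: simple_function_def)
  from D.ent_integrable[OF this] have "(\<lambda>x. - ln (fiber_prob (distr M N T) X x)) \<in> borel_measurable N"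
    using borel_measurable_integrable by force
  then show ?thesis
    unfolding ent_def by (subst integral_distr[OF T]) (auto simp: *)
qed

end

text \<open>With v = sqrt (s / t), -ln (s / t) = -2 ln v \<ge> 2 - 2 v, and 2 t - 2 sqrt (t s) is
  the right-hand side. Summed over two probability vectors, t - s cancels and the squared Hellinger
  distance remains.\<close>

lemma neg_ln_ge_sqrt:
  fixes t s :: real
  assumes "0 < t" "0 < s"
  shows "t * (- ln (s / t)) \<ge> (sqrt t - sqrt s)\<^sup>2 + t - s"
proof -
  have "- ln (s / t) = - 2 * ln (sqrt (s / t))" using assms by (simp add: ln_sqrt)
  also have "\<dots> \<ge> - 2 * (sqrt (s / t) - 1)" using ln_le_minus_one[of "sqrt (s / t)"] assms by simp
  finally have "t * (- ln (s / t)) \<ge> t * (- 2 * (sqrt (s / t) - 1))" using assms by (intro mult_left_mono) auto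
  moreover have "t * sqrt (s / t) = sqrt t * sqrt s"
    using assms by (simp add: real_sqrt_divide real_div_sqrt field_simps)
  ultimately show ?thesis using assms by (simp add: power2_diff algebra_simps)
qed

context prob_space
begin

text \<open>A conditional Pinsker-type inequality, with a worse constant.\<close>

lemma cond_mi_bound:
  assumes X: "simple_function M X" and Q: "simple_function M Q" and Y: "simple_function M Y"
  shows "0 \<le> cond_mi M X Q Y" (is ?nonneg)
    and "(\<Sum>y\<in>Y ` space M. \<bar>prob {x \<in> space M. X x = a \<and> Q x = q \<and> Y x = y}
           - prob {x \<in> space M. X x = a \<and> Y x = y} * prob {x \<in> space M. Q x = q \<and> Y x = y}
             / prob {x \<in> space M. Y x = y}\<bar>) \<le> 2 * sqrt (cond_mi M X Q Y)" (is ?bound)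
proof -
  note [measurable] = simple_function_fiber[OF X] simple_function_fiber[OF Q] simple_function_fiber[OF Y]
  \<comment> \<open>The fixed values \<open>a\<close> and \<open>q\<close> may fail to be attained;
    inserting them makes the sum to be bounded a part of the full triple sum.\<close>
  define RX where "RX = insert a (X ` space M)"
  define RQ where "RQ = insert q (Q ` space M)"
  define RY where "RY = Y ` space M"
  note R_defs = RX_def RQ_def RY_def
  have fin: "finite RX" "finite RQ" "finite RY"
    using X Q Y by (auto simp: R_defs simple_functionD)
  define pxq where "pxq = (\<lambda>a q y. prob {x \<in> space M. X x = a \<and> Q x = q \<and> Y x = y})"
  define px where "px = (\<lambda>a y. prob {x \<in> space M. X x = a \<and> Y x = y})"
  define pq where "pq = (\<lambda>q y. prob {x \<in> space M. Q x = q \<and> Y x = y})"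
  define p where "p = (\<lambda>y. prob {x \<in> space M. Y x = y})"
  note p_defs = pxq_def px_def pq_def p_def
  have sets[measurable]: "{x \<in> space M. X x = a \<and> Q x = q \<and> Y x = y} \<in> sets M"
    "{x \<in> space M. X x = a \<and> Y x = y} \<in> sets M" "{x \<in> space M. Q x = q \<and> Y x = y} \<in> sets M" for a q y
    by (intro sets.sets_Collect_conj simple_function_fiber X Q Y)+
  have ge0: "0 \<le> pxq a q y" "0 \<le> px a y" "0 \<le> pq q y" "0 \<le> p y" for a q y by (auto simp: p_defs)
  have le: "pxq a q y \<le> px a y" "pxq a q y \<le> pq q y" "px a y \<le> p y" for a q y
    unfolding p_defs by (intro finite_measure_mono; force)+
  \<comment> \<open>The mass the triple would have if \<open>X\<close> and \<open>Q\<close> were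
    independent given \<open>Y\<close>.\<close>
  define s where "s = (\<lambda>a q y. px a y * pq q y / p y)"
  have s0: "0 \<le> s a q y" for a q y unfolding s_def using ge0 by simp
  have sXY: "simple_function M (\<lambda>x. (X x, Y x))" and sQY: "simple_function M (\<lambda>x. (Q x, Y x))"
    and sXQY: "simple_function M (\<lambda>x. (X x, Q x, Y x))"
    using X Q Y by auto
  have "cond_mi M X Q Y = (\<integral>x. - ln (px (X x) (Y x)) - ln (pq (Q x) (Y x)) + ln (p (Y x)) + ln (pxq (X x) (Q x) (Y x)) \<partial>M)"
    using ent_integrable[OF sXY] ent_integrable[OF sQY] ent_integrable[OF sXQY] ent_integrable[OF Y]
    unfolding cond_mi_def ent_def p_defs fiber_prob_def by simp
  also have "\<dots> = (\<integral>x. (\<lambda>(a, q, y). - ln (px a y) - ln (pq q y) + ln (p y) + ln (pxq a q y)) (X x, Q x, Y x) \<partial>M)"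
    by simp
  also have "\<dots> = (\<Sum>(a, q, y)\<in>RX \<times> RQ \<times> RY. (- ln (px a y) - ln (pq q y) + ln (p y) + ln (pxq a q y)) * pxq a q y)"
    by (subst integral_simple[OF sXQY, of "RX \<times> RQ \<times> RY"])
       (use fin in \<open>auto simp: R_defs p_defs intro!: sum.cong\<close>)
  finally have mi: "cond_mi M X Q Y = \<dots>" .
  have pointwise: "(- ln (px a y) - ln (pq q y) + ln (p y) + ln (pxq a q y)) * pxq a q y
      \<ge> (sqrt (pxq a q y) - sqrt (s a q y))\<^sup>2 + pxq a q y - s a q y" for a q y
  proof (cases "pxq a q y = 0")
    case True then show ?thesis using s0[of a q y] by simp
  next
    case False
    then have pos: "pxq a q y > 0" "px a y > 0" "pq q y > 0" "p y > 0"
      using ge0(1)[of a q y] le(1)[of a q y] le(2)[of a q y] le(3)[of a y] by linarith+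
    then have "s a q y > 0" by (simp add: s_def)
    moreover have "- ln (s a q y / pxq a q y) = - ln (px a y) - ln (pq q y) + ln (p y) + ln (pxq a q y)"
      using pos by (simp add: s_def ln_div ln_mult)
    ultimately show ?thesis using neg_ln_ge_sqrt[of "pxq a q y" "s a q y"] pos by (simp add: mult.commute)
  qed
  have sum_p: "(\<Sum>y\<in>RY. p y) = 1"
    using sum_fibers[OF Y fin(3), of "space M"] by (simp add: RY_def p_def prob_space)
  have sum_px: "(\<Sum>a\<in>RX. px a y) = p y" for y
  proof -
    have "{x \<in> {x \<in> space M. Y x = y}. X x = a} = {x \<in> space M. X x = a \<and> Y x = y}" for a by auto
    then show ?thesis
      using sum_fibers[OF X fin(1), of "{x \<in> space M. Y x = y}"] by (simp add: RX_def p_defs subset_insertI)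
  qed
  have sum_pq: "(\<Sum>q\<in>RQ. pq q y) = p y" for y
  proof -
    have "{x \<in> {x \<in> space M. Y x = y}. Q x = q} = {x \<in> space M. Q x = q \<and> Y x = y}" for q by auto
    then show ?thesis
      using sum_fibers[OF Q fin(2), of "{x \<in> space M. Y x = y}"] by (simp add: RQ_def p_defs subset_insertI)
  qed
  have sum_pxq: "(\<Sum>(a, q, y)\<in>RX \<times> RQ \<times> RY. pxq a q y) = 1"
  proof -
    have "(\<lambda>x. (X x, Q x, Y x)) ` space M \<subseteq> RX \<times> RQ \<times> RY" by (auto simp: R_defs)
    then show ?thesis
      using integral_simple[OF sXQY, of "RX \<times> RQ \<times> RY" "\<lambda>_. 1"] fin
      by (simp add: p_defs prob_space case_prod_beta' prod_eq_iff)
  qed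
  have "(\<Sum>(a, q, y)\<in>RX \<times> RQ \<times> RY. s a q y) = (\<Sum>y\<in>RY. \<Sum>a\<in>RX. \<Sum>q\<in>RQ. s a q y)"
    by (simp add: sum.cartesian_product[symmetric] sum.swap[of _ RY])
  also have "\<dots> = (\<Sum>y\<in>RY. (\<Sum>a\<in>RX. px a y) * (\<Sum>q\<in>RQ. pq q y) / p y)"
    unfolding s_def by (simp add: sum_product sum_divide_distrib)
  also have "\<dots> = (\<Sum>y\<in>RY. p y)" unfolding sum_px sum_pq by simp
  also have "\<dots> = 1" using sum_p by simp
  finally have sum_s: "(\<Sum>(a, q, y)\<in>RX \<times> RQ \<times> RY. s a q y) = 1" .
  have "cond_mi M X Q Y \<ge> (\<Sum>(a, q, y)\<in>RX \<times> RQ \<times> RY. (sqrt (pxq a q y) - sqrt (s a q y))\<^sup>2 + pxq a q y - s a q y)"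
    unfolding mi by (intro sum_mono) (use pointwise in auto)
  also have "(\<Sum>(a, q, y)\<in>RX \<times> RQ \<times> RY. (sqrt (pxq a q y) - sqrt (s a q y))\<^sup>2 + pxq a q y - s a q y)
     = (\<Sum>(a, q, y)\<in>RX \<times> RQ \<times> RY. (sqrt (pxq a q y) - sqrt (s a q y))\<^sup>2)"
    using sum_s sum_pxq by (simp add: case_prod_beta' sum.distrib sum_subtractf)
  finally have main: "(\<Sum>(a, q, y)\<in>RX \<times> RQ \<times> RY. (sqrt (pxq a q y) - sqrt (s a q y))\<^sup>2) \<le> cond_mi M X Q Y" .
  have nn: "0 \<le> (\<Sum>(a, q, y)\<in>RX \<times> RQ \<times> RY. (sqrt (pxq a q y) - sqrt (s a q y))\<^sup>2)"
    by (intro sum_nonneg) auto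
  then show ?nonneg using main by linarith
  have sub: "(\<lambda>y. (a, q, y)) ` RY \<subseteq> RX \<times> RQ \<times> RY" by (auto simp: RX_def RQ_def)
  have part: "(\<Sum>y\<in>RY. f a q y) \<le> (\<Sum>(a, q, y)\<in>RX \<times> RQ \<times> RY. f a q y)"
    if "\<And>a q y. 0 \<le> f a q y" for f :: "_ \<Rightarrow> _ \<Rightarrow> _ \<Rightarrow> real"
  proof -
    have "(\<Sum>y\<in>RY. f a q y) = (\<Sum>(a, q, y)\<in>(\<lambda>y. (a, q, y)) ` RY. f a q y)"
      by (subst sum.reindex) (auto simp: inj_on_def)
    also have "\<dots> \<le> (\<Sum>(a, q, y)\<in>RX \<times> RQ \<times> RY. f a q y)"
      by (rule sum_mono2) (use sub fin that in auto)
    finally show ?thesis .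
  qed
  \<comment> \<open>Cauchy-Schwarz for u^2 - v^2 = (u - v) (u + v): the differences are controlled
    by \<open>cond_mi\<close>, the sums by (u + v)^2 \<le> 2 u^2 + 2 v^2 with total at most
    4.\<close>
  have "(\<Sum>y\<in>RY. \<bar>pxq a q y - s a q y\<bar>)
      = (\<Sum>y\<in>RY. \<bar>sqrt (pxq a q y) - sqrt (s a q y)\<bar> * \<bar>sqrt (pxq a q y) + sqrt (s a q y)\<bar>)"
  proof (intro sum.cong refl)
    fix y
    have "pxq a q y - s a q y = (sqrt (pxq a q y) - sqrt (s a q y)) * (sqrt (pxq a q y) + sqrt (s a q y))"
      using ge0(1)[of a q y] s0[of a q y] by (simp add: algebra_simps)
    then show "\<bar>pxq a q y - s a q y\<bar> = \<bar>sqrt (pxq a q y) - sqrt (s a q y)\<bar> * \<bar>sqrt (pxq a q y) + sqrt (s a q y)\<bar>"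
      by (simp only: abs_mult)
  qed
  also have "\<dots> \<le> L2_set (\<lambda>y. sqrt (pxq a q y) - sqrt (s a q y)) RY * L2_set (\<lambda>y. sqrt (pxq a q y) + sqrt (s a q y)) RY"
    by (rule L2_set_mult_ineq)
  also have "\<dots> \<le> sqrt (cond_mi M X Q Y) * 2"
  proof (intro mult_mono)
    show "L2_set (\<lambda>y. sqrt (pxq a q y) - sqrt (s a q y)) RY \<le> sqrt (cond_mi M X Q Y)"
      unfolding L2_set_def
      using part[of "\<lambda>a q y. (sqrt (pxq a q y) - sqrt (s a q y))\<^sup>2"] main
      by (simp add: case_prod_beta')
    have "(\<Sum>y\<in>RY. (sqrt (pxq a q y) + sqrt (s a q y))\<^sup>2) \<le> (\<Sum>y\<in>RY. 2 * pxq a q y + 2 * s a q y)"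
    proof (intro sum_mono)
      fix y
      have "(sqrt (pxq a q y) + sqrt (s a q y))\<^sup>2 + (sqrt (pxq a q y) - sqrt (s a q y))\<^sup>2 = 2 * pxq a q y + 2 * s a q y"
        using ge0 s0 by (simp add: power2_sum power2_diff)
      then show "(sqrt (pxq a q y) + sqrt (s a q y))\<^sup>2 \<le> 2 * pxq a q y + 2 * s a q y"
        using zero_le_power2[of "sqrt (pxq a q y) - sqrt (s a q y)"] by linarith
    qed
    also have "\<dots> \<le> (\<Sum>(a, q, y)\<in>RX \<times> RQ \<times> RY. 2 * pxq a q y + 2 * s a q y)"
      by (rule part) (use ge0 s0 in auto)
    also have "\<dots> = 2 * (\<Sum>(a, q, y)\<in>RX \<times> RQ \<times> RY. pxq a q y) + 2 * (\<Sum>(a, q, y)\<in>RX \<times> RQ \<times> RY. s a q y)"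
      by (simp add: case_prod_beta' sum.distrib sum_distrib_left)
    also have "\<dots> = 2\<^sup>2" using sum_s sum_pxq by simp
    finally show "L2_set (\<lambda>y. sqrt (pxq a q y) + sqrt (s a q y)) RY \<le> 2"
      unfolding L2_set_def by (intro real_le_lsqrt) auto
  qed (use nn main in auto)
  finally show ?bound by (simp add: p_defs s_def RY_def mult.commute)
qed

end

section \<open>Conditional expectations as limits of fiber averages\<close>

text \<open>The elementary conditional probability of \<open>E\<close> given \<open>Y\<close>; on a
  null fibre division by zero makes it 0.\<close>

definition fiber_avg :: "'m measure \<Rightarrow> ('m \<Rightarrow> 'c) \<Rightarrow> 'm set \<Rightarrow> 'm \<Rightarrow> real" where
  "fiber_avg M Y E x = measure M {y \<in> E. Y y = Y x} / fiber_prob M Y x"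

text \<open>Approximability in measure by events of finite stage; it stands in for the
  \<open>Y m\<close> generating the family modulo null sets.\<close>

definition dense_in :: "'m measure \<Rightarrow> (nat \<Rightarrow> 'm \<Rightarrow> 'c) \<Rightarrow> 'm set set \<Rightarrow> bool" where
  "dense_in M Y \<A> \<longleftrightarrow> (\<forall>E\<in>\<A>. \<forall>e>0. \<exists>m S. measure M (sym_diff E {x \<in> space M. Y m x \<in> S}) < e)"

context prob_space
begin

lemma simple_function_fiber_avg:
  assumes "simple_function M Y" shows "simple_function M (fiber_avg M Y E)"
  unfolding fiber_avg_def[abs_def] fiber_prob_def by (rule simple_function_compose1[OF assms])

lemma fiber_avg_bounds:
  assumes Y: "simple_function M Y" and E: "E \<in> sets M"
  shows "0 \<le> fiber_avg M Y E x" "fiber_avg M Y E x \<le> 1"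
proof -
  have "measure M {y \<in> E. Y y = Y x} \<le> fiber_prob M Y x"
    unfolding fiber_prob_def using simple_function_fiber[OF Y] sets.sets_into_space[OF E]
    by (intro finite_measure_mono) auto
  moreover have "0 \<le> fiber_prob M Y x" by (simp add: fiber_prob_def)
  ultimately show "fiber_avg M Y E x \<le> 1" unfolding fiber_avg_def by (auto simp: divide_le_eq_1)
  show "0 \<le> fiber_avg M Y E x" by (simp add: fiber_avg_def fiber_prob_def)
qed

lemma integrable_comp_simple:
  fixes \<phi> :: "'c \<Rightarrow> real"
  assumes "simple_function M Y"
  shows "integrable M (\<lambda>x. \<phi> (Y x))"
  by (rule simple_function_integrable[OF simple_function_compose1[OF assms]])

text \<open>Fibres of \<open>Y\<close> lie in \<open>F\<close>, so \<open>fiber_avg\<close> is the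
  fibrewise mean of the conditional expectation, while \<phi> (Y x) is constant on fibres; averaging
  over fibres contracts the L^1 norm.\<close>

lemma fiber_avg_L1:
  assumes Y: "simple_function M Y" and E: "E \<in> sets M" and F: "subalgebra M F"
    and YF: "\<And>y. {x \<in> space M. Y x = y} \<in> sets F"
  shows "(\<integral>x. \<bar>fiber_avg M Y E x - \<phi> (Y x)\<bar> \<partial>M) \<le> (\<integral>x. \<bar>real_cond_exp M F (indicator E) x - \<phi> (Y x)\<bar> \<partial>M)"
proof -
  interpret F: finite_measure_subalgebra M F by unfold_locales (rule F)
  note [measurable] = simple_function_fiber[OF Y] E
  let ?g = "real_cond_exp M F (indicator E)"
  define p where "p = (\<lambda>y. prob {x \<in> space M. Y x = y})"
  define q where "q = (\<lambda>y. prob {x \<in> E. Y x = y})"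
  have EY: "{x \<in> E. Y x = y} = E \<inter> {x \<in> space M. Y x = y}" for y
    using sets.sets_into_space[OF E] by auto
  have fin: "finite (Y ` space M)" using Y by (rule simple_functionD)
  have iE: "integrable M (indicator E :: 'a \<Rightarrow> real)" by (simp add: emeasure_eq_measure)
  have ig: "integrable M ?g" using F.real_cond_exp_int(1)[OF iE] .
  have sphi: "simple_function M (\<lambda>x. \<phi> (Y x))" by (rule simple_function_compose1[OF Y])
  note [measurable] = borel_measurable_simple_function[OF sphi]
  have igd: "integrable M (\<lambda>x. ?g x - \<phi> (Y x))"
    using ig simple_function_integrable[OF sphi] by auto
  have key: "p y * \<bar>q y / p y - \<phi> y\<bar> \<le> (\<integral>x. \<bar>?g x - \<phi> (Y x)\<bar> * indicator {x \<in> space M. Y x = y} x \<partial>M)" for y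
  proof -
    have "q y = (\<integral>x. indicator {x \<in> space M. Y x = y} x * indicator E x \<partial>M)"
      unfolding q_def EY by (simp add: indicator_inter_arith[symmetric] Int_commute)
    also have "\<dots> = (\<integral>x. indicator {x \<in> space M. Y x = y} x * ?g x \<partial>M)"
      by (rule F.real_cond_exp_intg(2)[symmetric])
         (use YF in \<open>auto simp: indicator_inter_arith[symmetric] emeasure_eq_measure\<close>)
    finally have q: "q y = (\<integral>x. ?g x * indicator {x \<in> space M. Y x = y} x \<partial>M)" by (simp add: mult.commute)
    have i1: "integrable M (\<lambda>x. ?g x * indicator {x \<in> space M. Y x = y} x)"
      using ig by (intro integrable_real_mult_indicator) auto
    have i2: "integrable M (\<lambda>x. \<phi> y * indicator {x \<in> space M. Y x = y} x)"
      by (auto simp: emeasure_eq_measure)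
    have "p y * \<bar>q y / p y - \<phi> y\<bar> = \<bar>q y - \<phi> y * p y\<bar>"
    proof (cases "p y = 0")
      case True
      then have "q y = 0" using finite_measure_mono[of "E \<inter> {x \<in> space M. Y x = y}" "{x \<in> space M. Y x = y}"]
        unfolding q_def p_def EY by (simp add: antisym)
      then show ?thesis using True by simp
    next
      case False
      then have "p y > 0" by (simp add: p_def zero_less_measure_iff)
      then have "p y * \<bar>q y / p y - \<phi> y\<bar> = \<bar>p y * (q y / p y - \<phi> y)\<bar>" by (simp add: abs_mult)
      also have "p y * (q y / p y - \<phi> y) = q y - \<phi> y * p y" using False by (simp add: field_simps)
      finally show ?thesis .
    qed
    also have "q y - \<phi> y * p y = (\<integral>x. ?g x * indicator {x \<in> space M. Y x = y} x - \<phi> y * indicator {x \<in> space M. Y x = y} x \<partial>M)"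
      using i1 i2 by (simp add: q p_def)
    also have "\<dots> = (\<integral>x. (?g x - \<phi> (Y x)) * indicator {x \<in> space M. Y x = y} x \<partial>M)"
      by (intro Bochner_Integration.integral_cong) (auto simp: indicator_def)
    also have "\<bar>\<dots>\<bar> \<le> (\<integral>x. \<bar>(?g x - \<phi> (Y x)) * indicator {x \<in> space M. Y x = y} x\<bar> \<partial>M)"
      using integral_norm_bound[of M "\<lambda>x. (?g x - \<phi> (Y x)) * indicator {x \<in> space M. Y x = y} x"] by simp
    finally show ?thesis by (simp add: abs_mult)
  qed
  have "(\<integral>x. \<bar>fiber_avg M Y E x - \<phi> (Y x)\<bar> \<partial>M) = (\<integral>x. (\<lambda>y. \<bar>q y / p y - \<phi> y\<bar>) (Y x) \<partial>M)"
    by (simp add: fiber_avg_def fiber_prob_def q_def p_def)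
  also have "\<dots> = (\<Sum>y\<in>Y ` space M. p y * \<bar>q y / p y - \<phi> y\<bar>)"
    by (subst integral_simple[OF Y fin order_refl]) (simp add: p_def mult.commute)
  also have "\<dots> \<le> (\<Sum>y\<in>Y ` space M. (\<integral>x. \<bar>?g x - \<phi> (Y x)\<bar> * indicator {x \<in> space M. Y x = y} x \<partial>M))"
    by (intro sum_mono key)
  also have "\<dots> = (\<integral>x. (\<Sum>y\<in>Y ` space M. \<bar>?g x - \<phi> (Y x)\<bar> * indicator {x \<in> space M. Y x = y} x) \<partial>M)"
    using igd by (intro Bochner_Integration.integral_sum[symmetric] integrable_real_mult_indicator) auto
  also have "\<dots> = (\<integral>x. \<bar>?g x - \<phi> (Y x)\<bar> \<partial>M)"
  proof (intro Bochner_Integration.integral_cong refl)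
    fix x assume x: "x \<in> space M"
    have "(\<Sum>y\<in>Y ` space M. \<bar>?g x - \<phi> (Y x)\<bar> * indicator {x \<in> space M. Y x = y} x)
      = (\<Sum>y\<in>Y ` space M. if y = Y x then \<bar>?g x - \<phi> (Y x)\<bar> else 0)"
      using x by (intro sum.cong) (auto simp: indicator_def)
    then show "(\<Sum>y\<in>Y ` space M. \<bar>?g x - \<phi> (Y x)\<bar> * indicator {x \<in> space M. Y x = y} x) = \<bar>?g x - \<phi> (Y x)\<bar>"
      using x fin by (simp add: sum.delta)
  qed
  finally show ?thesis .
qed

end

section \<open>Conditional expectations along a refining sequence of finite partitions\<close>

locale filtration_to = prob_space M for M :: "'m measure" +
  fixes Y :: "nat \<Rightarrow> 'm \<Rightarrow> 'c" and F :: "'m measure"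
  assumes subalg: "subalgebra M F"
    and simple: "\<And>m. simple_function M (Y m)"
    and adapted: "\<And>m y. {x \<in> space M. Y m x = y} \<in> sets F"
    and refining: "\<And>m x y. x \<in> space M \<Longrightarrow> y \<in> space M \<Longrightarrow> Y (Suc m) x = Y (Suc m) y \<Longrightarrow> Y m x = Y m y"
    and dense: "dense_in M Y (sets F)"
begin

lemma refining_le:
  "m \<le> n \<Longrightarrow> x \<in> space M \<Longrightarrow> y \<in> space M \<Longrightarrow> Y n x = Y n y \<Longrightarrow> Y m x = Y m y"
proof (induction rule: dec_induct)
  case (step n)
  show ?case by (rule step.IH[OF step.prems(1,2) refining[OF step.prems]])
qed

lemma factor:
  assumes "m \<le> n" obtains f where "\<And>x. x \<in> space M \<Longrightarrow> Y m x = f (Y n x)"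
proof (rule that[of "\<lambda>v. Y m (SOME y. y \<in> space M \<and> Y n y = v)"])
  fix x assume x: "x \<in> space M"
  let ?z = "SOME y. y \<in> space M \<and> Y n y = Y n x"
  have "?z \<in> space M \<and> Y n ?z = Y n x"
    by (rule someI[of _ x]) (simp add: x)
  then show "Y m x = Y m ?z" by (intro refining_le[OF assms x]) simp_all
qed

lemma sets_F: "sets F \<subseteq> sets M"
  using subalg by (auto simp: subalgebra_def)

text \<open>Induction over integrable functions: indicators come from \<open>dense\<close>, a sum is
  handled at the later of two stages, and limits by dominated convergence.\<close>

lemma dense_functions:
  fixes g :: "'m \<Rightarrow> real"
  assumes g: "integrable (restr_to_subalg M F) g" and e: "0 < e"
  shows "\<exists>m \<phi>. (\<integral>x. \<bar>g x - \<phi> (Y m x)\<bar> \<partial>M) < e"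
proof -
  have "\<forall>e>0. \<exists>m \<phi>. (\<integral>x. \<bar>g x - \<phi> (Y m x)\<bar> \<partial>M) < e"
    using g
  proof (induction rule: integrable_induct)
    case (base A c)
    show ?case
    proof (intro allI impI)
      fix e :: real assume e: "e > 0"
      have A: "A \<in> sets F" using base subalg by (simp add: sets_restr_to_subalg)
      have "e / (\<bar>c\<bar> + 1) > 0" using e by (simp add: add_pos_nonneg)
      then obtain m S where mS: "prob (sym_diff A {x \<in> space M. Y m x \<in> S}) < e / (\<bar>c\<bar> + 1)"
        using dense A unfolding dense_in_def by meson
      have SM[measurable]: "{x \<in> space M. Y m x \<in> S} \<in> sets M"
        using simple_functionD(2)[OF simple[of m], of S] by (simp add: vimage_def Int_def conj_commute)
      have AM[measurable]: "A \<in> sets M" using A sets_F by auto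
      have "(\<integral>x. \<bar>indicator A x *\<^sub>R c - (\<lambda>y. c * indicator S y) (Y m x)\<bar> \<partial>M)
        = (\<integral>x. \<bar>c\<bar> * indicator (sym_diff A {x \<in> space M. Y m x \<in> S}) x \<partial>M)"
        by (intro Bochner_Integration.integral_cong) (auto simp: indicator_def)
      also have "\<dots> = \<bar>c\<bar> * prob (sym_diff A {x \<in> space M. Y m x \<in> S})"
        by (subst Bochner_Integration.integral_mult_right_zero) simp
      also have "\<dots> \<le> \<bar>c\<bar> * (e / (\<bar>c\<bar> + 1))" using mS by (intro mult_left_mono) auto
      also have "\<dots> < e" using e by (simp add: field_simps add_pos_nonneg)
      finally show "\<exists>m \<phi>. (\<integral>x. \<bar>indicator A x *\<^sub>R c - \<phi> (Y m x)\<bar> \<partial>M) < e"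
        by (intro exI[of _ m] exI[of _ "\<lambda>y. c * indicator S y"])
    qed
  next
    case (add f g)
    show ?case
    proof (intro allI impI)
      fix e :: real assume e: "e > 0"
      obtain m \<phi> where 1: "(\<integral>x. \<bar>f x - \<phi> (Y m x)\<bar> \<partial>M) < e / 2" using add.IH(1) e half_gt_zero by blast
      obtain n \<psi> where 2: "(\<integral>x. \<bar>g x - \<psi> (Y n x)\<bar> \<partial>M) < e / 2" using add.IH(2) e half_gt_zero by blast
      obtain F1 where F1: "\<And>x. x \<in> space M \<Longrightarrow> Y m x = F1 (Y (max m n) x)" using factor[of m "max m n"] by auto
      obtain F2 where F2: "\<And>x. x \<in> space M \<Longrightarrow> Y n x = F2 (Y (max m n) x)" using factor[of n "max m n"] by auto
      note fg = integrable_from_subalg[OF subalg add.hyps(1)] integrable_from_subalg[OF subalg add.hyps(2)]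
      have i: "integrable M (\<lambda>x. f x - \<phi> (Y m x))" "integrable M (\<lambda>x. g x - \<psi> (Y n x))"
        by (rule Bochner_Integration.integrable_diff[OF fg(1) integrable_comp_simple[OF simple]],
            rule Bochner_Integration.integrable_diff[OF fg(2) integrable_comp_simple[OF simple]])
      have "(\<integral>x. \<bar>f x + g x - (\<lambda>v. \<phi> (F1 v) + \<psi> (F2 v)) (Y (max m n) x)\<bar> \<partial>M)
          = (\<integral>x. \<bar>(f x - \<phi> (Y m x)) + (g x - \<psi> (Y n x))\<bar> \<partial>M)"
        using F1 F2 by (intro Bochner_Integration.integral_cong) (auto simp: algebra_simps)
      also have "\<dots> \<le> (\<integral>x. \<bar>f x - \<phi> (Y m x)\<bar> + \<bar>g x - \<psi> (Y n x)\<bar> \<partial>M)"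
        using i by (intro integral_mono) (auto intro!: Bochner_Integration.integrable_add)
      also have "\<dots> < e" using i 1 2 by simp
      finally show "\<exists>m \<phi>. (\<integral>x. \<bar>f x + g x - \<phi> (Y m x)\<bar> \<partial>M) < e"
        by (intro exI[of _ "max m n"] exI[of _ "\<lambda>v. \<phi> (F1 v) + \<psi> (F2 v)"])
    qed
  next
    case (lim f s)
    show ?case
    proof (intro allI impI)
      fix e :: real assume e: "e > 0"
      have f: "integrable M f" using integrable_from_subalg[OF subalg lim.hyps(4)] .
      have s: "integrable M (s i)" for i using integrable_from_subalg[OF subalg lim.hyps(1)] .
      note [measurable] = borel_measurable_integrable[OF f] borel_measurable_integrable[OF s]
      have sp: "space (restr_to_subalg M F) = space M" by (simp add: space_restr_to_subalg)
      have "(\<lambda>i. \<integral>x. \<bar>f x - s i x\<bar> \<partial>M) \<longlonglongrightarrow> (\<integral>x. 0 \<partial>M)"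
      \<comment> \<open>The approximants satisfy |s_i| \<le> 2 |f|, whence the dominating function 3
        |f|.\<close>
      proof (rule integral_dominated_convergence[where w = "\<lambda>x. 3 * \<bar>f x\<bar>"])
        show "AE x in M. (\<lambda>i. \<bar>f x - s i x\<bar>) \<longlonglongrightarrow> 0"
        proof (rule AE_I2)
          fix x assume "x \<in> space M"
          then have "(\<lambda>i. s i x) \<longlonglongrightarrow> f x" using lim.hyps(2) sp by auto
          then have "(\<lambda>i. \<bar>f x - s i x\<bar>) \<longlonglongrightarrow> \<bar>f x - f x\<bar>" by (intro tendsto_intros)
          then show "(\<lambda>i. \<bar>f x - s i x\<bar>) \<longlonglongrightarrow> 0" by simp
        qed
        show "AE x in M. norm \<bar>f x - s i x\<bar> \<le> 3 * \<bar>f x\<bar>" for i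
        proof (rule AE_I2)
          fix x assume "x \<in> space M"
          then have "norm (s i x) \<le> 2 * norm (f x)" using lim.hyps(3) sp by auto
          then show "norm \<bar>f x - s i x\<bar> \<le> 3 * \<bar>f x\<bar>" by simp
        qed
      qed (use f in auto)
      then have "eventually (\<lambda>i. (\<integral>x. \<bar>f x - s i x\<bar> \<partial>M) < e / 2) sequentially"
        using e by (intro order_tendstoD(2)) auto
      then obtain i where 1: "(\<integral>x. \<bar>f x - s i x\<bar> \<partial>M) < e / 2" by (auto simp: eventually_sequentially)
      obtain m \<phi> where 2: "(\<integral>x. \<bar>s i x - \<phi> (Y m x)\<bar> \<partial>M) < e / 2" using lim.IH[of i] e half_gt_zero by blast
      have p: "integrable M (\<lambda>x. \<phi> (Y m x))"
        by (rule integrable_comp_simple[OF simple])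
      have "(\<integral>x. \<bar>f x - \<phi> (Y m x)\<bar> \<partial>M) \<le> (\<integral>x. \<bar>f x - s i x\<bar> + \<bar>s i x - \<phi> (Y m x)\<bar> \<partial>M)"
        using p s f by (intro integral_mono) auto
      also have "\<dots> < e" using p s f 1 2 by simp
      finally show "\<exists>m \<phi>. (\<integral>x. \<bar>f x - \<phi> (Y m x)\<bar> \<partial>M) < e" by blast
    qed
  qed
  from this[rule_format, OF e] show ?thesis .
qed

lemma cond_exp_indicator_bounds:
  assumes "E \<in> sets M"
  shows "AE x in M. 0 \<le> real_cond_exp M F (indicator E) x \<and> real_cond_exp M F (indicator E) x \<le> 1"
proof -
  interpret F: finite_measure_subalgebra M F by unfold_locales (rule subalg)
  have "integrable M (indicator E :: 'm \<Rightarrow> real)" using assms by (simp add: emeasure_eq_measure)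
  then show ?thesis
    using F.real_cond_exp_ge_c[of "indicator E" 0] F.real_cond_exp_le_c[of "indicator E" 1] by auto
qed

text \<open>A weak form of Levy's upward theorem, by density instead of martingale convergence.\<close>

lemma fiber_avg_tendsto:
  assumes E[measurable]: "E \<in> sets M"
  shows "(\<lambda>m. \<integral>x. \<bar>fiber_avg M (Y m) E x - real_cond_exp M F (indicator E) x\<bar> \<partial>M) \<longlonglongrightarrow> 0"
proof (rule LIMSEQ_I)
  fix e :: real assume e: "0 < e"
  interpret F: finite_measure_subalgebra M F by unfold_locales (rule subalg)
  let ?g = "real_cond_exp M F (indicator E)"
  have iE: "integrable M (indicator E :: 'm \<Rightarrow> real)" by (simp add: emeasure_eq_measure)
  have g: "integrable M ?g" using F.real_cond_exp_int(1)[OF iE] .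
  then have "integrable (restr_to_subalg M F) ?g"
    by (intro integrable_in_subalg[OF subalg]) auto
  then obtain m \<phi> where m: "(\<integral>x. \<bar>?g x - \<phi> (Y m x)\<bar> \<partial>M) < e / 2"
    using dense_functions[of ?g "e / 2"] e by auto
  show "\<exists>no. \<forall>n\<ge>no. norm ((\<integral>x. \<bar>fiber_avg M (Y n) E x - ?g x\<bar> \<partial>M) - 0) < e"
  proof (intro exI[of _ m] allI impI)
    fix n assume "m \<le> n"
    then obtain f where f: "\<And>x. x \<in> space M \<Longrightarrow> Y m x = f (Y n x)" using factor by blast
    have a: "integrable M (fiber_avg M (Y n) E)"
      by (intro simple_function_integrable simple_function_fiber_avg simple)
    have p: "integrable M (\<lambda>x. \<phi> (f (Y n x)))"
      using integrable_comp_simple[OF simple, of "\<lambda>y. \<phi> (f y)"] .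
    have eq: "(\<integral>x. \<bar>?g x - \<phi> (f (Y n x))\<bar> \<partial>M) = (\<integral>x. \<bar>?g x - \<phi> (Y m x)\<bar> \<partial>M)"
      using f by (intro Bochner_Integration.integral_cong) auto
    have "(\<integral>x. \<bar>fiber_avg M (Y n) E x - ?g x\<bar> \<partial>M)
      \<le> (\<integral>x. \<bar>fiber_avg M (Y n) E x - \<phi> (f (Y n x))\<bar> + \<bar>?g x - \<phi> (f (Y n x))\<bar> \<partial>M)"
      using a p g by (intro integral_mono) auto
    also have "\<dots> = (\<integral>x. \<bar>fiber_avg M (Y n) E x - \<phi> (f (Y n x))\<bar> \<partial>M) + (\<integral>x. \<bar>?g x - \<phi> (f (Y n x))\<bar> \<partial>M)"
      using a p g by (intro Bochner_Integration.integral_add) auto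
    \<comment> \<open>By the contraction property the fibre average is no farther from the
      approximant than the conditional expectation is, so both halves cost less than e / 2.\<close>
    also have "\<dots> \<le> (\<integral>x. \<bar>?g x - \<phi> (f (Y n x))\<bar> \<partial>M) + (\<integral>x. \<bar>?g x - \<phi> (f (Y n x))\<bar> \<partial>M)"
      using fiber_avg_L1[OF simple E subalg adapted, of n "\<lambda>y. \<phi> (f y)"] by simp
    also have "\<dots> < e" using m by (simp add: eq)
    finally have "(\<integral>x. \<bar>fiber_avg M (Y n) E x - ?g x\<bar> \<partial>M) < e" .
    moreover have "0 \<le> (\<integral>x. \<bar>fiber_avg M (Y n) E x - ?g x\<bar> \<partial>M)"
      by (rule Bochner_Integration.integral_nonneg) simp
    ultimately show "norm ((\<integral>x. \<bar>fiber_avg M (Y n) E x - ?g x\<bar> \<partial>M) - 0) < e"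
      by (simp only: real_norm_def diff_0_right abs_of_nonneg)
  qed
qed

text \<open>Finite-stage independence holds up to twice the root of the mutual information
  (\<open>cond_mi_bound\<close>), and fibre averages converge in L^1 along all stages; smallness
  along a subsequence of stages is therefore enough.\<close>

lemma cond_indep_limit:
  assumes X: "simple_function M X" and Q: "simple_function M Q"
    and small: "\<And>e n. 0 < e \<Longrightarrow> \<exists>m\<ge>n. cond_mi M X Q (Y m) < e"
  shows "AE x in M. real_cond_exp M F (indicator {x \<in> space M. X x = a \<and> Q x = q}) x =
     real_cond_exp M F (indicator {x \<in> space M. X x = a}) x * real_cond_exp M F (indicator {x \<in> space M. Q x = q}) x"
proof -
  interpret F: finite_measure_subalgebra M F by unfold_locales (rule subalg)
  define A where "A = {x \<in> space M. X x = a}"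
  define B where "B = {x \<in> space M. Q x = q}"
  define C where "C = {x \<in> space M. X x = a \<and> Q x = q}"
  have [measurable]: "A \<in> sets M" "B \<in> sets M" "C \<in> sets M"
    unfolding A_def B_def C_def by (intro sets.sets_Collect_conj simple_function_fiber X Q)+
  define g where "g = (\<lambda>E x. real_cond_exp M F (indicator E) x)"
  define c where "c = (\<lambda>m. fiber_avg M (Y m))"
  have [measurable]: "g E \<in> borel_measurable M" for E unfolding g_def by measurable
  have gi: "integrable M (g E)" if "E \<in> sets M" for E
    unfolding g_def using F.real_cond_exp_int(1)[of "indicator E"] that by (simp add: emeasure_eq_measure)
  have cs: "simple_function M (c m E)" for m E
    unfolding c_def by (intro simple_function_fiber_avg simple)
  have ci: "integrable M (c m E)" for m E by (intro simple_function_integrable cs)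
  note [measurable] = borel_measurable_simple_function[OF cs]
  have gb: "AE x in M. 0 \<le> g E x \<and> g E x \<le> 1" if "E \<in> sets M" for E
    unfolding g_def by (rule cond_exp_indicator_bounds[OF that])
  have cb: "0 \<le> c m E x" "c m E x \<le> 1" if "E \<in> sets M" for m E x
    unfolding c_def using fiber_avg_bounds[OF simple that] by auto
  have bnd: "integrable M f" if "f \<in> borel_measurable M" "AE x in M. \<bar>f x\<bar> \<le> 1" for f :: "'m \<Rightarrow> real"
    using that by (intro integrable_const_bound[where B = 1]) auto
  have iAB: "integrable M (\<lambda>x. g C x - g A x * g B x)"
  proof (rule Bochner_Integration.integrable_diff)
    show "integrable M (\<lambda>x. g A x * g B x)"
    proof (rule bnd)
      show "AE x in M. \<bar>g A x * g B x\<bar> \<le> 1"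
        using gb[OF \<open>A \<in> sets M\<close>] gb[OF \<open>B \<in> sets M\<close>]
        by eventually_elim (simp add: abs_mult mult_le_one)
    qed measurable
  qed (use gi in simp)
  define D where "D = (\<lambda>E m. \<integral>x. \<bar>c m E x - g E x\<bar> \<partial>M)"
  have D: "D E \<longlonglongrightarrow> 0" if "E \<in> sets M" for E
    unfolding D_def c_def g_def by (rule fiber_avg_tendsto[OF that])
  have icAB: "integrable M (\<lambda>x. c m C x - c m A x * c m B x)" for m
  proof (rule Bochner_Integration.integrable_diff[OF ci bnd])
    have "\<bar>c m A x * c m B x\<bar> \<le> 1" for x
      using cb[OF \<open>A \<in> sets M\<close>] cb[OF \<open>B \<in> sets M\<close>] by (simp add: abs_mult mult_le_one)
    then show "AE x in M. \<bar>c m A x * c m B x\<bar> \<le> 1" by simp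
  qed measurable
  have est: "(\<integral>x. \<bar>g C x - g A x * g B x\<bar> \<partial>M) \<le> D C m + D A m + D B m + 2 * sqrt (cond_mi M X Q (Y m))" for m
  proof -
    have "(\<integral>x. \<bar>c m C x - c m A x * c m B x\<bar> \<partial>M)
      = (\<integral>x. (\<lambda>y. \<bar>prob {x \<in> C. Y m x = y} / prob {x \<in> space M. Y m x = y}
          - prob {x \<in> A. Y m x = y} / prob {x \<in> space M. Y m x = y} * (prob {x \<in> B. Y m x = y} / prob {x \<in> space M. Y m x = y})\<bar>) (Y m x) \<partial>M)"
      by (simp add: c_def fiber_avg_def fiber_prob_def)
    also have "\<dots> = (\<Sum>y\<in>Y m ` space M. \<bar>prob {x \<in> C. Y m x = y} / prob {x \<in> space M. Y m x = y}
          - prob {x \<in> A. Y m x = y} / prob {x \<in> space M. Y m x = y} * (prob {x \<in> B. Y m x = y} / prob {x \<in> space M. Y m x = y})\<bar>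
          * prob {x \<in> space M. Y m x = y})"
      by (subst integral_simple[OF simple]) (auto simp: simple_functionD[OF simple])
    also have "\<dots> \<le> (\<Sum>y\<in>Y m ` space M. \<bar>prob {x \<in> space M. X x = a \<and> Q x = q \<and> Y m x = y}
           - prob {x \<in> space M. X x = a \<and> Y m x = y} * prob {x \<in> space M. Q x = q \<and> Y m x = y}
             / prob {x \<in> space M. Y m x = y}\<bar>)"
    proof (intro sum_mono)
      fix y
      define p where "p = prob {x \<in> space M. Y m x = y}"
      have *: "{x \<in> C. Y m x = y} = {x \<in> space M. X x = a \<and> Q x = q \<and> Y m x = y}"
        "{x \<in> A. Y m x = y} = {x \<in> space M. X x = a \<and> Y m x = y}"
        "{x \<in> B. Y m x = y} = {x \<in> space M. Q x = q \<and> Y m x = y}" by (auto simp: A_def B_def C_def)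
      have "\<bar>u / p - v / p * (w / p)\<bar> * p \<le> \<bar>u - v * w / p\<bar>" for u v w
      proof (cases "p = 0")
        case False
        then have "p > 0" by (simp add: p_def zero_less_measure_iff)
        then have "\<bar>u / p - v / p * (w / p)\<bar> * p = \<bar>(u / p - v / p * (w / p)) * p\<bar>" by (simp add: abs_mult)
        also have "(u / p - v / p * (w / p)) * p = u - v * w / p" using False by (simp add: field_simps)
        finally show ?thesis by simp
      qed simp
      then show "\<bar>prob {x \<in> C. Y m x = y} / prob {x \<in> space M. Y m x = y}
          - prob {x \<in> A. Y m x = y} / prob {x \<in> space M. Y m x = y} * (prob {x \<in> B. Y m x = y} / prob {x \<in> space M. Y m x = y})\<bar>
          * prob {x \<in> space M. Y m x = y} \<le> \<bar>prob {x \<in> space M. X x = a \<and> Q x = q \<and> Y m x = y}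
           - prob {x \<in> space M. X x = a \<and> Y m x = y} * prob {x \<in> space M. Q x = q \<and> Y m x = y}
             / prob {x \<in> space M. Y m x = y}\<bar>"
        unfolding * p_def[symmetric] by blast
    qed
    also have "\<dots> \<le> 2 * sqrt (cond_mi M X Q (Y m))" by (rule cond_mi_bound(2)[OF X Q simple])
    finally have 1: "(\<integral>x. \<bar>c m C x - c m A x * c m B x\<bar> \<partial>M) \<le> 2 * sqrt (cond_mi M X Q (Y m))" .
    have "(\<integral>x. \<bar>g C x - g A x * g B x\<bar> \<partial>M)
      \<le> (\<integral>x. \<bar>c m C x - g C x\<bar> + \<bar>c m A x - g A x\<bar> + \<bar>c m B x - g B x\<bar> + \<bar>c m C x - c m A x * c m B x\<bar> \<partial>M)"
    proof (intro integral_mono_AE)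
      show "AE x in M. \<bar>g C x - g A x * g B x\<bar> \<le> \<bar>c m C x - g C x\<bar> + \<bar>c m A x - g A x\<bar> + \<bar>c m B x - g B x\<bar> + \<bar>c m C x - c m A x * c m B x\<bar>"
        using gb[OF \<open>A \<in> sets M\<close>] gb[OF \<open>B \<in> sets M\<close>]
      proof eventually_elim
        case (elim x)
        have e: "c m A x * c m B x - g A x * g B x = (c m A x - g A x) * c m B x + g A x * (c m B x - g B x)"
          by (simp add: algebra_simps)
        have "\<bar>(c m A x - g A x) * c m B x\<bar> \<le> \<bar>c m A x - g A x\<bar> * 1"
          unfolding abs_mult using cb[OF \<open>B \<in> sets M\<close>, of m x] by (intro mult_left_mono) auto
        moreover have "\<bar>g A x * (c m B x - g B x)\<bar> \<le> 1 * \<bar>c m B x - g B x\<bar>"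
          unfolding abs_mult using elim by (intro mult_right_mono) auto
        ultimately have "\<bar>c m A x * c m B x - g A x * g B x\<bar> \<le> \<bar>c m A x - g A x\<bar> + \<bar>c m B x - g B x\<bar>"
          unfolding e by (intro order_trans[OF abs_triangle_ineq add_mono]) simp_all
        then show ?case by linarith
      qed
    qed (use iAB gi ci icAB in \<open>auto intro!: Bochner_Integration.integrable_add integrable_abs Bochner_Integration.integrable_diff\<close>)
    also have "\<dots> = D C m + D A m + D B m + (\<integral>x. \<bar>c m C x - c m A x * c m B x\<bar> \<partial>M)"
      using gi ci icAB unfolding D_def
      by (simp add: Bochner_Integration.integral_add Bochner_Integration.integrable_add)
    finally show ?thesis using 1 by linarith
  qed
  have "(\<integral>x. \<bar>g C x - g A x * g B x\<bar> \<partial>M) \<le> 0 + e" if "e > 0" for e :: real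
  proof -
    have "(\<lambda>m. D C m + D A m + D B m) \<longlonglongrightarrow> 0 + 0 + 0" by (intro tendsto_add D) auto
    then have "eventually (\<lambda>m. D C m + D A m + D B m < e / 2) sequentially"
      using \<open>e > 0\<close> by (intro order_tendstoD(2)) auto
    then obtain n where n: "\<And>m. m \<ge> n \<Longrightarrow> D C m + D A m + D B m < e / 2" by (auto simp: eventually_sequentially)
    \<comment> \<open>The information enters as 2 sqrt (cond_mi), so (e / 4)^2 leaves e / 2.\<close>
    obtain m where m: "m \<ge> n" "cond_mi M X Q (Y m) < (e / 4)\<^sup>2" using small[of "(e / 4)\<^sup>2" n] \<open>e > 0\<close> by auto
    have "sqrt (cond_mi M X Q (Y m)) \<le> sqrt ((e / 4)\<^sup>2)" using m by (intro real_sqrt_le_mono) simp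
    also have "\<dots> = e / 4" using \<open>e > 0\<close> by simp
    finally show ?thesis using est[of m] n[OF m(1)] by linarith
  qed
  then have "(\<integral>x. \<bar>g C x - g A x * g B x\<bar> \<partial>M) \<le> 0" by (rule field_le_epsilon)
  then have "(\<integral>x. \<bar>g C x - g A x * g B x\<bar> \<partial>M) = 0"
    by (intro antisym Bochner_Integration.integral_nonneg) auto
  then have "AE x in M. \<bar>g C x - g A x * g B x\<bar> = 0"
    using integral_nonneg_eq_0_iff_AE[of M "\<lambda>x. \<bar>g C x - g A x * g B x\<bar>"] iAB by auto
  then show ?thesis unfolding g_def A_def B_def C_def by auto
qed

end

section \<open>Entropy rates\<close>

text \<open>The \<open>X\<close>-name of length \<open>n\<close> of an orbit; its fibres are the
  atoms of the partition refined over the times 0, ..., n - 1.\<close>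

definition hist :: "('m \<Rightarrow> 'm) \<Rightarrow> ('m \<Rightarrow> 'c) \<Rightarrow> nat \<Rightarrow> 'm \<Rightarrow> 'c list" where
  "hist T X n x = map (\<lambda>i. X ((T ^^ i) x)) [0..<n]"

lemma hist_0 [simp]: "hist T X 0 x = []"
  by (simp add: hist_def)

lemma hist_Suc: "hist T X (Suc n) x = X x # hist T X n (T x)"
  unfolding hist_def by (simp only: upt_conv_Cons[of 0 "Suc n"] zero_less_Suc list.map map_Suc_upt[symmetric] map_map)
    (simp add: funpow_swap1 comp_def)

lemma hist_add: "hist T X (n + m) x = hist T X n x @ hist T X m ((T ^^ n) x)"
  by (induction n arbitrary: x) (simp_all add: hist_Suc funpow_swap1)

lemma hist_eq_iff: "hist T X n x = hist T X n y \<longleftrightarrow> (\<forall>i<n. X ((T ^^ i) x) = X ((T ^^ i) y))"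
  by (auto simp: hist_def list_eq_iff_nth_eq)

lemma length_hist [simp]: "length (hist T X n x) = n"
  by (simp add: hist_def)

lemma hist_le: "m \<le> n \<Longrightarrow> hist T X n x = hist T X n y \<Longrightarrow> hist T X m x = hist T X m y"
  by (auto simp: hist_eq_iff)

context prob_space
begin

lemma ent_const: "ent M (\<lambda>x. c) = 0"
  by (simp add: ent_def fiber_prob_def prob_space)

lemma ent_submod:
  assumes "simple_function M X" "simple_function M Q" "simple_function M Y"
  shows "ent M (\<lambda>x. (X x, Q x, Y x)) + ent M Y \<le> ent M (\<lambda>x. (X x, Y x)) + ent M (\<lambda>x. (Q x, Y x))"
  using cond_mi_bound(1)[OF assms] by (simp add: cond_mi_def)

text \<open>Joining \<open>W\<close> to \<open>Y\<close> changes no entropy, so this is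
  submodularity for \<open>X\<close>, \<open>Y\<close> and \<open>W\<close>: conditioning on finer
  data lowers entropy.\<close>

lemma ent_cond_mono:
  assumes X: "simple_function M X" and Y: "simple_function M Y" and W: "simple_function M W"
    and f: "\<And>x y. x \<in> space M \<Longrightarrow> y \<in> space M \<Longrightarrow> Y x = Y y \<Longrightarrow> W x = W y"
  shows "ent M (\<lambda>x. (X x, Y x)) - ent M Y \<le> ent M (\<lambda>x. (X x, W x)) - ent M W"
proof -
  have "ent M (\<lambda>x. (X x, Y x, W x)) = ent M (\<lambda>x. (X x, Y x))" by (rule ent_cong) (simp, blast intro: f)
  moreover have "ent M (\<lambda>x. (Y x, W x)) = ent M Y" by (rule ent_cong) (simp, blast intro: f)
  ultimately show ?thesis using ent_submod[OF X Y W] by simp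
qed

end

locale measure_preserving_map = prob_space M for M :: "'m measure" +
  fixes T :: "'m \<Rightarrow> 'm"
  assumes T [measurable]: "T \<in> M \<rightarrow>\<^sub>M M" and distr_T: "distr M M T = M"
begin

lemma T_space: "x \<in> space M \<Longrightarrow> T x \<in> space M"
  using measurable_space[OF T] .

lemma T_pow [measurable]: "T ^^ n \<in> M \<rightarrow>\<^sub>M M"
  by (induction n) auto

lemma T_pow_space: "x \<in> space M \<Longrightarrow> (T ^^ n) x \<in> space M"
  using measurable_space[OF T_pow] .

lemma simple_T: "simple_function M X \<Longrightarrow> simple_function M (\<lambda>x. X (T x))"
proof (rule simple_function_countI)
  assume X: "simple_function M X"
  show "(\<lambda>x. X (T x)) \<in> M \<rightarrow>\<^sub>M count_space UNIV"
    using measurable_compose[OF T measurable_simple_function[OF X]] .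
  show "finite ((\<lambda>x. X (T x)) ` space M)"
    by (rule finite_subset[OF _ simple_functionD(1)[OF X]]) (use T_space in blast)
qed

lemma ent_T: "simple_function M X \<Longrightarrow> ent M (\<lambda>x. X (T x)) = ent M X"
  using ent_distr[OF T, of X] distr_T by simp

lemma AE_T: "AE x in M. P x \<Longrightarrow> AE x in M. P (T x)"
  using AE_distrD[OF T, of P] unfolding distr_T .

lemma AE_T_pow: "AE x in M. P x \<Longrightarrow> AE x in M. P ((T ^^ n) x)"
proof (induction n)
  case (Suc n)
  from AE_T[OF Suc.IH[OF Suc.prems]] show ?case by (simp add: funpow_swap1)
qed simp

lemma simple_hist: "simple_function M X \<Longrightarrow> simple_function M (hist T X n)"
proof (induction n)
  case 0 then show ?case by (simp add: hist_def[abs_def])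
next
  case (Suc n)
  have "simple_function M (\<lambda>x. X x # hist T X n (T x))"
    by (rule simple_function_compose2[OF Suc.prems simple_T[OF Suc.IH[OF Suc.prems]]])
  then show ?case by (simp add: hist_Suc[abs_def])
qed

text \<open>By invariance this is the entropy of \<open>X\<close> given the next \<open>n\<close>
  values (\<open>ent_incr_eq\<close>), which decreases in \<open>n\<close>; so the rate is both an
  infimum and a limit.\<close>

definition ent_incr :: "('m \<Rightarrow> 'c) \<Rightarrow> nat \<Rightarrow> real" where
  "ent_incr X n = ent M (hist T X (Suc n)) - ent M (hist T X n)"

definition ent_rate :: "('m \<Rightarrow> 'c) \<Rightarrow> real" where
  "ent_rate X = (INF n. ent_incr X n)"

lemma ent_hist_pair: "ent M (\<lambda>x. (X x, hist T X n (T x))) = ent M (hist T X (Suc n))"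
  by (rule ent_cong) (simp add: hist_Suc)

lemma ent_incr_eq:
  "simple_function M X \<Longrightarrow> ent_incr X n = ent M (\<lambda>x. (X x, hist T X n (T x))) - ent M (\<lambda>x. hist T X n (T x))"
  by (simp add: ent_incr_def ent_hist_pair ent_T simple_hist)

context
  fixes X :: "'m \<Rightarrow> 'c"
  assumes X: "simple_function M X"
begin

lemma decseq_ent_incr: "decseq (ent_incr X)"
proof (rule decseq_SucI)
  fix n
  show "ent_incr X (Suc n) \<le> ent_incr X n"
    unfolding ent_incr_eq[OF X]
    by (rule ent_cond_mono[OF X simple_T[OF simple_hist[OF X]] simple_T[OF simple_hist[OF X]]])
      (rule hist_le[of n "Suc n"], simp_all)
qed

lemma ent_incr_nonneg: "0 \<le> ent_incr X n"
proof -
  have "ent M (hist T X n) \<le> ent M (hist T X (Suc n))"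
    by (rule ent_mono[OF simple_hist[OF X] simple_hist[OF X]]) (rule hist_le[of n "Suc n"], simp_all)
  then show ?thesis by (simp add: ent_incr_def)
qed

lemma ent_rate_le: "ent_rate X \<le> ent_incr X n"
  unfolding ent_rate_def using ent_incr_nonneg by (intro cINF_lower bdd_belowI[of _ 0]) auto

lemma ent_incr_tendsto: "ent_incr X \<longlonglongrightarrow> ent_rate X"
  unfolding ent_rate_def using ent_incr_nonneg decseq_ent_incr
  by (intro LIMSEQ_decseq_INF bdd_belowI[of _ 0]) auto

lemma ent_rate_nonneg: "0 \<le> ent_rate X"
  unfolding ent_rate_def using ent_incr_nonneg by (intro cINF_greatest) auto

lemma ent_hist_eq_sum: "ent M (hist T X n) = (\<Sum>m<n. ent_incr X m)"
  by (induction n) (auto simp: ent_incr_def ent_const hist_def[abs_def])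

lemma ent_hist_ge: "real n * ent_rate X \<le> ent M (hist T X n)"
  using sum_mono[of "{..<n}" "\<lambda>_. ent_rate X" "ent_incr X"] ent_rate_le by (simp add: ent_hist_eq_sum)

text \<open>A Cesaro argument: all but finitely many increments are within e / 2 of the rate, and
  the initial block disappears after division by \<open>n\<close>.\<close>

lemma ent_hist_tendsto: "(\<lambda>n. ent M (hist T X n) / n) \<longlonglongrightarrow> ent_rate X"
proof (rule LIMSEQ_I)
  fix e :: real assume e: "0 < e"
  obtain N where N: "\<And>m. m \<ge> N \<Longrightarrow> ent_incr X m < ent_rate X + e / 2"
    using order_tendstoD(2)[OF ent_incr_tendsto, of "ent_rate X + e / 2"] e by (auto simp: eventually_sequentially)
  let ?H = "\<lambda>n. ent M (hist T X n)"
  have up: "?H n \<le> ?H N + (real n - real N) * (ent_rate X + e / 2)" if "n \<ge> N" for n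
    using that
  proof (induction n rule: dec_induct)
    case (step n)
    have "?H (Suc n) = ?H n + ent_incr X n" by (simp add: ent_incr_def)
    also have "\<dots> \<le> ?H N + (real n - real N) * (ent_rate X + e / 2) + (ent_rate X + e / 2)"
      using step.IH N[of n] step.hyps by linarith
    finally show ?case by (simp add: algebra_simps add_divide_distrib diff_divide_distrib)
  qed simp
  have lim: "(\<lambda>n. ?H N / real n) \<longlonglongrightarrow> 0" by (rule lim_const_over_n)
  obtain N2 where N2: "\<And>n. n \<ge> N2 \<Longrightarrow> ?H N / real n < e / 2"
    using order_tendstoD(2)[OF lim, of "e / 2"] e by (auto simp: eventually_sequentially)
  show "\<exists>no. \<forall>n\<ge>no. norm (?H n / n - ent_rate X) < e"
  proof (intro exI[of _ "max 1 (max N N2)"] allI impI)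
    fix n assume n: "n \<ge> max 1 (max N N2)"
    have "?H n \<le> ?H N + real n * (ent_rate X + e / 2)"
    proof -
      have "0 \<le> real N * (ent_rate X + e / 2)" using ent_rate_nonneg e by simp
      moreover have "?H n \<le> ?H N + (real n * (ent_rate X + e / 2) - real N * (ent_rate X + e / 2))"
        using up[of n] n by (simp add: left_diff_distrib)
      ultimately show ?thesis by linarith
    qed
    then have "?H n / n \<le> (?H N + real n * (ent_rate X + e / 2)) / n" by (rule divide_right_mono) simp
    also have "\<dots> = ?H N / n + (ent_rate X + e / 2)" using n by (simp add: add_divide_distrib)
    also have "\<dots> < ent_rate X + e"
    proof -
      have "?H N / real n < e / 2" by (rule N2) (use n in simp)
      then show ?thesis by linarith
    qed
    finally have 1: "?H n / n < ent_rate X + e" .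
    have "ent_rate X \<le> ?H n / n" using ent_hist_ge[of n] n by (simp add: field_simps)
    with 1 show "norm (?H n / n - ent_rate X) < e" by simp
  qed
qed

text \<open>Given \<open>Q\<close>, the entropy of \<open>K\<close> consecutive blocks is at most \<open>K\<close> times that of one block, and for
  large \<open>K\<close> the entropy of \<open>Q\<close> itself becomes negligible.\<close>

lemma ent_hist_invariant:
  assumes Q: "simple_function M Q" and inv: "AE x in M. Q (T x) = Q x"
  shows "real n * ent_rate X \<le> ent M (\<lambda>x. (hist T X n x, Q x)) - ent M Q"
proof -
  define c where "c = ent M (\<lambda>x. (hist T X n x, Q x)) - ent M Q"
  have inv_n: "AE x in M. Q ((T ^^ m) x) = Q x" for m
  proof (induction m)
    case (Suc m)
    from AE_T_pow[OF inv, of m] Suc.IH show ?case by eventually_elim simp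
  qed simp
  have sT: "simple_function M V \<Longrightarrow> simple_function M (\<lambda>x. V ((T ^^ m) x))"
    and eT: "simple_function M V \<Longrightarrow> ent M (\<lambda>x. V ((T ^^ m) x)) = ent M V" for V :: "'m \<Rightarrow> 'z" and m
  proof (induction m arbitrary: V)
    case (Suc m)
    { case 1 from Suc.IH(1)[OF simple_T[OF 1]] show ?case by simp }
    { case 2 from Suc.IH(2)[OF simple_T[OF 2]] ent_T[OF 2] show ?case by simp }
  qed simp_all
  have K: "ent M (\<lambda>x. (hist T X (K * n) x, Q x)) - ent M Q \<le> real K * c" for K
  proof (induction K)
    case 0
    have "ent M (\<lambda>x. (hist T X (0 * n) x, Q x)) = ent M Q" by (rule ent_cong) simp
    then show ?case by simp
  next
    case (Suc K)
    let ?V = "\<lambda>x. hist T X (K * n) ((T ^^ n) x)"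
    have sV: "simple_function M ?V" by (rule sT[OF simple_hist[OF X]])
    have sVQ: "simple_function M (\<lambda>x. (hist T X (K * n) x, Q x))" using simple_hist[OF X] Q by auto
    \<comment> \<open>Off a null set \<open>Q x\<close> equals \<open>Q ((T ^^ n) x)\<close>, so
      this pair is a translate of the previous one and has the same entropy.\<close>
    have "ent M (\<lambda>x. (?V x, Q x)) = ent M (\<lambda>x. (\<lambda>x. (hist T X (K * n) x, Q x)) ((T ^^ n) x))"
      by (rule ent_cong_AE) (use inv_n[of n] sV Q sT[OF sVQ, of n] in auto)
    also have "\<dots> = ent M (\<lambda>x. (hist T X (K * n) x, Q x))" by (rule eT[OF sVQ])
    finally have 1: "ent M (\<lambda>x. (?V x, Q x)) = ent M (\<lambda>x. (hist T X (K * n) x, Q x))" .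
    have "ent M (\<lambda>x. (hist T X (Suc K * n) x, Q x)) = ent M (\<lambda>x. (hist T X n x, ?V x, Q x))"
      by (rule ent_cong) (simp add: hist_add)
    with 1 ent_submod[OF simple_hist[OF X, of n] sV Q] Suc.IH show ?case
      by (simp add: c_def algebra_simps)
  qed
  \<comment> \<open>Only the term \<open>ent M Q\<close> fails to scale with \<open>K\<close>, so a
    positive gap would be contradictory for large \<open>K\<close>.\<close>
  have "real K * (real n * ent_rate X - c) \<le> ent M Q" for K
  proof -
    have "real (K * n) * ent_rate X \<le> ent M (hist T X (K * n))" by (rule ent_hist_ge)
    also have "\<dots> \<le> ent M (\<lambda>x. (hist T X (K * n) x, Q x))"
      by (rule ent_mono) (use simple_hist[OF X] Q in auto)
    finally show ?thesis using K[of K] by (simp add: algebra_simps)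
  qed
  then have "\<not> 0 < real n * ent_rate X - c"
    by (meson not_le reals_Archimedean3)
  then show ?thesis by (simp add: c_def)
qed

text \<open>Increments tending to 0 thus make \<open>X\<close> conditionally independent of itself
  given its future, that is, deterministic.\<close>

lemma cond_mi_self:
  "cond_mi M X X (\<lambda>x. hist T X m (T x)) = ent_incr X m"
proof -
  have "ent M (\<lambda>x. (X x, X x, hist T X m (T x))) = ent M (\<lambda>x. (X x, hist T X m (T x)))"
    by (rule ent_cong) auto
  then show ?thesis by (simp add: cond_mi_def ent_incr_eq[OF X])
qed

end

end

text \<open>If \<open>S\<close> and \<open>T\<close> commute and generate the same partitions, an event invariant under \<open>T\<close> carries
  no \<open>S\<close>-entropy: relative to it both maps keep the same entropy rate, and that rate is already the one of
  \<open>T\<close>.\<close>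

lemma (in prob_space) invariant_cond_mi_small:
  assumes S: "measure_preserving_map M S" and T: "measure_preserving_map M T"
    and comm: "\<And>x. x \<in> space M \<Longrightarrow> S (T x) = T (S x)"
    and X: "simple_function M X" and Q: "simple_function M Q"
    and same: "\<And>n x y. x \<in> space M \<Longrightarrow> y \<in> space M \<Longrightarrow> hist S X n x = hist S X n y \<longleftrightarrow> hist T X n x = hist T X n y"
    and inv: "AE x in M. Q (T x) = Q x" and e: "0 < e"
  shows "\<exists>m\<ge>n. cond_mi M X Q (\<lambda>x. hist S X m (S x)) < e"
proof (rule ccontr)
  interpret S: measure_preserving_map M S by fact
  interpret T: measure_preserving_map M T by fact
  define d where "d = (\<lambda>m. cond_mi M X Q (\<lambda>x. hist S X m (S x)))"
  assume "\<not> ?thesis"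
  then have big: "d m \<ge> e" if "m \<ge> n" for m using that by (auto simp: d_def not_less)
  have d0: "d m \<ge> 0" for m
    unfolding d_def by (rule cond_mi_bound(1)[OF X Q S.simple_T[OF S.simple_hist[OF X]]])
  have H: "ent M (hist T X m) = ent M (hist S X m)" for m by (rule ent_cong) (rule same)
  have rate: "T.ent_rate X = S.ent_rate X"
    by (simp add: T.ent_rate_def S.ent_rate_def T.ent_incr_def S.ent_incr_def H)
  \<comment> \<open>Since the maps commute, the whole \<open>S\<close>-history of \<open>Q\<close>
    is again \<open>T\<close>-invariant, as \<open>ent_hist_invariant\<close> will require.\<close>
  have comm_n: "(S ^^ i) (T x) = T ((S ^^ i) x)" if "x \<in> space M" for i x
    using that by (induction i) (auto simp: comm S.T_pow_space)
  have invQ: "AE x in M. hist S Q m (T x) = hist S Q m x" for m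
  proof -
    have "AE x in M. \<forall>i<m. Q (T ((S ^^ i) x)) = Q ((S ^^ i) x)"
      using S.AE_T_pow[OF inv] by (simp add: AE_ball_countable AE_all_countable AE_impI)
    moreover have "AE x in M. x \<in> space M" by simp
    ultimately show ?thesis by eventually_elim (simp add: hist_eq_iff comm_n)
  qed
  \<comment> \<open>Chain rule for the \<open>X\<close>-block given the \<open>Q\<close>-block: each
    new symbol costs at most its increment minus the information \<open>d i\<close> that the present
    value of \<open>Q\<close> supplies.\<close>
  have rel: "ent M (\<lambda>x. (hist S X m x, hist S Q m x)) - ent M (hist S Q m) \<le> (\<Sum>i<m. S.ent_incr X i - d i)" for m
  proof (induction m)
    case 0 show ?case by (simp add: ent_const hist_def[abs_def])
  next
    case (Suc m)
    let ?V = "\<lambda>x. hist S X m (S x)" and ?R = "\<lambda>x. hist S Q m (S x)"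
    have sV: "simple_function M ?V" and sR: "simple_function M ?R"
      by (intro S.simple_T S.simple_hist X Q)+
    have e1: "ent M (\<lambda>x. (hist S X (Suc m) x, hist S Q (Suc m) x)) = ent M (\<lambda>x. (X x, (?V x, (Q x, ?R x))))"
      by (rule ent_cong) (auto simp: hist_Suc)
    have e2: "ent M (hist S Q (Suc m)) = ent M (\<lambda>x. (Q x, ?R x))" by (rule ent_cong) (auto simp: hist_Suc)
    have e3: "ent M (\<lambda>x. (?V x, ?R x)) = ent M (\<lambda>x. (hist S X m x, hist S Q m x))"
      using S.ent_T[of "\<lambda>x. (hist S X m x, hist S Q m x)"] S.simple_hist[OF X] S.simple_hist[OF Q] by auto
    have "ent M (\<lambda>x. (X x, (?V x, (Q x, ?R x)))) - ent M (\<lambda>x. (?V x, (Q x, ?R x)))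
        \<le> ent M (\<lambda>x. (X x, (Q x, ?V x))) - ent M (\<lambda>x. (Q x, ?V x))"
      by (rule ent_cond_mono) (use X Q sV sR in auto)
    also have "\<dots> = S.ent_incr X m - d m"
      by (simp add: d_def cond_mi_def S.ent_incr_eq[OF X])
    finally have 1: "ent M (\<lambda>x. (X x, (?V x, (Q x, ?R x)))) - ent M (\<lambda>x. (?V x, (Q x, ?R x))) \<le> S.ent_incr X m - d m" .
    have 2: "ent M (\<lambda>x. (?V x, (Q x, ?R x))) - ent M (\<lambda>x. (Q x, ?R x)) \<le> ent M (\<lambda>x. (?V x, ?R x)) - ent M ?R"
      by (rule ent_cond_mono) (use Q sV sR in auto)
    have 3: "ent M ?R = ent M (hist S Q m)" by (rule S.ent_T[OF S.simple_hist[OF Q]])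
    show ?case using 1 2 Suc.IH by (simp add: e1 e2 e3 3)
  qed
  \<comment> \<open>Relative to the \<open>T\<close>-invariant variable \<open>hist S Q m\<close>
    the block keeps at least \<open>m\<close> times the rate of \<open>T\<close>, which equals that
    of \<open>S\<close>; so the \<open>d i\<close> can only use up the sublinear excess of the block
    entropy.\<close>
  have sumd: "(\<Sum>i<m. d i) \<le> ent M (hist S X m) - real m * S.ent_rate X" for m
  proof -
    have "real m * T.ent_rate X \<le> ent M (\<lambda>x. (hist T X m x, hist S Q m x)) - ent M (hist S Q m)"
      by (rule T.ent_hist_invariant[OF X S.simple_hist[OF Q] invQ])
    also have "ent M (\<lambda>x. (hist T X m x, hist S Q m x)) = ent M (\<lambda>x. (hist S X m x, hist S Q m x))"
      by (rule ent_cong) (use same in auto)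
    finally show ?thesis using rel[of m] by (simp add: rate sum_subtractf S.ent_hist_eq_sum[OF X])
  qed
  have low: "(real m - real n) * e \<le> (\<Sum>i<m. d i)" if "m \<ge> n" for m
    using that
  proof (induction m rule: dec_induct)
    case base show ?case using d0 by (simp add: sum_nonneg)
  next
    case (step m) then show ?case using big[of m] by (simp add: algebra_simps)
  qed
  have "(\<lambda>m. real n * e / real m) \<longlonglongrightarrow> 0" by (rule lim_const_over_n)
  then have lim1: "(\<lambda>m. e - real n * e / real m) \<longlonglongrightarrow> e - 0" by (intro tendsto_intros)
  have lim2: "(\<lambda>m. ent M (hist S X m) / m - S.ent_rate X) \<longlonglongrightarrow> S.ent_rate X - S.ent_rate X"
    by (intro tendsto_diff S.ent_hist_tendsto[OF X] tendsto_const)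
  have "eventually (\<lambda>m. e - real n * e / real m \<le> ent M (hist S X m) / m - S.ent_rate X) sequentially"
    using eventually_ge_at_top[of "max 1 n"]
  proof eventually_elim
    case (elim m)
    have "(real m - real n) * e / m \<le> (ent M (hist S X m) - real m * S.ent_rate X) / m"
      using low[of m] sumd[of m] elim by (intro divide_right_mono) auto
    then show ?case using elim by (simp add: field_simps)
  qed
  then have "e - 0 \<le> S.ent_rate X - S.ent_rate X"
    by (rule tendsto_le[OF sequentially_bot lim2 lim1])
  then show False using e by simp
qed

section \<open>Kolmogorov--Sinai entropy of finite-valued processes\<close>

definition cell :: "'m set set \<Rightarrow> 'm \<Rightarrow> 'm set" where
  "cell P x = (THE A. A \<in> P \<and> x \<in> A)"

lemma cell_eqI:
  assumes "partition_on S P" "A \<in> P" "x \<in> A"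
  shows "cell P x = A"
  unfolding cell_def
proof (rule the_equality)
  fix B assume "B \<in> P \<and> x \<in> B"
  then show "B = A" using assms disjointD[OF partition_onD2[OF assms(1)]] by blast
qed (use assms in auto)

lemma cell_mem:
  assumes "partition_on S P" "x \<in> S"
  shows "cell P x \<in> P" "x \<in> cell P x"
proof -
  obtain A where "A \<in> P" "x \<in> A" using assms by (auto simp: partition_on_def)
  then show "cell P x \<in> P" "x \<in> cell P x" using cell_eqI[OF assms(1)] by auto
qed

lemma simple_function_cell:
  assumes P: "finite P" "P \<subseteq> sets M" "partition_on (space M) P"
  shows "simple_function M (cell P)"
  unfolding simple_function_def
proof (intro conjI ballI)
  show "finite (cell P ` space M)"
    by (rule finite_subset[OF _ P(1)]) (use cell_mem(1)[OF P(3)] in blast)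
  fix A assume A: "A \<in> cell P ` space M"
  then have AP: "A \<in> P" using cell_mem(1)[OF P(3)] by blast
  have "cell P -` {A} \<inter> space M = A"
  proof
    show "cell P -` {A} \<inter> space M \<subseteq> A" using cell_mem(2)[OF P(3)] by blast
    show "A \<subseteq> cell P -` {A} \<inter> space M"
      using cell_eqI[OF P(3) AP] sets.sets_into_space[of A M] AP P(2) by blast
  qed
  then show "cell P -` {A} \<inter> space M \<in> sets M" using AP P(2) by auto
qed

context measure_preserving_map
begin

text \<open>An atom is fixed by the block visited at each time. For \<open>n = 0\<close> the empty
  intersection would be \<open>UNIV\<close> instead of \<open>space M\<close>.\<close>

lemma iterated_partition_eq:
  assumes P: "partition_on (space M) P" and n: "0 < n"
  shows "iterated_partition M T P n
    = (\<lambda>l. {x \<in> space M. hist T (cell P) n x = l}) ` (hist T (cell P) n ` space M)"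
    (is "_ = ?R")
proof -
  define PP where "PP = (\<lambda>i. (\<lambda>A. (T ^^ i) -` A \<inter> space M) ` P)"
  have IP: "iterated_partition M T P n = common_refinement (PP ` {..<n})"
    by (simp add: iterated_partition_def PP_def)
  have key: "\<Inter> (f ` PP ` {..<n}) = {y \<in> space M. hist T (cell P) n y = hist T (cell P) n x}"
    if x: "x \<in> space M" and f: "\<And>i. i < n \<Longrightarrow> f (PP i) \<in> PP i \<and> x \<in> f (PP i)" for f x
  proof -
    have "f (PP i) = (T ^^ i) -` cell P ((T ^^ i) x) \<inter> space M" if i: "i < n" for i
    proof -
      obtain A where A: "A \<in> P" "f (PP i) = (T ^^ i) -` A \<inter> space M" using f[OF i] by (auto simp: PP_def)
      then have "(T ^^ i) x \<in> A" using f[OF i] by auto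
      then show ?thesis using A cell_eqI[OF P] by simp
    qed
    then have "\<Inter> (f ` PP ` {..<n}) = (\<Inter>i<n. (T ^^ i) -` cell P ((T ^^ i) x) \<inter> space M)"
      unfolding image_image by (intro INF_cong) auto
    also have "\<dots> = {y \<in> space M. \<forall>i<n. (T ^^ i) y \<in> cell P ((T ^^ i) x)}" using n by auto
    also have "\<dots> = {y \<in> space M. hist T (cell P) n y = hist T (cell P) n x}"
    proof -
      have "(T ^^ i) y \<in> cell P ((T ^^ i) x) \<longleftrightarrow> cell P ((T ^^ i) y) = cell P ((T ^^ i) x)" if y: "y \<in> space M" for y i
        using cell_eqI[OF P cell_mem(1)[OF P T_pow_space[OF x, of i]], of "(T ^^ i) y"]
          cell_mem(2)[OF P T_pow_space[OF y, of i]] by auto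
      then show ?thesis by (auto simp: hist_eq_iff)
    qed
    finally show ?thesis .
  qed
  show ?thesis unfolding IP
  proof (intro set_eqI iffI)
    fix A assume "A \<in> common_refinement (PP ` {..<n})"
    then obtain f where f: "f \<in> (\<Pi> P\<in>PP ` {..<n}. P)" "A = \<Inter> (f ` PP ` {..<n})" "A \<noteq> {}"
      by (auto simp: common_refinement)
    then obtain x where x: "x \<in> A" by auto
    have fi: "f (PP i) \<in> PP i \<and> x \<in> f (PP i)" if "i < n" for i using f x that by auto
    have xs: "x \<in> space M" using fi[OF n] by (auto simp: PP_def)
    show "A \<in> ?R" using key[OF xs fi] f(2) xs by auto
  next
    fix A assume "A \<in> ?R"
    then obtain x where x: "x \<in> space M"
      and A: "A = {y \<in> space M. hist T (cell P) n y = hist T (cell P) n x}" by auto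
    \<comment> \<open>The choice runs over partitions rather than times, since the partitions at two
      times may coincide; selecting a block that contains \<open>x\<close> is consistent.\<close>
    define f where "f = (\<lambda>W. SOME B. B \<in> W \<and> x \<in> B)"
    have f: "f (PP i) \<in> PP i \<and> x \<in> f (PP i)" for i
      unfolding f_def
    proof (rule someI)
      show "(T ^^ i) -` cell P ((T ^^ i) x) \<inter> space M \<in> PP i
        \<and> x \<in> (T ^^ i) -` cell P ((T ^^ i) x) \<inter> space M"
        using cell_mem[OF P T_pow_space[OF x]] x by (auto simp: PP_def)
    qed
    have "A = \<Inter> (f ` PP ` {..<n})" using key[OF x f] A by simp
    moreover have "x \<in> A" using x A by auto
    moreover have "f \<in> (\<Pi> P\<in>PP ` {..<n}. P)" using f by auto
    ultimately show "A \<in> common_refinement (PP ` {..<n})" unfolding common_refinement by blast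
  qed
qed

lemma partition_entropy_hist:
  assumes P: "finite P" "P \<subseteq> sets M" "partition_on (space M) P" and n: "0 < n"
  shows "partition_entropy M (iterated_partition M T P n) = ent M (hist T (cell P) n)"
proof -
  have s: "simple_function M (hist T (cell P) n)" by (intro simple_hist simple_function_cell P)
  have inj: "inj_on (\<lambda>l. {x \<in> space M. hist T (cell P) n x = l}) (hist T (cell P) n ` space M)"
    by (rule inj_onI) blast
  show ?thesis
    unfolding partition_entropy_def iterated_partition_eq[OF P(3) n] sum.reindex[OF inj]
    by (subst ent_eq_sum[OF s simple_functionD(1)[OF s] order_refl]) (simp add: sum_negf)
qed

lemma partition_entropy_lim:
  assumes P: "finite P" "P \<subseteq> sets M" "partition_on (space M) P"
  shows "lim (\<lambda>n. ereal (partition_entropy M (iterated_partition M T P n) / real n)) = ereal (ent_rate (cell P))"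
proof (rule limI)
  have "(\<lambda>n. ereal (ent M (hist T (cell P) n) / real n)) \<longlonglongrightarrow> ereal (ent_rate (cell P))"
    by (intro tendsto_ereal ent_hist_tendsto simple_function_cell P)
  then show "(\<lambda>n. ereal (partition_entropy M (iterated_partition M T P n) / real n)) \<longlonglongrightarrow> ereal (ent_rate (cell P))"
    by (rule Lim_transform_eventually)
       (use eventually_gt_at_top[of 0] in eventually_elim, simp add: partition_entropy_hist[OF P])
qed

lemma ent_rate_cong:
  assumes "\<And>n. ent M (hist T X n) = ent M (hist T W n)"
  shows "ent_rate X = ent_rate W"
  unfolding ent_rate_def ent_incr_def assms ..

text \<open>The partition into fibres of \<open>X\<close> is one of the competitors in the
  supremum.\<close>

lemma ent_rate_zero_if_measure_entropy:
  assumes X: "simple_function M X" and "measure_entropy M T = 0"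
  shows "ent_rate X = 0"
proof -
  define P where "P = (\<lambda>a. {x \<in> space M. X x = a}) ` (X ` space M)"
  have P: "finite P" "P \<subseteq> sets M" "partition_on (space M) P"
    using simple_functionD(1)[OF X] simple_function_fiber[OF X]
    by (auto simp: P_def intro!: partition_onI simp: disjnt_def)
  have "cell P x = {y \<in> space M. X y = X x}" if "x \<in> space M" for x
    using that by (intro cell_eqI[OF P(3)]) (auto simp: P_def)
  then have "cell P x = cell P y \<longleftrightarrow> X x = X y" if "x \<in> space M" "y \<in> space M" for x y
    using that by auto
  then have "ent M (hist T (cell P) n) = ent M (hist T X n)" for n
    by (intro ent_cong) (simp add: hist_eq_iff T_pow_space)
  then have "ent_rate (cell P) = ent_rate X" by (rule ent_rate_cong)
  moreover have "ereal (ent_rate (cell P)) \<le> measure_entropy M T"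
    unfolding measure_entropy_def partition_entropy_lim[OF P, symmetric]
    using P by (intro SUP_upper) auto
  ultimately show ?thesis using assms(2) ent_rate_nonneg[OF X] by (simp add: zero_ereal_def)
qed

text \<open>Each symbol of \<open>W\<close> is charged its entropy given the \<open>N\<close>
  symbols of \<open>X\<close> from that time on; covering \<open>n\<close> symbols of
  \<open>W\<close> takes \<open>n + N\<close> of \<open>X\<close>, and the extra \<open>N\<close>
  are negligible.\<close>

lemma ent_rate_le_cond:
  assumes X: "simple_function M X" and W: "simple_function M W"
  shows "ent_rate W \<le> ent_rate X + (ent M (\<lambda>x. (W x, hist T X N x)) - ent M (hist T X N))"
proof -
  define c where "c = ent M (\<lambda>x. (W x, hist T X N x)) - ent M (hist T X N)"
  note sX = simple_hist[OF X] and sW = simple_hist[OF W]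
  have ind: "ent M (\<lambda>x. (hist T W n x, hist T X (n + N) x)) - ent M (hist T X (n + N)) \<le> real n * c" for n
  proof (induction n)
    case 0
    have "ent M (\<lambda>x. (hist T W 0 x, hist T X (0 + N) x)) = ent M (hist T X (0 + N))" by (rule ent_cong) simp
    then show ?case by simp
  next
    case (Suc n)
    let ?V = "\<lambda>x. hist T W n (T x)" and ?Y = "\<lambda>x. hist T X (n + N) (T x)" and ?H = "hist T X (Suc n + N)"
    have sV: "simple_function M ?V" and sY: "simple_function M ?Y" by (rule simple_T[OF sW], rule simple_T[OF sX])
    have e1: "ent M (\<lambda>x. (hist T W (Suc n) x, ?H x)) = ent M (\<lambda>x. (W x, ?V x, ?H x))"
      by (rule ent_cong) (auto simp: hist_Suc)
    have 1: "ent M (\<lambda>x. (W x, ?H x)) - ent M ?H \<le> c"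
      unfolding c_def
    proof (rule ent_cond_mono[OF W sX sX])
      fix x y assume "?H x = ?H y" then show "hist T X N x = hist T X N y" by (rule hist_le[rotated]) simp
    qed
    have "ent M (\<lambda>x. (?V x, ?H x)) - ent M ?H \<le> ent M (\<lambda>x. (?V x, ?Y x)) - ent M ?Y"
      by (rule ent_cond_mono[OF sV sX sY]) (simp add: hist_Suc)
    also have "ent M (\<lambda>x. (?V x, ?Y x)) = ent M (\<lambda>x. (hist T W n x, hist T X (n + N) x))"
      using ent_T[of "\<lambda>x. (hist T W n x, hist T X (n + N) x)"] sW sX by auto
    also have "ent M ?Y = ent M (hist T X (n + N))" by (rule ent_T[OF sX])
    finally have 2: "ent M (\<lambda>x. (?V x, ?H x)) - ent M ?H \<le> real n * c" using Suc.IH by simp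
    show ?case using ent_submod[OF W sV sX, of "Suc n + N"] 1 2 unfolding e1 by (simp add: algebra_simps)
  qed
  have "eventually (\<lambda>n. ent M (hist T W n) / real n \<le> ent M (hist T X n) / real n + ent M (hist T X N) / real n + c) sequentially"
    using eventually_gt_at_top[of 0]
  proof eventually_elim
    case (elim n)
    have "ent M (hist T W n) \<le> ent M (\<lambda>x. (hist T W n x, hist T X (n + N) x))"
      by (rule ent_mono) (use sW sX in auto)
    also have "\<dots> \<le> ent M (hist T X (n + N)) + real n * c" using ind[of n] by simp
    also have "ent M (hist T X (n + N)) \<le> ent M (hist T X n) + ent M (hist T X N)"
      using decseq_ent_incr[OF X]
    proof (induction n)
      case 0 then show ?case by (simp add: ent_const hist_def[abs_def])
    next
      case (Suc n)
      have "ent_incr X (n + N) \<le> ent_incr X n" using Suc.prems by (simp add: decseq_def)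
      then show ?case using Suc by (simp add: ent_incr_def)
    qed
    finally have "ent M (hist T W n) / real n \<le> (ent M (hist T X n) + ent M (hist T X N) + real n * c) / real n"
      by (intro divide_right_mono) auto
    then show ?case using elim by (simp add: add_divide_distrib)
  qed
  moreover have "(\<lambda>n. ent M (hist T X n) / real n + ent M (hist T X N) / real n + c) \<longlonglongrightarrow> ent_rate X + 0 + c"
    by (intro tendsto_intros ent_hist_tendsto X lim_const_over_n)
  ultimately have "ent_rate W \<le> ent_rate X + 0 + c"
    by (intro tendsto_le[OF sequentially_bot _ ent_hist_tendsto[OF W]]) auto
  then show ?thesis by (simp add: c_def)
qed

end

text \<open>A modulus for the entropy function near 0 and 1: with u = sqrt t one has -ln t \<le> 2
  (1 / u - 1), then 2 w \<le> d + w^2 / d for w = u (1 - u). It turns L^1 closeness to an indicator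
  into small conditional entropy.\<close>

lemma eta_le:
  fixes t d :: real
  assumes t: "0 \<le> t" "t \<le> 1" and d: "0 < d"
  shows "- (t * ln t) \<le> d + t * (1 - t) / d"
proof (cases "t = 0")
  case False
  then have t0: "0 < t" using t by simp
  define u where "u = sqrt t"
  have u: "0 < u" "u \<le> 1" "t = u\<^sup>2" using t0 t by (auto simp: u_def)
  have "ln (1 / u) \<le> 1 / u - 1" using u by (intro ln_le_minus_one) auto
  then have "- ln u \<le> 1 / u - 1" using u by (simp add: ln_div)
  moreover have "ln t = 2 * ln u" using u by (simp add: ln_realpow)
  ultimately have "- ln t \<le> 2 * (1 / u - 1)"
    using mult_left_mono[of "- ln u" "1 / u - 1" 2] by simp
  then have "t * (- ln t) \<le> t * (2 * (1 / u - 1))" using t0 by (intro mult_left_mono) auto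
  then have "- (t * ln t) \<le> t * (2 * (1 / u - 1))" by simp
  also have "\<dots> = 2 * (u * (1 - u))" using u by (simp add: field_simps power2_eq_square)
  also have "\<dots> \<le> d + (u * (1 - u))\<^sup>2 / d"
  proof -
    have "0 \<le> (d - u * (1 - u))\<^sup>2 / d" using d by simp
    also have "\<dots> = d - 2 * (u * (1 - u)) + (u * (1 - u))\<^sup>2 / d" using d by (simp add: power2_eq_square field_simps)
    finally show ?thesis by simp
  qed
  also have "(u * (1 - u))\<^sup>2 \<le> t * (1 - t)"
  proof -
    have "(1 - u)\<^sup>2 \<le> (1 - u) * (1 + u)" unfolding power2_eq_square using u by (intro mult_left_mono) auto
    also have "\<dots> = 1 - t" using u by (simp add: power2_eq_square algebra_simps)
    finally show ?thesis unfolding power_mult_distrib u(3)[symmetric] using t0 by (intro mult_left_mono) auto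
  qed
  finally show ?thesis using d by (simp add: divide_right_mono)
qed (use d in simp)

context prob_space
begin

lemma ent_cond_eq_sum:
  assumes W: "simple_function M W" and Y: "simple_function M Y"
  shows "ent M (\<lambda>x. (W x, Y x)) - ent M Y = (\<Sum>w\<in>W ` space M.
     \<integral>x. - (fiber_avg M Y {y \<in> space M. W y = w} x * ln (fiber_avg M Y {y \<in> space M. W y = w} x)) \<partial>M)"
proof -
  define p where "p = (\<lambda>y. prob {x \<in> space M. Y x = y})"
  define q where "q = (\<lambda>w y. prob {x \<in> space M. W x = w \<and> Y x = y})"
  have finW: "finite (W ` space M)" and finY: "finite (Y ` space M)" using W Y by (auto simp: simple_functionD)
  note [measurable] = simple_function_fiber[OF W] simple_function_fiber[OF Y]
  have sets: "{x \<in> space M. W x = w \<and> Y x = y} \<in> sets M" for w y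
    by (intro sets.sets_Collect_conj simple_function_fiber W Y)
  have ql: "q w y \<le> p y" for w y unfolding q_def p_def by (rule finite_measure_mono) auto
  have q0: "0 \<le> q w y" for w y by (simp add: q_def)
  have sq: "(\<Sum>w\<in>W ` space M. q w y) = p y" for y
  proof -
    have "{x \<in> {x \<in> space M. Y x = y}. W x = w} = {x \<in> space M. W x = w \<and> Y x = y}" for w by auto
    then show ?thesis
      using sum_fibers[OF W finW order_refl, of "{x \<in> space M. Y x = y}"] by (simp add: q_def p_def)
  qed
  have avg: "fiber_avg M Y {y \<in> space M. W y = w} x = q w (Y x) / p (Y x)" for w x
    by (simp add: fiber_avg_def fiber_prob_def p_def q_def)
  have "(\<Sum>w\<in>W ` space M. \<integral>x. - (fiber_avg M Y {y \<in> space M. W y = w} x * ln (fiber_avg M Y {y \<in> space M. W y = w} x)) \<partial>M)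
     = (\<Sum>w\<in>W ` space M. \<Sum>y\<in>Y ` space M. - (q w y / p y * ln (q w y / p y)) * p y)"
  proof (intro sum.cong refl)
    fix w
    show "(\<integral>x. - (fiber_avg M Y {y \<in> space M. W y = w} x * ln (fiber_avg M Y {y \<in> space M. W y = w} x)) \<partial>M)
      = (\<Sum>y\<in>Y ` space M. - (q w y / p y * ln (q w y / p y)) * p y)"
      unfolding avg p_def[symmetric]
      using integral_simple[OF Y finY order_refl, of "\<lambda>y. - (q w y / p y * ln (q w y / p y))"]
      by (simp add: p_def)
  qed
  also have "\<dots> = (\<Sum>w\<in>W ` space M. \<Sum>y\<in>Y ` space M. - (q w y * ln (q w y)) + q w y * ln (p y))"
  proof (intro sum.cong refl)
    fix w y
    show "- (q w y / p y * ln (q w y / p y)) * p y = - (q w y * ln (q w y)) + q w y * ln (p y)"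
    proof (cases "q w y = 0")
      case False
      then have "q w y > 0" "p y > 0" using q0[of w y] ql[of w y] by linarith+
      then show ?thesis by (simp add: ln_div algebra_simps)
    qed simp
  qed
  also have "\<dots> = (\<Sum>w\<in>W ` space M. \<Sum>y\<in>Y ` space M. - (q w y * ln (q w y))) + (\<Sum>y\<in>Y ` space M. \<Sum>w\<in>W ` space M. q w y * ln (p y))"
    unfolding sum.distrib by (subst (3) sum.swap) (rule refl)
  also have "(\<Sum>y\<in>Y ` space M. \<Sum>w\<in>W ` space M. q w y * ln (p y)) = (\<Sum>y\<in>Y ` space M. p y * ln (p y))"
    by (simp add: sum_distrib_right[symmetric] sq)
  also have "(\<Sum>w\<in>W ` space M. \<Sum>y\<in>Y ` space M. - (q w y * ln (q w y))) = ent M (\<lambda>x. (W x, Y x))"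
  proof -
    have s: "simple_function M (\<lambda>x. (W x, Y x))" using W Y by auto
    show ?thesis
      by (subst ent_eq_sum[OF s, of "W ` space M \<times> Y ` space M"])
         (use finW finY in \<open>auto simp: q_def sum.cartesian_product case_prod_beta' prod_eq_iff\<close>)
  qed
  also have "(\<Sum>y\<in>Y ` space M. p y * ln (p y)) = - ent M Y"
    by (subst ent_eq_sum[OF Y finY order_refl]) (simp add: p_def sum_negf)
  finally show ?thesis by simp
qed

end

text \<open>The zero-entropy case of the generator theorem: given a long \<open>X\<close>-block, the
  conditional probabilities of the cells of any partition approach indicators, so the bound of
  \<open>ent_rate_le_cond\<close> tends to 0.\<close>

lemma (in measure_preserving_map) measure_entropy_zero:
  assumes X: "simple_function M X" and dense: "dense_in M (hist T X) (sets M)" and zero: "ent_rate X = 0"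
  shows "measure_entropy M T = 0"
proof -
  \<comment> \<open>The limiting sigma-algebra is that of \<open>M\<close> itself, so the
    conditional expectations are the indicators.\<close>
  interpret F: filtration_to M "hist T X" M
  proof
    show "subalgebra M M" by (simp add: subalgebra_def)
    show "simple_function M (hist T X m)" "{x \<in> space M. hist T X m x = y} \<in> sets M" for m y
      using simple_hist[OF X] simple_function_fiber by auto
    show "dense_in M (hist T X) (sets M)" by fact
  qed (auto intro: hist_le[of m "Suc m" for m])
  interpret MM: finite_measure_subalgebra M M by unfold_locales (simp add: subalgebra_def)
  have rate: "ent_rate (cell P) = 0" if P: "finite P" "P \<subseteq> sets M" "partition_on (space M) P" for P
  proof -
    let ?W = "cell P"
    have W: "simple_function M ?W" by (rule simple_function_cell[OF P])
    define E where "E = (\<lambda>w. {x \<in> space M. ?W x = w})"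
    have E[measurable]: "E w \<in> sets M" for w unfolding E_def by (rule simple_function_fiber[OF W])
    define R where "R = ?W ` space M"
    have R: "finite R" unfolding R_def using W by (rule simple_functionD)
    define g where "g = (\<lambda>N w. \<integral>x. \<bar>fiber_avg M (hist T X N) (E w) x - indicator (E w) x\<bar> \<partial>M)"
    have g_tendsto: "(\<lambda>N. g N w) \<longlonglongrightarrow> 0" for w
    proof -
      have "AE x in M. real_cond_exp M M (indicator (E w)) x = indicator (E w) x"
        by (rule MM.real_cond_exp_F_meas) (auto simp: emeasure_eq_measure)
      then have "g N w = (\<integral>x. \<bar>fiber_avg M (hist T X N) (E w) x - real_cond_exp M M (indicator (E w)) x\<bar> \<partial>M)" for N
        unfolding g_def
        by (intro integral_cong_AE)
           (use borel_measurable_simple_function[OF simple_function_fiber_avg[OF simple_hist[OF X]]] in auto)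
      then show ?thesis using F.fiber_avg_tendsto[OF E] by simp
    qed
    have bound: "ent_rate ?W \<le> (\<Sum>w\<in>R. d + g N w / d)" if d: "0 < d" for d N
    proof -
      have "ent_rate ?W \<le> ent M (\<lambda>x. (?W x, hist T X N x)) - ent M (hist T X N)"
        using ent_rate_le_cond[OF X W, of N] zero by simp
      also have "\<dots> = (\<Sum>w\<in>R. \<integral>x. - (fiber_avg M (hist T X N) (E w) x * ln (fiber_avg M (hist T X N) (E w) x)) \<partial>M)"
        unfolding ent_cond_eq_sum[OF W simple_hist[OF X]] E_def R_def ..
      also have "\<dots> \<le> (\<Sum>w\<in>R. d + g N w / d)"
      proof (intro sum_mono)
        fix w
        let ?c = "fiber_avg M (hist T X N) (E w)"
        have sc: "simple_function M ?c" by (intro simple_function_fiber_avg simple_hist X)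
        have ic: "integrable M ?c" by (rule simple_function_integrable[OF sc])
        have "(\<integral>x. - (?c x * ln (?c x)) \<partial>M) \<le> (\<integral>x. d + \<bar>?c x - indicator (E w) x\<bar> / d \<partial>M)"
        proof (rule integral_mono)
          show "integrable M (\<lambda>x. - (?c x * ln (?c x)))"
            using integrable_comp_simple[OF sc, of "\<lambda>t. - (t * ln t)"] .
          show "integrable M (\<lambda>x. d + \<bar>?c x - indicator (E w) x\<bar> / d)"
            using ic by (auto simp: emeasure_eq_measure)
          fix x
          have b: "0 \<le> ?c x" "?c x \<le> 1" using fiber_avg_bounds[OF simple_hist[OF X] E] by auto
          have "?c x * (1 - ?c x) \<le> \<bar>?c x - indicator (E w) x\<bar>"
            using b mult_left_le[of "1 - ?c x" "?c x"] mult_left_le_one_le[of "1 - ?c x" "?c x"]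
            by (auto simp: indicator_def)
          then have "?c x * (1 - ?c x) / d \<le> \<bar>?c x - indicator (E w) x\<bar> / d"
            using d by (intro divide_right_mono) auto
          then show "- (?c x * ln (?c x)) \<le> d + \<bar>?c x - indicator (E w) x\<bar> / d"
            using eta_le[OF b d] by linarith
        qed
        also have "\<dots> = d + g N w / d"
          using ic unfolding g_def
          by (subst Bochner_Integration.integral_add) (auto simp: emeasure_eq_measure prob_space)
        finally show "(\<integral>x. - (?c x * ln (?c x)) \<partial>M) \<le> d + g N w / d" .
      qed
      finally show ?thesis .
    qed
    have "ent_rate ?W \<le> 0 + e" if e: "0 < e" for e
    proof -
      define d where "d = e / (1 + real (card R))"
      have d: "0 < d" "real (card R) * d < e" using e by (auto simp: d_def field_simps)
      have "(\<lambda>N. \<Sum>w\<in>R. d + g N w / d) \<longlonglongrightarrow> (\<Sum>w\<in>R. d + 0 / d)"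
        by (intro tendsto_intros g_tendsto) (use d in auto)
      then have "ent_rate ?W \<le> (\<Sum>w\<in>R. d + 0 / d)"
        by (rule LIMSEQ_le_const) (use bound[OF d(1)] in auto)
      then show ?thesis using d by simp
    qed
    then have "ent_rate ?W \<le> 0" by (rule field_le_epsilon)
    then show ?thesis using ent_rate_nonneg[OF W] by simp
  qed
  let ?PP = "{P. finite P \<and> P \<subseteq> sets M \<and> partition_on (space M) P}"
  have "{space M} \<in> ?PP" using not_empty by (auto simp: partition_on_def)
  then have ne: "?PP \<noteq> {}" by blast
  have "measure_entropy M T = (SUP P\<in>?PP. 0)"
    unfolding measure_entropy_def
    by (rule SUP_cong) (auto simp: partition_entropy_lim rate zero_ereal_def)
  then show ?thesis using ne by simp
qed

section \<open>Shift-invariant measures on sequence spaces\<close>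

definition cyl :: "'b list \<Rightarrow> (nat \<Rightarrow> 'b) set" where
  "cyl l = {x. \<forall>i<length l. x i = l ! i}"

definition first :: "(nat \<Rightarrow> 'b) \<Rightarrow> 'b" where
  "first x = x 0"

lemma shift_pow: "(shift ^^ n) x = (\<lambda>i. x (n + i))"
proof (induction n)
  case (Suc n)
  have "(shift ^^ Suc n) x = shift ((shift ^^ n) x)" by simp
  also have "\<dots> = shift (\<lambda>i. x (n + i))" by (simp only: Suc.IH)
  also have "\<dots> = (\<lambda>i. x (Suc n + i))" by (simp add: shift_def)
  finally show ?case .
qed simp

lemma hist_first: "hist shift first n x = map x [0..<n]"
  unfolding hist_def first_def shift_pow by simp

lemma cyl_eq: "cyl l = {x. hist shift first (length l) x = l}"
proof -
  have "map x [0..<length l] = l \<longleftrightarrow> (\<forall>i<length l. x i = l ! i)" for x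
    by (subst list_eq_iff_nth_eq) simp
  then show ?thesis by (simp add: cyl_def hist_first)
qed

lemma cyl_Nil [simp]: "cyl [] = UNIV"
  by (simp add: cyl_def)

lemma cyl_Cons: "x \<in> cyl (a # l) \<longleftrightarrow> first x = a \<and> shift x \<in> cyl l"
  by (simp add: cyl_def first_def shift_def All_less_Suc2)

lemma shift_case_nat [simp]: "shift (case_nat a y) = y"
  by (simp add: shift_def)

lemma first_case_nat [simp]: "first (case_nat a y) = a"
  by (simp add: first_def)

lemma case_nat_first_shift: "case_nat (first x) (shift x) = x"
proof
  fix i show "case_nat (first x) (shift x) i = x i" by (cases i) (simp_all add: first_def shift_def)
qed

lemma seq_eqI:
  assumes "first x = first y" "shift x = shift y" shows "x = y"
proof -
  have "x = case_nat (first x) (shift x)" by (simp only: case_nat_first_shift)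
  also have "\<dots> = y" unfolding assms by (rule case_nat_first_shift)
  finally show ?thesis .
qed

lemma measurable_seq_coord [measurable]:
  "(\<lambda>x :: nat \<Rightarrow> 'b::finite. x i) \<in> seq_borel \<rightarrow>\<^sub>M count_space UNIV"
  unfolding measurable_cong_sets[OF sets_seq_borel_PiM refl] by measurable

lemma measurable_first [measurable]:
  "(first :: (nat \<Rightarrow> 'b::finite) \<Rightarrow> 'b) \<in> seq_borel \<rightarrow>\<^sub>M count_space UNIV"
  unfolding first_def[abs_def] by measurable

lemma measurable_seq_borelI:
  fixes f :: "'m \<Rightarrow> nat \<Rightarrow> 'b::finite"
  assumes "\<And>i. (\<lambda>x. f x i) \<in> M \<rightarrow>\<^sub>M count_space UNIV"
  shows "f \<in> M \<rightarrow>\<^sub>M seq_borel"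
  unfolding measurable_cong_sets[OF refl sets_seq_borel_PiM]
  by (rule measurable_PiM_single') (use assms in auto)

lemma measurable_shift [measurable]: "(shift :: (nat \<Rightarrow> 'b::finite) \<Rightarrow> _) \<in> seq_borel \<rightarrow>\<^sub>M seq_borel"
  by (rule measurable_seq_borelI) (simp add: shift_def)

lemma measurable_case_nat_seq [measurable]:
  fixes f :: "'m \<Rightarrow> nat \<Rightarrow> 'b::finite"
  assumes f: "f \<in> M \<rightarrow>\<^sub>M seq_borel"
  shows "(\<lambda>x. case_nat a (f x)) \<in> M \<rightarrow>\<^sub>M seq_borel"
proof (rule measurable_seq_borelI)
  fix i show "(\<lambda>x. case_nat a (f x) i) \<in> M \<rightarrow>\<^sub>M count_space UNIV"
    using measurable_compose[OF f measurable_seq_coord] by (cases i) auto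
qed

lemma sets_cyl [measurable]: "cyl (l :: 'b::finite list) \<in> sets seq_borel"
proof -
  have "cyl l = (\<Inter>i<length l. (\<lambda>x. x i) -` {l ! i} \<inter> space seq_borel)"
    by (auto simp: cyl_def)
  also have "\<dots> \<in> sets seq_borel"
  proof (cases "length l = 0")
    case True
    then show ?thesis using sets.top[of "seq_borel :: (nat \<Rightarrow> 'b) measure"] by simp
  next
    case False
    then show ?thesis
      by (intro sets.finite_INT measurable_sets[OF measurable_seq_coord]) auto
  qed
  finally show ?thesis .
qed

text \<open>Two cylinders are nested or disjoint, which is why the empty set is added.\<close>

lemma Int_stable_cyl: "Int_stable (insert {} (range cyl))"
proof (rule Int_stableI)
  have *: "cyl l \<inter> cyl l' \<in> insert {} (range cyl)" if "length l \<le> length l'" for l l' :: "'a list"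
  proof (cases "\<forall>i<length l. l ! i = l' ! i")
    case True
    then have "cyl l \<inter> cyl l' = cyl l'" using that by (auto simp: cyl_def)
    then show ?thesis by simp
  next
    case False
    then have "cyl l \<inter> cyl l' = {}" using that by (auto simp: cyl_def)
    then show ?thesis by simp
  qed
  fix A B :: "(nat \<Rightarrow> 'a) set" assume A: "A \<in> insert {} (range cyl)" and B: "B \<in> insert {} (range cyl)"
  then consider "A = {} \<or> B = {}" | l l' where "A = cyl l" "B = cyl l'" by auto
  then show "A \<inter> B \<in> insert {} (range cyl)"
  proof cases
    case 2
    show ?thesis
    proof (cases "length l \<le> length l'")
      case True then show ?thesis unfolding 2 by (rule *)
    next
      case False
      then have "cyl l' \<inter> cyl l \<in> insert {} (range cyl)" by (intro *) simp
      then show ?thesis unfolding 2 by (simp only: Int_commute)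
    qed
  qed auto
qed

lemma sets_seq_borel_cyl:
  "sets (seq_borel :: (nat \<Rightarrow> 'b::finite) measure) = sigma_sets UNIV (insert {} (range cyl))"
proof
  show "sigma_sets UNIV (insert {} (range cyl)) \<subseteq> sets (seq_borel :: (nat \<Rightarrow> 'b) measure)"
  proof -
    have "insert {} (range cyl) \<subseteq> sets (seq_borel :: (nat \<Rightarrow> 'b) measure)" using sets_cyl by auto
    from sets.sigma_sets_subset[OF this] show ?thesis by simp
  qed
  have coord: "{x. x i = a} \<in> sigma_sets UNIV (insert {} (range cyl))" for i and a :: 'b
  proof -
    have "{x. x i = a} = (\<Union>l\<in>{l. length l = Suc i \<and> l ! i = a}. cyl l)"
    proof (intro set_eqI iffI)
      fix x :: "nat \<Rightarrow> 'b" assume "x \<in> {x. x i = a}"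
      then show "x \<in> (\<Union>l\<in>{l. length l = Suc i \<and> l ! i = a}. cyl l)"
        by (intro UN_I[of "map x [0..<Suc i]"]) (auto simp: cyl_def simp del: upt_Suc)
    qed (auto simp: cyl_def)
    also have "\<dots> \<in> sigma_sets UNIV (insert {} (range cyl))"
      by (intro sigma_sets_UNION) auto
    finally show ?thesis .
  qed
  have "{f :: nat \<Rightarrow> 'b. f i \<in> A} \<in> sigma_sets UNIV (insert {} (range cyl))" for i A
  proof -
    have "{f :: nat \<Rightarrow> 'b. f i \<in> A} = (\<Union>a\<in>A. {x. x i = a})" by auto
    also have "\<dots> \<in> sigma_sets UNIV (insert {} (range cyl))"
      by (intro sigma_sets_UNION) (use coord in \<open>auto intro: countable_finite\<close>)
    finally show ?thesis .
  qed
  then show "sets (seq_borel :: (nat \<Rightarrow> 'b) measure) \<subseteq> sigma_sets UNIV (insert {} (range cyl))"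
    unfolding sets_seq_borel_PiM sets_PiM_single by (auto intro!: sigma_sets_mono)
qed

lemma measure_eqI_cyl:
  fixes M N :: "(nat \<Rightarrow> 'b::finite) measure"
  assumes M: "sets M = sets seq_borel" and N: "sets N = sets seq_borel" and fin: "finite_measure M"
    and eq: "\<And>l. emeasure M (cyl l) = emeasure N (cyl l)"
  shows "M = N"
proof (rule measure_eqI_generator_eq[OF Int_stable_cyl, of UNIV _ _ "\<lambda>_. UNIV"])
  show "sets M = sigma_sets UNIV (insert {} (range cyl))" "sets N = sigma_sets UNIV (insert {} (range cyl))"
    using M N sets_seq_borel_cyl by auto
  show "emeasure M X = emeasure N X" if "X \<in> insert {} (range cyl)" for X using that eq by auto
  show "range (\<lambda>_. UNIV :: (nat \<Rightarrow> 'b) set) \<subseteq> insert {} (range cyl)" using cyl_Nil by (auto simp del: cyl_Nil intro!: image_eqI[of _ _ "[]"])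
  show "emeasure M UNIV \<noteq> \<infinity>" for i :: nat
    using finite_measure.emeasure_finite[OF fin] by simp
qed auto

lemma sets_shift_algebra:
  "sets (shift_algebra :: (nat \<Rightarrow> 'b) measure) = {shift -` A | A. A \<in> sets seq_borel}"
  unfolding shift_algebra_def by (subst sets_vimage_algebra2) auto

lemma space_shift_algebra [simp]: "space shift_algebra = UNIV"
  by (simp add: shift_algebra_def)

lemma shift_measurable_shift_algebra [measurable]: "shift \<in> shift_algebra \<rightarrow>\<^sub>M seq_borel"
  unfolding shift_algebra_def by (rule measurable_vimage_algebra1) auto

text \<open>Level sets are preimages under \<open>shift\<close> and cannot separate \<open>x\<close>
  from \<open>y\<close>. This is valid at every point, so shift-measurable versions are honest
  functions of \<open>shift x\<close>.\<close>

lemma shift_algebra_constant: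
  fixes f :: "(nat \<Rightarrow> 'b) \<Rightarrow> 'c::t1_space"
  assumes f: "f \<in> borel_measurable shift_algebra" and eq: "shift x = shift y"
  shows "f x = f y"
proof -
  have "f -` {f x} \<inter> space shift_algebra \<in> sets shift_algebra"
    by (rule measurable_sets[OF f]) auto
  then obtain A where A: "f -` {f x} = shift -` A" by (auto simp: sets_shift_algebra)
  have "x \<in> shift -` A" unfolding A[symmetric] by simp
  then have "y \<in> shift -` A" using eq by simp
  then have "y \<in> f -` {f x}" unfolding A .
  then show ?thesis by simp
qed

lemma (in prob_space) integrable_le_1:
  fixes f :: "'a \<Rightarrow> real"
  shows "f \<in> borel_measurable M \<Longrightarrow> (\<And>x. \<bar>f x\<bar> \<le> 1) \<Longrightarrow> integrable M f"
  by (rule integrable_const_bound[where B=1]) auto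

locale seq_measure = prob_space \<mu> for \<mu> :: "(nat \<Rightarrow> 'b::finite) measure" +
  assumes sets_M: "sets \<mu> = sets seq_borel"
begin

lemma space_M [simp]: "space \<mu> = UNIV"
  using sets_eq_imp_space_eq[OF sets_M] by simp

lemmas measurable_M [measurable_cong] = sets_M

lemma simple_first: "simple_function \<mu> first"
  unfolding simple_function_finite_type measurable_cong_sets[OF sets_M refl] by measurable

lemma measurable_M_eq: "measurable \<mu> N = measurable seq_borel N"
  by (rule measurable_cong_sets[OF sets_M refl])

lemma subalgebra_shift: "subalgebra \<mu> shift_algebra"
  unfolding subalgebra_def sets_M
  using measurable_sets[OF measurable_shift] by (auto simp: sets_shift_algebra)

sublocale F: finite_measure_subalgebra \<mu> shift_algebra
  by unfold_locales (rule subalgebra_shift)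

text \<open>The approximable sets contain the cylinders and form a sigma-algebra; a countable union
  is first replaced by a finite one.\<close>

lemma hist_dense: "dense_in \<mu> (hist shift first) (sets seq_borel)"
proof -
  define ap where "ap = (\<lambda>E. \<forall>e>0. \<exists>m S. prob (sym_diff E {x. hist shift first m x \<in> S}) < e)"
  have apD: "\<exists>m S. prob (sym_diff E {x. hist shift first m x \<in> S}) < e" if "ap E" "0 < e" for E e
    using that(1)[unfolded ap_def, rule_format, OF that(2)] .
  have hm [measurable]: "{x. hist shift first m x \<in> S} \<in> sets \<mu>" for m and S :: "'b list set"
  proof -
    have "{x. hist shift first m x \<in> S} = (\<Union>l\<in>{l \<in> S. length l = m}. cyl l)"
      by (auto simp: cyl_eq)
    also have "\<dots> \<in> sets \<mu>" unfolding sets_M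
      by (intro sets.countable_UN'') auto
    finally show ?thesis .
  qed
  have un: "ap (A \<union> B)" if A: "ap A" "A \<in> sets \<mu>" and B: "ap B" "B \<in> sets \<mu>" for A B
    unfolding ap_def
  proof (intro allI impI)
    fix e :: real assume e: "0 < e"
    obtain m S where mS: "prob (sym_diff A {x. hist shift first m x \<in> S}) < e / 2"
      using apD[OF A(1) half_gt_zero[OF e]] by (elim exE) (rule that)
    obtain n R where nR: "prob (sym_diff B {x. hist shift first n x \<in> R}) < e / 2"
      using apD[OF B(1) half_gt_zero[OF e]] by (elim exE) (rule that)
    define k where "k = max m n"
    define U where "U = {l. take m l \<in> S \<or> take n l \<in> R}"
    have U: "{x. hist shift first k x \<in> U} = {x. hist shift first m x \<in> S} \<union> {x. hist shift first n x \<in> R}"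
      by (auto simp: U_def k_def hist_first take_map min_def)
    have "prob (sym_diff (A \<union> B) {x. hist shift first k x \<in> U})
      \<le> prob (sym_diff A {x. hist shift first m x \<in> S} \<union> sym_diff B {x. hist shift first n x \<in> R})"
      unfolding U using A(2) B(2) by (intro finite_measure_mono) auto
    also have "\<dots> \<le> prob (sym_diff A {x. hist shift first m x \<in> S}) + prob (sym_diff B {x. hist shift first n x \<in> R})"
      using A(2) B(2) by (intro measure_Un_le) auto
    also have "\<dots> < e" using mS nR by simp
    finally show "\<exists>m S. prob (sym_diff (A \<union> B) {x. hist shift first m x \<in> S}) < e"
      by (intro exI[of _ k] exI[of _ U])
  qed
  have main: "ap E \<and> E \<in> sets \<mu>" if "E \<in> sigma_sets UNIV (insert {} (range cyl))" for E
    using that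
  proof induction
    case (Basic E)
    have cylS: "cyl l = {x. hist shift first (length l) x \<in> {l}}" for l :: "'b list" by (simp add: cyl_eq)
    have "\<exists>m S. E = {x. hist shift first m x \<in> S}"
      using Basic
    proof
      assume "E = {}" then show ?thesis by (intro exI[of _ 0] exI[of _ "{}"]) simp
    next
      assume "E \<in> range cyl" then show ?thesis using cylS by blast
    qed
    then obtain m S where E: "E = {x. hist shift first m x \<in> S}" by blast
    have "ap E" unfolding ap_def
    proof (intro allI impI)
      fix e :: real assume "0 < e"
      then show "\<exists>m S. prob (sym_diff E {x. hist shift first m x \<in> S}) < e"
        by (intro exI[of _ m] exI[of _ S]) (simp add: E)
    qed
    then show ?case using hm E by simp
  next
    case Empty
    have "ap {}" unfolding ap_def
    proof (intro allI impI)
      fix e :: real assume "0 < e"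
      then show "\<exists>m S. prob (sym_diff {} {x. hist shift first m x \<in> S}) < e"
        by (intro exI[of _ 0] exI[of _ "{}"]) simp
    qed
    then show ?case by simp
  next
    case (Compl E)
    have "ap (UNIV - E)" unfolding ap_def
    proof (intro allI impI)
      fix e :: real assume e: "0 < e"
      obtain m S where "prob (sym_diff E {x. hist shift first m x \<in> S}) < e"
        using apD[OF conjunct1[OF Compl.IH] e] by (elim exE) (rule that)
      moreover have "sym_diff (UNIV - E) {x. hist shift first m x \<in> - S} = sym_diff E {x. hist shift first m x \<in> S}"
        by auto
      ultimately show "\<exists>m S. prob (sym_diff (UNIV - E) {x. hist shift first m x \<in> S}) < e"
        by (intro exI[of _ m] exI[of _ "- S"]) (simp only:)
    qed
    then show ?case using Compl sets.compl_sets[of E \<mu>] by simp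
  next
    case (Union A)
    have A [measurable]: "A i \<in> sets \<mu>" for i using Union by blast
    have UA [measurable]: "(\<Union>i. A i) \<in> sets \<mu>" by auto
    have fin: "ap (\<Union>i<n. A i)" for n
    proof (induction n)
      case 0
      show ?case unfolding ap_def
      proof (intro allI impI)
        fix e :: real assume "0 < e"
        then show "\<exists>m S. prob (sym_diff (\<Union>i<0. A i) {x. hist shift first m x \<in> S}) < e"
          by (intro exI[of _ 0] exI[of _ "{}"]) simp
      qed
    next
      case (Suc n)
      then show ?case using un[of "\<Union>i<n. A i" "A n"] Union A by (simp add: lessThan_Suc Un_commute)
    qed
    have "ap (\<Union>i. A i)" unfolding ap_def
    proof (intro allI impI)
      fix e :: real assume e: "0 < e"
      have "(\<lambda>n. prob (\<Union>i<n. A i)) \<longlonglongrightarrow> prob (\<Union>n. \<Union>i<n. A i)"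
      proof (rule finite_Lim_measure_incseq)
        show "range (\<lambda>n. \<Union>i<n. A i) \<subseteq> sets \<mu>" using A by auto
        show "incseq (\<lambda>n. \<Union>i<n. A i)" by (intro monoI UN_mono) auto
      qed
      also have "(\<Union>n. \<Union>i<n. A i) = (\<Union>i. A i)" by auto
      finally have "eventually (\<lambda>n. prob (\<Union>i. A i) - e / 2 < prob (\<Union>i<n. A i)) sequentially"
        by (rule order_tendstoD(1)) (use e in simp)
      then obtain n where n: "prob (\<Union>i. A i) - e / 2 < prob (\<Union>i<n. A i)"
        by (auto simp: eventually_sequentially)
      obtain m S where mS: "prob (sym_diff (\<Union>i<n. A i) {x. hist shift first m x \<in> S}) < e / 2"
        using apD[OF fin[of n] half_gt_zero[OF e]] by (elim exE) (rule that)
      have "prob (sym_diff (\<Union>i. A i) {x. hist shift first m x \<in> S})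
        \<le> prob (((\<Union>i. A i) - (\<Union>i<n. A i)) \<union> sym_diff (\<Union>i<n. A i) {x. hist shift first m x \<in> S})"
        by (intro finite_measure_mono) auto
      also have "\<dots> \<le> prob ((\<Union>i. A i) - (\<Union>i<n. A i)) + prob (sym_diff (\<Union>i<n. A i) {x. hist shift first m x \<in> S})"
        by (intro measure_Un_le) auto
      also have "prob ((\<Union>i. A i) - (\<Union>i<n. A i)) = prob (\<Union>i. A i) - prob (\<Union>i<n. A i)"
        by (intro finite_measure_Diff) auto
      finally show "\<exists>m S. prob (sym_diff (\<Union>i. A i) {x. hist shift first m x \<in> S}) < e"
        using n mS by (intro exI[of _ m] exI[of _ S]) linarith
    qed
    then show ?case by simp
  qed
  show ?thesis unfolding dense_in_def sets_seq_borel_cyl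
  proof
    fix E assume "E \<in> sigma_sets UNIV (insert {} (range (cyl :: 'b list \<Rightarrow> _)))"
    then have "ap E" using main by blast
    then show "\<forall>e>0. \<exists>m S. prob (sym_diff E {x \<in> space \<mu>. hist shift first m x \<in> S}) < e"
      unfolding ap_def by simp
  qed
qed

end

section \<open>Conditional probabilities of the first symbol\<close>

locale shift_measure = seq_measure \<mu> for \<mu> :: "(nat \<Rightarrow> 'b::finite) measure" +
  assumes inv: "distr \<mu> \<mu> shift = \<mu>"
begin

sublocale S: measure_preserving_map \<mu> shift
proof
  show "shift \<in> \<mu> \<rightarrow>\<^sub>M \<mu>" unfolding measurable_cong_sets[OF sets_M sets_M] by (rule measurable_shift)
qed (rule inv)

lemma prob_shift: "A \<in> sets \<mu> \<Longrightarrow> prob (shift -` A) = prob A"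
  using measure_distr[OF S.T, of A] unfolding inv by simp

text \<open>Blocks of \<open>shift x\<close> are dense in \<open>shift_algebra\<close>: an
  approximation is pulled back along \<open>shift\<close>, which preserves the measure.\<close>

sublocale FF: filtration_to \<mu> "\<lambda>m x. hist shift first m (shift x)" shift_algebra
proof
  show "subalgebra \<mu> shift_algebra" by (rule subalgebra_shift)
  show s: "simple_function \<mu> (\<lambda>x. hist shift first m (shift x))" for m
    by (rule S.simple_T[OF S.simple_hist[OF simple_first]])
  show "{x \<in> space \<mu>. hist shift first m (shift x) = y} \<in> sets shift_algebra" for m y
  proof -
    have "{x. hist shift first m x = y} \<in> sets \<mu>"
      using simple_function_fiber[OF S.simple_hist[OF simple_first], of m y] by simp
    then show ?thesis by (auto simp: sets_shift_algebra sets_M intro!: exI[of _ "{x. hist shift first m x = y}"])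
  qed
  show "hist shift first m (shift x) = hist shift first m (shift y)"
    if "hist shift first (Suc m) (shift x) = hist shift first (Suc m) (shift y)" for m x y
    by (rule hist_le[OF _ that]) simp
  show "dense_in \<mu> (\<lambda>m x. hist shift first m (shift x)) (sets shift_algebra)"
    unfolding dense_in_def
  proof (intro ballI allI impI)
    fix E :: "(nat \<Rightarrow> 'b) set" and e :: real assume "E \<in> sets shift_algebra" and e: "0 < e"
    then obtain A where E: "E = shift -` A" and A: "A \<in> sets seq_borel" by (auto simp: sets_shift_algebra)
    obtain m S where mS: "prob (sym_diff A {x. hist shift first m x \<in> S}) < e"
      using hist_dense A e unfolding dense_in_def by fastforce
    have "{x. hist shift first m x \<in> S} \<in> sets \<mu>"
      using simple_functionD(2)[OF S.simple_hist[OF simple_first], of m S] by (simp add: vimage_def)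
    then have "prob (shift -` (sym_diff A {x. hist shift first m x \<in> S})) = prob (sym_diff A {x. hist shift first m x \<in> S})"
      using A by (intro prob_shift) (auto simp: sets_M)
    moreover have "shift -` (sym_diff A {x. hist shift first m x \<in> S}) = sym_diff E {x \<in> space \<mu>. hist shift first m (shift x) \<in> S}"
      by (auto simp: E)
    ultimately show "\<exists>m S. prob (sym_diff E {x \<in> space \<mu>. hist shift first m (shift x) \<in> S}) < e"
      using mS by (intro exI[of _ m] exI[of _ S]) simp
  qed
qed

text \<open>This is \<open>p\<^sub>a\<close> of the overview, in a version that depends on
  \<open>shift x\<close> at every point (\<open>step_prob_shift\<close>).\<close>

definition step_prob :: "'b \<Rightarrow> (nat \<Rightarrow> 'b) \<Rightarrow> real" where
  "step_prob a = real_cond_exp \<mu> shift_algebra (indicator {x. first x = a})"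

lemma first_sets [measurable]: "{x. first x = a} \<in> sets \<mu>"
  using simple_function_fiber[OF simple_first, of a] by simp

lemma step_prob_measurable [measurable]:
  "step_prob a \<in> borel_measurable shift_algebra" "step_prob a \<in> borel_measurable \<mu>"
  unfolding step_prob_def by measurable

lemma step_prob_shift: "shift x = shift y \<Longrightarrow> step_prob a x = step_prob a y"
  by (rule shift_algebra_constant[OF step_prob_measurable(1)])

lemma step_prob_bounds: "AE x in \<mu>. \<forall>a. 0 \<le> step_prob a x \<and> step_prob a x \<le> 1"
  using FF.cond_exp_indicator_bounds[OF first_sets] by (simp add: AE_all_countable step_prob_def)

lemma step_prob_integrable: "integrable \<mu> (step_prob a)"
  unfolding step_prob_def by (rule F.real_cond_exp_int) (simp add: emeasure_eq_measure)

lemma indicator_measurable_shift [measurable]: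
  fixes B :: "(nat \<Rightarrow> 'b) set"
  shows "B \<in> sets seq_borel \<Longrightarrow> (\<lambda>x. indicator B (case_nat a (shift x)) :: real) \<in> borel_measurable shift_algebra"
  by (rule measurable_compose[OF measurable_case_nat_seq[OF shift_measurable_shift_algebra] borel_measurable_indicator])

text \<open>On \<open>first x = a\<close> the point is \<open>case_nat a (shift x)\<close>, so
  membership in \<open>B\<close> becomes shift-measurable and can be pulled out of the conditional
  expectation.\<close>

lemma cond_exp_step:
  assumes B: "B \<in> sets seq_borel"
  shows "AE x in \<mu>. real_cond_exp \<mu> shift_algebra (indicator ({x. first x = a} \<inter> B)) x
    = step_prob a x * indicator B (case_nat a (shift x))"
proof -
  let ?h = "\<lambda>x. indicator B (case_nat a (shift x)) :: real"
  have [measurable]: "?h \<in> borel_measurable \<mu>"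
    using measurable_from_subalg[OF subalgebra_shift indicator_measurable_shift[OF B]] .
  have e: "(indicator ({x. first x = a} \<inter> B) :: _ \<Rightarrow> real) = (\<lambda>x. ?h x * indicator {x. first x = a} x)"
  proof
    fix x :: "nat \<Rightarrow> 'b"
    have "first x = a \<Longrightarrow> case_nat a (shift x) = x" using case_nat_first_shift[of x] by simp
    then show "indicator ({x. first x = a} \<inter> B) x = ?h x * indicator {x. first x = a} x"
      by (auto simp: indicator_def)
  qed
  have "AE x in \<mu>. real_cond_exp \<mu> shift_algebra (\<lambda>x. ?h x * indicator {x. first x = a} x) x = ?h x * step_prob a x"
    unfolding step_prob_def
  proof (rule F.real_cond_exp_mult)
    show "integrable \<mu> (\<lambda>x. ?h x * indicator {x. first x = a} x)"
      by (rule integrable_le_1, measurable) (simp add: indicator_def)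
  qed (rule indicator_measurable_shift[OF B], measurable)
  then show ?thesis unfolding e by (simp add: mult.commute)
qed

text \<open>Splitting \<open>B\<close> by its first symbol shows that the conditional measure lives
  on the finitely many points \<open>case_nat a (shift x)\<close>.\<close>

lemma cond_exp_indicator:
  assumes B: "B \<in> sets seq_borel"
  shows "AE x in \<mu>. real_cond_exp \<mu> shift_algebra (indicator B) x
    = (\<Sum>a\<in>UNIV. step_prob a x * indicator B (case_nat a (shift x)))"
proof -
  have Bm [measurable]: "B \<in> sets \<mu>" using B by (simp add: sets_M)
  have e: "(indicator B :: _ \<Rightarrow> real) = (\<lambda>x. \<Sum>a\<in>UNIV. indicator ({x. first x = a} \<inter> B) x)"
  proof
    fix x :: "nat \<Rightarrow> 'b"
    have "(\<Sum>a\<in>UNIV. indicator ({x. first x = a} \<inter> B) x :: real) = (\<Sum>a\<in>UNIV. if a = first x then indicator B x else 0)"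
      by (intro sum.cong) (auto simp: indicator_def)
    then show "(indicator B x :: real) = (\<Sum>a\<in>UNIV. indicator ({x. first x = a} \<inter> B) x)" by simp
  qed
  have "AE x in \<mu>. real_cond_exp \<mu> shift_algebra (\<lambda>x. \<Sum>a\<in>UNIV. indicator ({x. first x = a} \<inter> B) x) x
    = (\<Sum>a\<in>UNIV. real_cond_exp \<mu> shift_algebra (indicator ({x. first x = a} \<inter> B)) x)"
    by (rule F.real_cond_exp_sum) (simp add: emeasure_eq_measure)
  moreover have "AE x in \<mu>. \<forall>a. real_cond_exp \<mu> shift_algebra (indicator ({x. first x = a} \<inter> B)) x
    = step_prob a x * indicator B (case_nat a (shift x))"
    using cond_exp_step[OF B] by (simp add: AE_all_countable)
  ultimately show ?thesis unfolding e[symmetric] by eventually_elim simp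
qed

lemma sum_step_prob: "AE x in \<mu>. (\<Sum>a\<in>UNIV. step_prob a x) = 1"
proof -
  have "AE x in \<mu>. real_cond_exp \<mu> shift_algebra (\<lambda>_. 1) x = 1"
    by (rule F.real_cond_exp_F_meas) auto
  moreover have "UNIV \<in> sets (seq_borel :: (nat \<Rightarrow> 'b) measure)"
    using sets.top[of "seq_borel :: (nat \<Rightarrow> 'b) measure"] by simp
  from cond_exp_indicator[OF this]
  have "AE x in \<mu>. real_cond_exp \<mu> shift_algebra (\<lambda>_. 1) x = (\<Sum>a\<in>UNIV. step_prob a x)"
    by simp
  ultimately show ?thesis by eventually_elim simp
qed

text \<open>Integrating \<open>step_prob a\<close> over the tails where \<open>P a\<close> fails
  gives the probability of failure with first symbol \<open>a\<close>, which is 0. This moves a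
  property from the actual first symbol to all symbols of positive conditional probability.\<close>

lemma AE_step:
  assumes P: "AE x in \<mu>. P (first x) (shift x)" and m: "\<And>a. {y. P a y} \<in> sets seq_borel"
  shows "AE x in \<mu>. \<forall>a. 0 < step_prob a x \<longrightarrow> P a (shift x)"
proof -
  have "AE x in \<mu>. 0 < step_prob a x \<longrightarrow> P a (shift x)" for a
  proof -
    define B where "B = {y. \<not> P a y}"
    have "B = UNIV - {y. P a y}" by (auto simp: B_def)
    then have B: "B \<in> sets seq_borel" using sets.compl_sets[OF m[of a]] by simp
    let ?h = "\<lambda>x. indicator B (shift x) :: real"
    have hm [measurable]: "?h \<in> borel_measurable shift_algebra"
      using measurable_compose[OF shift_measurable_shift_algebra borel_measurable_indicator[OF B]] .
    have hm2 [measurable]: "?h \<in> borel_measurable \<mu>" using measurable_from_subalg[OF subalgebra_shift hm] .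
    have "(\<integral>x. ?h x * step_prob a x \<partial>\<mu>) = (\<integral>x. ?h x * indicator {x. first x = a} x \<partial>\<mu>)"
      unfolding step_prob_def
      by (rule F.real_cond_exp_intg(2)[OF integrable_le_1 hm], measurable) (simp add: indicator_def, measurable)
    also have "\<dots> = (\<integral>x. 0 \<partial>\<mu>)"
    proof (rule integral_cong_AE)
      show "(\<lambda>x. ?h x * indicator {x. first x = a} x) \<in> borel_measurable \<mu>" by measurable
      show "AE x in \<mu>. ?h x * indicator {x. first x = a} x = 0"
        using P by eventually_elim (auto simp: indicator_def B_def)
    qed simp
    finally have z: "(\<integral>x. ?h x * step_prob a x \<partial>\<mu>) = 0" by simp
    have i: "integrable \<mu> (\<lambda>x. ?h x * step_prob a x)"
    proof (rule Bochner_Integration.integrable_bound[OF step_prob_integrable[of a]])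
      show "(\<lambda>x. ?h x * step_prob a x) \<in> borel_measurable \<mu>" by measurable
    qed (simp add: indicator_def)
    have "AE x in \<mu>. 0 \<le> ?h x * step_prob a x"
      using step_prob_bounds by eventually_elim (simp add: indicator_def)
    from integral_nonneg_eq_0_iff_AE[OF i this] z have "AE x in \<mu>. ?h x * step_prob a x = 0" by simp
    then show ?thesis by eventually_elim (auto simp: B_def indicator_def)
  qed
  then show ?thesis by (simp add: AE_all_countable)
qed

end

section \<open>The local alphabet\<close>

lemma measurable_Collect_finite:
  fixes P :: "'b::finite \<Rightarrow> 'm \<Rightarrow> bool"
  assumes "\<And>a. {x \<in> space M. P a x} \<in> sets M"
  shows "(\<lambda>x. {a. P a x}) \<in> M \<rightarrow>\<^sub>M count_space UNIV"
proof -
  have "(\<lambda>x. {a. P a x}) -` {S} \<inter> space M \<in> sets M" for S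
  proof -
    have "(\<lambda>x. {a. P a x}) -` {S} \<inter> space M = {x \<in> space M. \<forall>a\<in>UNIV. if a \<in> S then P a x else \<not> P a x}"
      by (auto split: if_splits)
    also have "\<dots> \<in> sets M"
    proof (rule sets.sets_Collect_finite_All)
      fix a show "{x \<in> space M. if a \<in> S then P a x else \<not> P a x} \<in> sets M"
        using assms[of a] by (cases "a \<in> S") (auto intro: sets.sets_Collect_neg)
    qed simp
    finally show ?thesis .
  qed
  then show ?thesis by (subst measurable_count_space_eq2) auto
qed

context shift_measure
begin

text \<open>\<open>cond_measure\<close> is a choice and becomes meaningful once a kernel exists; the
  one built here puts the weights \<open>step_prob\<close> on the preimages of
  \<open>shift x\<close>.\<close>

lemma cond_measure_exists: "\<exists>\<kappa>. is_cond_measure \<mu> shift_algebra \<kappa>"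
proof -
  define good where "good = (\<lambda>x. (\<forall>a. 0 \<le> step_prob a x) \<and> (\<Sum>a\<in>UNIV. step_prob a x) = 1)"
  \<comment> \<open>Where the weights fail to be a probability vector, a point mass at
    \<open>undefined\<close> keeps the kernel a probability measure everywhere.\<close>
  define w where "w = (\<lambda>a x. if good x then step_prob a x else if a = undefined then 1 else 0 :: real)"
  define \<kappa> where "\<kappa> = (\<lambda>x. distr (density (count_space UNIV) (\<lambda>a. ennreal (w a x))) \<mu> (\<lambda>a. case_nat a (shift x)))"
  have w0: "0 \<le> w a x" for a x by (auto simp: w_def good_def)
  have w1: "(\<Sum>a\<in>UNIV. w a x) = 1" for x
  proof (cases "good x")
    case True
    then have "(\<Sum>a\<in>UNIV. w a x) = (\<Sum>a\<in>UNIV. step_prob a x)" by (simp add: w_def)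
    with True show ?thesis by (simp add: good_def)
  qed (simp add: w_def)
  have good_m: "{x \<in> space shift_algebra. good x} \<in> sets shift_algebra"
    unfolding good_def by measurable
  have w_m: "w a \<in> borel_measurable shift_algebra" for a
    unfolding w_def by (rule measurable_If[OF _ _ good_m]) auto
  have em: "emeasure (\<kappa> x) B = ennreal (\<Sum>a\<in>UNIV. w a x * indicator B (case_nat a (shift x)))"
    if B: "B \<in> sets \<mu>" for B x
  proof -
    have "emeasure (\<kappa> x) B = emeasure (density (count_space UNIV) (\<lambda>a. ennreal (w a x))) ((\<lambda>a. case_nat a (shift x)) -` B)"
      unfolding \<kappa>_def using B by (subst emeasure_distr) auto
    also have "\<dots> = (\<Sum>a\<in>UNIV. ennreal (w a x) * indicator ((\<lambda>a. case_nat a (shift x)) -` B) a)"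
      by (subst emeasure_density) (auto simp: nn_integral_count_space_finite)
    also have "\<dots> = (\<Sum>a\<in>UNIV. ennreal (w a x * indicator B (case_nat a (shift x))))"
      by (intro sum.cong) (auto simp: indicator_def)
    also have "\<dots> = ennreal (\<Sum>a\<in>UNIV. w a x * indicator B (case_nat a (shift x)))"
      by (rule sum_ennreal) (simp add: w0)
    finally show ?thesis .
  qed
  have sets\<kappa>: "sets (\<kappa> x) = sets \<mu>" for x by (simp add: \<kappa>_def)
  have prob\<kappa>: "prob_space (\<kappa> x)" for x
  proof
    have "UNIV \<in> sets \<mu>" using sets.top[of \<mu>] by simp
    from em[OF this] show "emeasure (\<kappa> x) (space (\<kappa> x)) = 1"
      using sets_eq_imp_space_eq[OF sets\<kappa>] w1 by simp
  qed
  have meas: "(\<lambda>x. \<Sum>a\<in>UNIV. w a x * indicator B (case_nat a (shift x))) \<in> borel_measurable shift_algebra"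
    if "B \<in> sets \<mu>" for B
    using indicator_measurable_shift[of B] that w_m
    by (intro borel_measurable_sum borel_measurable_times) (auto simp: sets_M)
  have "\<kappa> \<in> shift_algebra \<rightarrow>\<^sub>M prob_algebra \<mu>"
  proof (rule measurable_prob_algebraI)
    show "\<kappa> \<in> shift_algebra \<rightarrow>\<^sub>M subprob_algebra \<mu>"
    proof (rule measurable_subprob_algebra)
      fix B assume B: "B \<in> sets \<mu>"
      show "(\<lambda>x. emeasure (\<kappa> x) B) \<in> borel_measurable shift_algebra"
        unfolding em[OF B] using meas[OF B] by measurable
    qed (use prob\<kappa> sets\<kappa> prob_space_imp_subprob_space in auto)
  qed (rule prob\<kappa>)
  moreover have "AE x in \<mu>. measure (\<kappa> x) B = real_cond_exp \<mu> shift_algebra (indicator B) x"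
    if B: "B \<in> sets \<mu>" for B
  proof -
    have "AE x in \<mu>. good x"
      using step_prob_bounds sum_step_prob by eventually_elim (simp add: good_def)
    then show ?thesis
      using cond_exp_indicator[of B, folded sets_M, OF B]
    proof eventually_elim
      case (elim x)
      have "measure (\<kappa> x) B = (\<Sum>a\<in>UNIV. w a x * indicator B (case_nat a (shift x)))"
        unfolding measure_def em[OF B] using w0 by (intro enn2real_ennreal sum_nonneg) simp
      then show ?case using elim by (simp add: w_def)
    qed
  qed
  ultimately show ?thesis unfolding is_cond_measure_def by blast
qed

lemma cond_measure: "is_cond_measure \<mu> shift_algebra (cond_measure \<mu> shift_algebra)"
  unfolding cond_measure_def by (rule someI_ex[OF cond_measure_exists])

abbreviation "kern \<equiv> cond_measure \<mu> shift_algebra"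

lemma kern_measurable: "kern \<in> shift_algebra \<rightarrow>\<^sub>M prob_algebra \<mu>"
  using cond_measure by (simp add: is_cond_measure_def)

lemma kern_prob: "prob_space (kern x)" and sets_kern: "sets (kern x) = sets seq_borel"
  using measurable_space[OF kern_measurable, of x] by (auto simp: space_prob_algebra sets_M)

text \<open>The kernel is known almost surely for each fixed set, while the singleton varies with
  \<open>x\<close>. The countably many cylinders share one null set, and the singleton is a
  decreasing intersection of cylinders.\<close>

lemma kern_atoms: "AE x in \<mu>. \<forall>a. measure (kern x) {case_nat a (shift x)} = step_prob a x"
proof -
  have "AE x in \<mu>. measure (kern x) (cyl l) = (\<Sum>b\<in>UNIV. step_prob b x * indicator (cyl l) (case_nat b (shift x)))" for l
  proof -
    have "AE x in \<mu>. measure (kern x) (cyl l) = real_cond_exp \<mu> shift_algebra (indicator (cyl l)) x"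
      using cond_measure sets_cyl[of l] by (simp add: is_cond_measure_def sets_M)
    then show ?thesis using cond_exp_indicator[OF sets_cyl[of l]] by eventually_elim simp
  qed
  then have "AE x in \<mu>. \<forall>l. measure (kern x) (cyl l) = (\<Sum>b\<in>UNIV. step_prob b x * indicator (cyl l) (case_nat b (shift x)))"
    by (simp add: AE_all_countable)
  then show ?thesis
  proof eventually_elim
    case (elim x)
    show ?case
    proof
      fix a
      interpret K: prob_space "kern x" by (rule kern_prob)
      let ?z = "case_nat a (shift x)"
      define C where "C = (\<lambda>n. cyl (map ?z [0..<Suc n]))"
      have C: "y \<in> C n \<longleftrightarrow> (\<forall>i\<le>n. y i = ?z i)" for y n
        unfolding C_def cyl_def by (simp add: less_Suc_eq_le del: upt_Suc)
      have "(\<lambda>n. measure (kern x) (C n)) \<longlonglongrightarrow> measure (kern x) (\<Inter>n. C n)"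
      proof (rule K.finite_Lim_measure_decseq)
        show "range C \<subseteq> sets (kern x)" unfolding C_def sets_kern by auto
        show "decseq C" unfolding decseq_def using C by fastforce
      qed
      moreover have "(\<Inter>n. C n) = {?z}"
      proof (intro set_eqI iffI)
        fix y assume "y \<in> (\<Inter>n. C n)"
        then have "y i = ?z i" for i using C[of y i] by blast
        then show "y \<in> {?z}" by blast
      qed (use C in blast)
      moreover have "measure (kern x) (C n) = step_prob a x" for n
      proof -
        have "case_nat b (shift x) \<in> C n \<longleftrightarrow> b = a" for b
        proof
          assume "case_nat b (shift x) \<in> C n"
          then show "b = a" using C[of "case_nat b (shift x)" n] by force
        qed (use C in blast)
        then have "(\<Sum>b\<in>UNIV. step_prob b x * indicator (C n) (case_nat b (shift x))) = (\<Sum>b\<in>UNIV. if b = a then step_prob b x else 0)"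
          by (intro sum.cong) (auto simp: indicator_def)
        then show ?thesis using elim[rule_format, of "map ?z [0..<Suc n]"] unfolding C_def by simp
      qed
      ultimately show "measure (kern x) {?z} = step_prob a x" by (simp add: LIMSEQ_const_iff)
    qed
  qed
qed

text \<open>Almost surely equal to \<open>local_alphabet\<close> by \<open>kern_atoms\<close>, but
  free of the chosen kernel and a function of \<open>shift x\<close> at every point.\<close>

definition alph :: "(nat \<Rightarrow> 'b) \<Rightarrow> 'b set" where
  "alph x = {a. 0 < step_prob a x}"

definition alph_seq :: "(nat \<Rightarrow> 'b) \<Rightarrow> nat \<Rightarrow> 'b set" where
  "alph_seq x i = alph ((shift ^^ i) x)"

lemma alph_shift: "shift x = shift y \<Longrightarrow> alph x = alph y"
  unfolding alph_def using step_prob_shift[of x y] by simp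

lemma alph_seq_shift: "alph_seq (shift x) = shift (alph_seq x)"
  by (simp add: alph_seq_def fun_eq_iff shift_def[of "alph_seq x"] funpow_swap1)

lemma first_alph_seq: "first (alph_seq x) = alph x"
  by (simp add: first_def alph_seq_def)

lemma alph_measurable [measurable]: "alph \<in> \<mu> \<rightarrow>\<^sub>M count_space UNIV"
  unfolding alph_def[abs_def]
  by (rule measurable_Collect_finite, measurable)

lemma alph_seq_measurable [measurable]: "alph_seq \<in> \<mu> \<rightarrow>\<^sub>M seq_borel"
  by (rule measurable_seq_borelI)
     (simp add: alph_seq_def measurable_compose[OF S.T_pow alph_measurable])

text \<open>Kernel and singleton both vary with \<open>x\<close>; the graph of the singleton is
  measurable in the product space, and a kernel may be evaluated on the sections of such a
  set.\<close>

lemma local_alphabet_measurable: "local_alphabet \<mu> \<in> \<mu> \<rightarrow>\<^sub>M count_space UNIV"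
  unfolding local_alphabet_def[abs_def]
proof (rule measurable_Collect_finite)
  fix a
  have [measurable]: "shift \<in> \<mu> \<rightarrow>\<^sub>M seq_borel"
    unfolding measurable_M_eq by (rule measurable_shift)
  define z where "z = (\<lambda>x :: nat \<Rightarrow> 'b. case_nat a (shift x))"
  have z: "z \<in> \<mu> \<rightarrow>\<^sub>M seq_borel" unfolding z_def by (rule measurable_case_nat_seq) measurable
  have [measurable]: "(\<lambda>p. z (fst p) i) \<in> \<mu> \<Otimes>\<^sub>M seq_borel \<rightarrow>\<^sub>M count_space UNIV" for i
    using measurable_compose[OF measurable_compose[OF measurable_fst z] measurable_seq_coord] .
  have [measurable]: "(\<lambda>p. snd p i) \<in> \<mu> \<Otimes>\<^sub>M seq_borel \<rightarrow>\<^sub>M count_space (UNIV :: 'b set)" for i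
    using measurable_compose[OF measurable_snd measurable_seq_coord] .
  have "{p \<in> space (\<mu> \<Otimes>\<^sub>M seq_borel). \<forall>i. snd p i = z (fst p) i} \<in> sets (\<mu> \<Otimes>\<^sub>M (seq_borel :: (nat \<Rightarrow> 'b) measure))"
    by measurable
  also have "{p \<in> space (\<mu> \<Otimes>\<^sub>M seq_borel). \<forall>i. snd p i = z (fst p) i} = (SIGMA x:space \<mu>. {z x})"
    by (auto simp: space_pair_measure fun_eq_iff)
  finally have Sg: "(SIGMA x:space \<mu>. {case_nat a (shift x)}) \<in> sets (\<mu> \<Otimes>\<^sub>M seq_borel)"
    unfolding z_def .
  have "kern \<in> \<mu> \<rightarrow>\<^sub>M subprob_algebra seq_borel"
    using measurable_from_subalg[OF subalgebra_shift measurable_prob_algebraD[OF kern_measurable]]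
    by (simp add: subprob_algebra_cong[OF sets_M])
  from measure_measurable_subprob_algebra2[OF Sg this]
  have [measurable]: "(\<lambda>x. measure (kern x) {case_nat a (shift x)}) \<in> borel_measurable \<mu>" .
  show "{x \<in> space \<mu>. 0 < measure (kern x) {case_nat a (shift x)}} \<in> sets \<mu>" by measurable
qed

lemma alphabet_map_measurable: "alphabet_map \<mu> \<in> \<mu> \<rightarrow>\<^sub>M seq_borel"
  by (rule measurable_seq_borelI)
     (simp add: alphabet_map_def measurable_compose[OF S.T_pow local_alphabet_measurable])

lemma alphabet_map_AE: "AE x in \<mu>. alphabet_map \<mu> x = alph_seq x"
proof -
  have "AE x in \<mu>. local_alphabet \<mu> x = alph x"
    using kern_atoms by eventually_elim (simp add: local_alphabet_def alph_def)
  then have "AE x in \<mu>. \<forall>i. local_alphabet \<mu> ((shift ^^ i) x) = alph ((shift ^^ i) x)"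
    using S.AE_T_pow[of "\<lambda>x. local_alphabet \<mu> x = alph x"] by (simp add: AE_all_countable)
  then show ?thesis by eventually_elim (simp add: alphabet_map_def alph_seq_def fun_eq_iff)
qed

lemma distr_alphabet_map: "distr \<mu> seq_borel (alphabet_map \<mu>) = distr \<mu> seq_borel alph_seq"
  by (rule distr_cong_AE) (use alphabet_map_AE alphabet_map_measurable in auto)

text \<open>\<open>step_prob\<close> as a function of the tail; by \<open>step_prob_shift\<close>
  any symbol may be put in front.\<close>

definition stepP :: "'b \<Rightarrow> (nat \<Rightarrow> 'b) \<Rightarrow> real" where
  "stepP a y = step_prob a (case_nat undefined y)"

lemma step_prob_eq: "step_prob a x = stepP a (shift x)"
  unfolding stepP_def by (rule step_prob_shift) simp

lemma stepP_measurable [measurable]: "stepP a \<in> borel_measurable seq_borel"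
proof -
  have "step_prob a \<in> borel_measurable seq_borel"
    using step_prob_measurable(2)[of a] unfolding measurable_M_eq .
  from measurable_compose[OF measurable_case_nat_seq[OF measurable_ident] this, of undefined]
  show ?thesis by (simp add: stepP_def[abs_def] id_def)
qed

lemma step_integral:
  assumes h: "h \<in> borel_measurable shift_algebra" and b: "AE x in \<mu>. \<bar>h x\<bar> \<le> 1"
  shows "(\<integral>x. h x * indicator {x. first x = a} x \<partial>\<mu>) = (\<integral>x. h x * step_prob a x \<partial>\<mu>)"
  unfolding step_prob_def
proof (rule F.real_cond_exp_intg(2)[symmetric])
  note [measurable] = h measurable_from_subalg[OF subalgebra_shift h]
  show "integrable \<mu> (\<lambda>x. h x * indicator {x. first x = a} x)"
  proof (rule integrable_const_bound[where B=1])
    show "AE x in \<mu>. norm (h x * indicator {x. first x = a} x) \<le> 1"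
      using b by eventually_elim (simp add: indicator_def)
  qed measurable
qed (use h in measurable)

end

section \<open>Measures invariant under the shift and the automaton\<close>

locale bipermutative =
  fixes \<tau> :: "(nat \<Rightarrow> 'a::finite) \<Rightarrow> nat \<Rightarrow> 'a" and r :: "'a \<Rightarrow> 'a \<Rightarrow> 'a"
  assumes tau: "\<And>x i. \<tau> x i = r (x i) (x (Suc i))"
    and bij_left: "\<And>a. bij (\<lambda>b. r b a)" and bij_right: "\<And>a. bij (\<lambda>b. r a b)"
begin

definition rset :: "'a set \<Rightarrow> 'a set \<Rightarrow> 'a set" where
  "rset S T = (\<Union>a\<in>S. \<Union>b\<in>T. {r a b})"

text \<open>The local form of \<open>set_ca\<close>. The two agree on sequences of nonempty sets
  (\<open>set_ca_eq\<close>); a single empty entry makes every entry of \<open>set_ca\<close>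
  empty.\<close>

definition set_rule :: "(nat \<Rightarrow> 'a set) \<Rightarrow> nat \<Rightarrow> 'a set" where
  "set_rule A i = rset (A i) (A (Suc i))"

lemma inj_left: "r a c = r b c \<longleftrightarrow> a = b"
  using bij_is_inj[OF bij_left[of c]] by (auto dest: injD)

lemma inj_right: "r c a = r c b \<longleftrightarrow> a = b"
  using bij_is_inj[OF bij_right[of c]] by (auto dest: injD)

lemma shift_tau: "shift (\<tau> x) = \<tau> (shift x)"
  by (simp add: fun_eq_iff shift_def tau)

lemma first_tau: "first (\<tau> x) = r (first x) (first (shift x))"
  by (simp add: first_def shift_def tau)

lemma shift_set_rule: "shift (set_rule A) = set_rule (shift A)"
  by (simp add: fun_eq_iff shift_def set_rule_def)

lemma first_set_rule: "first (set_rule A) = rset (first A) (first (shift A))"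
  by (simp add: first_def shift_def set_rule_def)

lemma measurable_tau [measurable]: "\<tau> \<in> seq_borel \<rightarrow>\<^sub>M seq_borel"
  by (rule measurable_seq_borelI) (simp add: tau)

lemma measurable_set_rule [measurable]: "set_rule \<in> seq_borel \<rightarrow>\<^sub>M seq_borel"
  by (rule measurable_seq_borelI) (simp add: set_rule_def)

lemma set_ca_eq:
  assumes "\<And>i. A i \<noteq> {}"
  shows "set_ca \<tau> A = set_rule A"
proof (intro ext set_eqI iffI)
  fix i c assume "c \<in> set_ca \<tau> A i"
  then obtain a where "c = \<tau> a i" "\<forall>j. a j \<in> A j" by (auto simp: set_ca_def)
  then show "c \<in> set_rule A i" by (auto simp: set_rule_def rset_def tau)
next
  fix i c assume "c \<in> set_rule A i"
  then obtain u v where uv: "u \<in> A i" "v \<in> A (Suc i)" "c = r u v" by (auto simp: set_rule_def rset_def)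
  define a where "a = (\<lambda>j. if j = i then u else if j = Suc i then v else SOME b. b \<in> A j)"
  have "a j \<in> A j" for j using uv assms[of j] by (auto simp: a_def some_in_eq)
  moreover have "\<tau> a i = c" by (simp add: tau a_def uv)
  ultimately show "c \<in> set_ca \<tau> A i" unfolding set_ca_def by blast
qed

lemma set_rule_nonempty: "(\<And>i. A i \<noteq> {}) \<Longrightarrow> set_rule A i \<noteq> {}"
  unfolding set_rule_def rset_def by (simp add: ex_in_conv[symmetric])

lemma set_rule_pow_nonempty: "(\<And>i. A i \<noteq> {}) \<Longrightarrow> (set_rule ^^ n) A i \<noteq> {}"
  by (induction n arbitrary: i) (auto intro!: set_rule_nonempty)

lemma set_ca_pow: "(\<And>i. A i \<noteq> {}) \<Longrightarrow> (set_ca \<tau> ^^ n) A = (set_rule ^^ n) A"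
  by (induction n) (auto simp: set_ca_eq set_rule_pow_nonempty)

text \<open>Positive cardinality keeps all entries of all iterates nonempty, so
  \<open>set_ca\<close> may be replaced by its local form; \<open>n = 0\<close> covers the condition
  on \<open>A\<close> itself.\<close>

lemma Zk_iff:
  assumes "0 < k"
  shows "A \<in> Zk \<tau> k \<longleftrightarrow> (\<forall>n i. card ((set_rule ^^ n) A i) = k)"
proof -
  have ne: "B i \<noteq> {}" if "\<And>i. card (B i) = k" for B :: "nat \<Rightarrow> 'a set" and i
    using that[of i] assms by auto
  show ?thesis
  proof
    assume A: "A \<in> Zk \<tau> k"
    then have "card (A i) = k" for i by (simp add: Zk_def)
    from set_ca_pow[OF ne[OF this]] have *: "(set_ca \<tau> ^^ n) A = (set_rule ^^ n) A" for n .
    show "\<forall>n i. card ((set_rule ^^ n) A i) = k"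
    proof (intro allI)
      fix n i show "card ((set_rule ^^ n) A i) = k"
        using A by (cases "n = 0") (auto simp: Zk_def *[symmetric])
    qed
  next
    assume A: "\<forall>n i. card ((set_rule ^^ n) A i) = k"
    from A[rule_format, of 0] have A0: "card (A i) = k" for i by simp
    from set_ca_pow[OF ne[OF A0]] have *: "(set_ca \<tau> ^^ n) A = (set_rule ^^ n) A" for n .
    show "A \<in> Zk \<tau> k" using A A0 by (simp add: Zk_def *)
  qed
qed

text \<open>By bijectivity in the second argument, \<open>x i\<close> and \<open>\<tau> x i\<close>
  determine \<open>x (Suc i)\<close>; the induction then passes from \<open>x\<close> to
  \<open>\<tau> x\<close>.\<close>

lemma hist_tau_iff: "hist shift first n x = hist shift first n y \<longleftrightarrow> hist \<tau> first n x = hist \<tau> first n y"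
proof (induction n arbitrary: x y)
  case (Suc n)
  have agree: "hist shift first n x = hist shift first n y \<longleftrightarrow> (\<forall>i<n. x i = y i)" for n and x y :: "nat \<Rightarrow> 'a"
    by (auto simp: hist_first)
  have "(\<forall>i<Suc n. x i = y i) \<longleftrightarrow> x 0 = y 0 \<and> (\<forall>i<n. \<tau> x i = \<tau> y i)"
  proof
    assume *: "x 0 = y 0 \<and> (\<forall>i<n. \<tau> x i = \<tau> y i)"
    have "x i = y i" if "i < Suc n" for i
      using that
    proof (induction i)
      case (Suc i)
      then have "x i = y i" "\<tau> x i = \<tau> y i" using * by simp_all
      then show ?case using inj_right[of "y i" "x (Suc i)" "y (Suc i)"] by (simp add: tau)
    qed (use * in simp)
    then show "\<forall>i<Suc n. x i = y i" by blast
  qed (simp add: tau)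
  also have "\<dots> \<longleftrightarrow> first x = first y \<and> hist shift first n (\<tau> x) = hist shift first n (\<tau> y)"
    by (simp add: agree first_def)
  also have "\<dots> \<longleftrightarrow> hist \<tau> first (Suc n) x = hist \<tau> first (Suc n) y"
    unfolding Suc.IH[of "\<tau> x" "\<tau> y"] by (simp add: hist_Suc)
  finally show ?case by (simp only: agree)
qed simp

end

context shift_measure
begin

lemma measurable_comp_shift:
  "g \<in> seq_borel \<rightarrow>\<^sub>M N \<Longrightarrow> (\<lambda>x. g (shift x)) \<in> shift_algebra \<rightarrow>\<^sub>M N"
  by (rule measurable_compose[OF shift_measurable_shift_algebra])

text \<open>The event that \<open>a\<close> occurs while \<open>step_prob a \<le> 0\<close> has as
  its probability the integral of \<open>step_prob a\<close> over a set where it is not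
  positive.\<close>

lemma step_prob_first_pos: "AE x in \<mu>. 0 < step_prob (first x) x"
proof -
  have "AE x in \<mu>. first x = a \<longrightarrow> 0 < step_prob a x" for a
  proof -
    define B where "B = {x \<in> space shift_algebra. step_prob a x \<le> 0}"
    have B: "B \<in> sets shift_algebra" unfolding B_def by measurable
    have [measurable]: "B \<in> sets \<mu>" using B subalgebra_shift by (auto simp: subalgebra_def)
    have "(\<integral>x. indicator B x * indicator {x. first x = a} x \<partial>\<mu>) = (\<integral>x. indicator B x * step_prob a x \<partial>\<mu>)"
      by (rule step_integral) (use B in \<open>auto simp: indicator_def\<close>)
    also have "\<dots> \<le> (\<integral>x. 0 \<partial>\<mu>)"
      by (rule Bochner_Integration.integral_mono')
         (auto simp: B_def indicator_def)
    finally have "prob (B \<inter> {x. first x = a}) \<le> 0"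
      by (simp add: indicator_inter_arith[symmetric])
    then have "prob (B \<inter> {x. first x = a}) = 0" using measure_nonneg[of \<mu>] by (simp add: antisym)
    then have "AE x in \<mu>. x \<notin> B \<inter> {x. first x = a}"
      by (intro AE_not_in) (auto simp: null_sets_def emeasure_eq_measure)
    then show ?thesis by eventually_elim (auto simp: B_def)
  qed
  then have "AE x in \<mu>. \<forall>a. first x = a \<longrightarrow> 0 < step_prob a x" unfolding AE_all_countable by blast
  then show ?thesis by eventually_elim simp
qed

text \<open>Zero rate makes the increments tend to 0, so \<open>first\<close> is conditionally
  independent of itself and each \<open>step_prob\<close> satisfies t = t * t; the symbol of
  probability 1 is the value of \<open>G\<close>.\<close>

lemma zero_entropy_deterministic:
  assumes "measure_entropy \<mu> shift = 0"
  obtains G where "G \<in> seq_borel \<rightarrow>\<^sub>M count_space UNIV" "AE x in \<mu>. first x = G (shift x)"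
proof
  define G where "G = (\<lambda>y. the_elem {a. stepP a y = 1})"
  have m: "(\<lambda>y. {a. stepP a y = 1}) \<in> seq_borel \<rightarrow>\<^sub>M count_space UNIV"
    by (rule measurable_Collect_finite) measurable
  show "G \<in> seq_borel \<rightarrow>\<^sub>M count_space UNIV"
    unfolding G_def by (rule measurable_compose[OF m]) simp
  have rate: "S.ent_rate first = 0"
    by (rule S.ent_rate_zero_if_measure_entropy[OF simple_first assms])
  have small: "\<exists>m\<ge>n. cond_mi \<mu> first first (\<lambda>x. hist shift first m (shift x)) < e" if "0 < e" for e n
  proof -
    have "eventually (\<lambda>m. S.ent_incr first m < e) sequentially"
      using S.ent_incr_tendsto[OF simple_first] rate \<open>0 < e\<close> by (intro order_tendstoD(2)) auto
    then obtain N where "\<And>m. m \<ge> N \<Longrightarrow> S.ent_incr first m < e" by (auto simp: eventually_sequentially)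
    then show ?thesis
      by (intro exI[of _ "max n N"]) (simp add: S.cond_mi_self[OF simple_first])
  qed
  have "AE x in \<mu>. step_prob a x = step_prob a x * step_prob a x" for a
    using FF.cond_indep_limit[OF simple_first simple_first small, of a a] by (simp add: step_prob_def)
  then have "AE x in \<mu>. \<forall>a. step_prob a x = step_prob a x * step_prob a x" by (simp add: AE_all_countable)
  then show "AE x in \<mu>. first x = G (shift x)"
    using step_prob_first_pos sum_step_prob step_prob_bounds
  proof eventually_elim
    case (elim x)
    then have 1: "step_prob (first x) x = 1" by (metis less_irrefl mult_cancel_right1)
    have "step_prob a x \<noteq> 1" if "a \<noteq> first x" for a
    proof
      assume a: "step_prob a x = 1"
      have "(\<Sum>b\<in>{a, first x}. step_prob b x) \<le> (\<Sum>b\<in>UNIV. step_prob b x)"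
        using elim by (intro sum_mono2) auto
      then show False using a 1 that elim by simp
    qed
    then have "{a. stepP a (shift x) = 1} = {first x}" using 1 by (auto simp: step_prob_eq)
    then show ?case by (simp add: G_def)
  qed
qed

end

section \<open>Consequences of invariance under the automaton\<close>

locale ca_measure = shift_measure \<mu> + bipermutative \<tau> r
  for \<mu> :: "(nat \<Rightarrow> 'a::finite) measure" and \<tau> :: "(nat \<Rightarrow> 'a) \<Rightarrow> nat \<Rightarrow> 'a" and r +
  assumes inv_tau: "distr \<mu> \<mu> \<tau> = \<mu>"
begin

sublocale T: measure_preserving_map \<mu> \<tau>
proof
  show "\<tau> \<in> \<mu> \<rightarrow>\<^sub>M \<mu>" unfolding measurable_cong_sets[OF sets_M sets_M] by (rule measurable_tau)
qed (rule inv_tau)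

text \<open>Both sides are conditional probabilities of \<open>(\<tau> x)\<^sub>0\<close>, given \<open>\<sigma> x\<close> and given the coarser
  \<open>\<sigma> (\<tau> x)\<close>. They have the same \<open>L\<^sup>2\<close> norm by invariance, so they agree.\<close>

lemma step_prob_tau: "AE x in \<mu>. \<forall>a. step_prob (r a (first (shift x))) (\<tau> x) = step_prob a x"
proof -
  \<comment> \<open>\<open>q b\<close> and \<open>p b\<close> are the conditional probabilities of
    \<open>first (\<tau> x) = b\<close>, given \<open>shift x\<close> and given
    \<open>shift (\<tau> x)\<close> respectively.\<close>
  define q where "q = (\<lambda>b x. \<Sum>a\<in>UNIV. step_prob a x * indicator {y. r a (first y) = b} (shift x))"
  define p where "p = (\<lambda>b x. step_prob b (\<tau> x))"
  have ind [measurable]: "(\<lambda>x. indicator {y. r a (first y) = b} (shift x) :: real) \<in> borel_measurable shift_algebra" for a b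
  proof (rule measurable_comp_shift)
    have "{y \<in> space seq_borel. r a (first y) = b} \<in> sets seq_borel" by measurable
    then show "indicator {y. r a (first y) = b} \<in> borel_measurable seq_borel" by simp
  qed
  have pF [measurable]: "p b \<in> borel_measurable shift_algebra" for b
  proof -
    have "p b = (\<lambda>x. stepP b (\<tau> (shift x)))" by (simp add: p_def step_prob_eq shift_tau fun_eq_iff)
    then show ?thesis
      using measurable_comp_shift[OF measurable_compose[OF measurable_tau stepP_measurable]] by simp
  qed
  have qF [measurable]: "q b \<in> borel_measurable shift_algebra" for b unfolding q_def by measurable
  note [measurable] = measurable_from_subalg[OF subalgebra_shift ind]
    measurable_from_subalg[OF subalgebra_shift pF] measurable_from_subalg[OF subalgebra_shift qF]
  have bp: "AE x in \<mu>. \<forall>b. 0 \<le> p b x \<and> p b x \<le> 1" unfolding p_def using T.AE_T[OF step_prob_bounds] .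
  have q_eq: "q b x = step_prob a x" if "r a (first (shift x)) = b" for a b x
  proof -
    have "q b x = (\<Sum>a'\<in>UNIV. if a' = a then step_prob a' x else 0)"
      unfolding q_def using that inj_left by (intro sum.cong) (auto simp: indicator_def)
    then show ?thesis by simp
  qed
  have q_ex: "\<exists>a. r a c = b" for b c using bij_is_surj[OF bij_left[of c]] by (metis surjD)
  have bq: "AE x in \<mu>. \<forall>b. 0 \<le> q b x \<and> q b x \<le> 1"
    using step_prob_bounds by eventually_elim (metis q_eq q_ex)
  have le1: "\<bar>u * v\<bar> \<le> 1" if "0 \<le> u \<and> u \<le> 1" "0 \<le> v \<and> v \<le> 1" for u v :: real
    using that by (simp add: abs_mult mult_le_one)
  have int: "integrable \<mu> (\<lambda>x. f x * g x)"
    if "f \<in> borel_measurable \<mu>" "g \<in> borel_measurable \<mu>" "AE x in \<mu>. 0 \<le> f x \<and> f x \<le> 1" "AE x in \<mu>. 0 \<le> g x \<and> g x \<le> 1"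
    for f g :: "_ \<Rightarrow> real"
  proof (rule integrable_const_bound[where B=1])
    show "AE x in \<mu>. norm (f x * g x) \<le> 1" using that(3,4) by eventually_elim (use le1 in simp)
  qed (use that in measurable)
  have bs: "AE x in \<mu>. 0 \<le> step_prob a x \<and> step_prob a x \<le> 1" for a using step_prob_bounds by eventually_elim simp
  have bp': "AE x in \<mu>. 0 \<le> p b x \<and> p b x \<le> 1" and bq': "AE x in \<mu>. 0 \<le> q b x \<and> q b x \<le> 1" for b
    using bp bq by (eventually_elim, simp)+
  define I where "I = (\<lambda>b. \<integral>x. step_prob b x * step_prob b x \<partial>\<mu>)"
  have pp: "(\<integral>x. p b x * p b x \<partial>\<mu>) = I b" for b
  proof -
    have "(\<integral>x. step_prob b x * step_prob b x \<partial>(distr \<mu> \<mu> \<tau>)) = (\<integral>x. p b x * p b x \<partial>\<mu>)"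
      unfolding p_def by (rule integral_distr) measurable
    then show ?thesis unfolding inv_tau I_def by simp
  qed
  \<comment> \<open>Since \<open>p b\<close> depends on \<open>shift x\<close>, conditioning
    replaces \<open>q b\<close> by the event \<open>first (\<tau> x) = b\<close>; invariance under
    \<open>\<tau>\<close> and a second conditioning give \<open>I b\<close>.\<close>
  have qp: "(\<integral>x. q b x * p b x \<partial>\<mu>) = I b" for b
  proof -
    define h where "h = (\<lambda>a x. indicator {y. r a (first y) = b} (shift x) * p b x)"
    have hF: "h a \<in> borel_measurable shift_algebra" for a unfolding h_def by measurable
    have hm: "h a \<in> borel_measurable \<mu>" for a using measurable_from_subalg[OF subalgebra_shift hF] .
    have hb: "AE x in \<mu>. 0 \<le> h a x \<and> h a x \<le> 1" for a
      using bp'[of b] by eventually_elim (simp add: h_def indicator_def)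
    have fm: "indicator {x. first x = a} \<in> borel_measurable \<mu>" for a :: 'a by measurable
    have "(\<integral>x. q b x * p b x \<partial>\<mu>) = (\<integral>x. (\<Sum>a\<in>UNIV. h a x * step_prob a x) \<partial>\<mu>)"
      unfolding q_def h_def sum_distrib_right by (simp only: mult_ac)
    also have "\<dots> = (\<Sum>a\<in>UNIV. \<integral>x. h a x * step_prob a x \<partial>\<mu>)"
      by (rule Bochner_Integration.integral_sum) (rule int[OF hm step_prob_measurable(2) hb bs])
    also have "\<dots> = (\<Sum>a\<in>UNIV. \<integral>x. h a x * indicator {x. first x = a} x \<partial>\<mu>)"
    proof (intro sum.cong refl step_integral[symmetric] hF)
      fix a show "AE x in \<mu>. \<bar>h a x\<bar> \<le> 1" using hb[of a] by eventually_elim simp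
    qed
    also have "\<dots> = (\<integral>x. (\<Sum>a\<in>UNIV. h a x * indicator {x. first x = a} x) \<partial>\<mu>)"
      by (rule Bochner_Integration.integral_sum[symmetric]) (rule int[OF hm fm hb], simp add: indicator_def)
    also have "\<dots> = (\<integral>x. (\<lambda>y. step_prob b y * indicator {y. first y = b} y) (\<tau> x) \<partial>\<mu>)"
    proof (intro Bochner_Integration.integral_cong refl)
      fix x
      have "(\<Sum>a\<in>UNIV. h a x * indicator {x. first x = a} x) = (\<Sum>a\<in>UNIV. if a = first x then h a x else 0)"
        by (intro sum.cong) (auto simp: indicator_def)
      then show "(\<Sum>a\<in>UNIV. h a x * indicator {x. first x = a} x)
        = (\<lambda>y. step_prob b y * indicator {y. first y = b} y) (\<tau> x)"
        by (simp add: p_def h_def first_tau indicator_def)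
    qed
    also have "\<dots> = (\<integral>y. step_prob b y * indicator {y. first y = b} y \<partial>(distr \<mu> \<mu> \<tau>))"
      by (rule integral_distr[symmetric]) measurable
    also have "\<dots> = I b"
      unfolding inv_tau I_def
    proof (rule step_integral)
      show "AE x in \<mu>. \<bar>step_prob b x\<bar> \<le> 1" using bs[of b] by eventually_elim simp
    qed measurable
    finally show ?thesis .
  qed
  \<comment> \<open>Norms are compared only after summing over \<open>b\<close>: for fixed
    \<open>x\<close> the values \<open>q b x\<close> are a permutation of the values
    \<open>step_prob a x\<close>.\<close>
  have qq: "(\<Sum>b\<in>UNIV. \<integral>x. q b x * q b x \<partial>\<mu>) = (\<Sum>b\<in>UNIV. I b)"
  proof -
    have "(\<Sum>b\<in>UNIV. \<integral>x. q b x * q b x \<partial>\<mu>) = (\<integral>x. (\<Sum>b\<in>UNIV. q b x * q b x) \<partial>\<mu>)"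
      by (rule Bochner_Integration.integral_sum[symmetric]) (rule int[OF _ _ bq' bq'], measurable)
    also have "\<dots> = (\<integral>x. (\<Sum>b\<in>UNIV. step_prob b x * step_prob b x) \<partial>\<mu>)"
    proof (intro Bochner_Integration.integral_cong refl)
      fix x
      show "(\<Sum>b\<in>UNIV. q b x * q b x) = (\<Sum>b\<in>UNIV. step_prob b x * step_prob b x)"
        by (rule sum.reindex_bij_betw[OF bij_left[of "first (shift x)"], of "\<lambda>b. q b x * q b x", symmetric, THEN trans])
           (simp add: q_eq)
    qed
    also have "\<dots> = (\<Sum>b\<in>UNIV. I b)"
      unfolding I_def by (rule Bochner_Integration.integral_sum) (rule int[OF _ _ bs bs], measurable)
    finally show ?thesis .
  qed
  define D where "D = (\<lambda>b. \<integral>x. (q b x - p b x) * (q b x - p b x) \<partial>\<mu>)"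
  have iqq: "integrable \<mu> (\<lambda>x. q b x * q b x)" and iqp: "integrable \<mu> (\<lambda>x. q b x * p b x)"
    and ipp: "integrable \<mu> (\<lambda>x. p b x * p b x)" for b
    by (rule int[OF _ _ bq' bq'], measurable, rule int[OF _ _ bq' bp'], measurable, rule int[OF _ _ bp' bp'], measurable)
  have sq: "(q b x - p b x) * (q b x - p b x) = q b x * q b x - 2 * (q b x * p b x) + p b x * p b x" for b x
    by (simp add: algebra_simps)
  have D: "D b = (\<integral>x. q b x * q b x \<partial>\<mu>) - I b" for b
    unfolding D_def sq using iqq[of b] iqp[of b] ipp[of b] by (simp add: qp pp)
  have "(\<Sum>b\<in>UNIV. D b) = 0" unfolding D by (simp add: sum_subtractf qq)
  moreover have D0: "0 \<le> D b" for b unfolding D_def by (rule Bochner_Integration.integral_nonneg) simp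
  ultimately have Dz: "D b = 0" for b using sum_nonneg_eq_0_iff[of UNIV D] by simp
  have "AE x in \<mu>. q b x = p b x" for b
  proof -
    have "integrable \<mu> (\<lambda>x. (q b x - p b x) * (q b x - p b x))"
      unfolding sq using iqq[of b] iqp[of b] ipp[of b] by simp
    then have "AE x in \<mu>. (q b x - p b x) * (q b x - p b x) = 0"
      using integral_nonneg_eq_0_iff_AE[of \<mu> "\<lambda>x. (q b x - p b x) * (q b x - p b x)"] Dz[of b] by (simp add: D_def)
    then show ?thesis by eventually_elim simp
  qed
  then have "AE x in \<mu>. \<forall>b. q b x = p b x" by (simp add: AE_all_countable)
  then show ?thesis
  proof eventually_elim
    case (elim x)
    show ?case
    proof
      fix a
      show "step_prob (r a (first (shift x))) (\<tau> x) = step_prob a x"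
        using elim q_eq[of a x "r a (first (shift x))"] by (simp add: p_def)
    qed
  qed
qed

text \<open>By \<open>step_prob_tau\<close> each event \<open>step_prob (first x) x \<le> t\<close>
  is invariant under \<open>\<tau>\<close>, hence conditionally independent of \<open>first\<close>.
  All symbols of \<open>alph x\<close> then lie on the same side of \<open>t\<close>, simultaneously
  for every rational \<open>t\<close>.\<close>

lemma step_prob_uniform: "AE x in \<mu>. \<forall>a. step_prob a x = (if a \<in> alph x then 1 / card (alph x) else 0)"
proof -
  have "AE x in \<mu>. \<forall>a\<in>alph x. \<forall>b\<in>alph x. step_prob a x \<le> t \<longrightarrow> step_prob b x \<le> t" for t
  proof -
    define Q where "Q = (\<lambda>x. step_prob (first x) x \<le> t)"
    have [measurable]: "(\<lambda>x. step_prob (first x) x) \<in> borel_measurable \<mu>"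
      by (rule measurable_compose_countable[where f = step_prob]) (use measurable_simple_function[OF simple_first] in auto)
    have Q: "simple_function \<mu> Q"
      unfolding simple_function_finite_type Q_def by measurable
    have "AE x in \<mu>. Q (\<tau> x) = Q x"
      using step_prob_tau by eventually_elim (simp add: Q_def first_tau)
    from invariant_cond_mi_small[OF S.measure_preserving_map_axioms T.measure_preserving_map_axioms _ simple_first Q _ this]
    have small: "\<exists>m\<ge>n. cond_mi \<mu> first Q (\<lambda>x. hist shift first m (shift x)) < e" if "0 < e" for e n
      using that by (simp add: shift_tau hist_tau_iff)
    have B: "{x. Q x} \<in> sets seq_borel" unfolding Q_def sets_M[symmetric]
      using measurable_sets[of "\<lambda>x. step_prob (first x) x" \<mu> borel "{..t}"] by (simp add: vimage_def)
    have "AE x in \<mu>. step_prob a x * indicator {x. Q x} (case_nat a (shift x))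
        = step_prob a x * real_cond_exp \<mu> shift_algebra (indicator {x \<in> space \<mu>. Q x = True}) x" for a
    proof -
      have e: "{x \<in> space \<mu>. first x = a \<and> Q x = True} = {x. first x = a} \<inter> {x. Q x}" by auto
      have e2: "{x \<in> space \<mu>. first x = a} = {x. first x = a}" by simp
      have "AE x in \<mu>. real_cond_exp \<mu> shift_algebra (indicator ({x. first x = a} \<inter> {x. Q x})) x
        = step_prob a x * real_cond_exp \<mu> shift_algebra (indicator {x \<in> space \<mu>. Q x = True}) x"
        using FF.cond_indep_limit[OF simple_first Q small, of a True] by (simp only: e e2 step_prob_def)
      with cond_exp_step[OF B, of a] show ?thesis by eventually_elim (simp only:)
    qed
    moreover have "indicator {x. Q x} (case_nat a (shift x)) = (of_bool (step_prob a x \<le> t) :: real)" for a x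
      using step_prob_shift[of "case_nat a (shift x)" x a] by (simp add: Q_def)
    ultimately have "AE x in \<mu>. \<forall>a. step_prob a x * of_bool (step_prob a x \<le> t)
        = step_prob a x * real_cond_exp \<mu> shift_algebra (indicator {x \<in> space \<mu>. Q x = True}) x"
      by (simp add: AE_all_countable)
    then show ?thesis
    proof eventually_elim
      case (elim x)
      \<comment> \<open>The conditional probability of the event: one number for all
        \<open>a\<close>, yet equal to the truth value at each \<open>a\<close> of positive
        probability.\<close>
      define g where "g = real_cond_exp \<mu> shift_algebra (indicator {x \<in> space \<mu>. Q x = True}) x"
      have "of_bool (step_prob a x \<le> t) = g" if "a \<in> alph x" for a
        using elim[rule_format, of a] that by (simp add: alph_def g_def del: mult_cancel_left1 mult_cancel_left2)
      then have "(of_bool (step_prob a x \<le> t) :: real) = of_bool (step_prob b x \<le> t)" if "a \<in> alph x" "b \<in> alph x" for a b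
        using that by simp
      then show ?case by (metis of_bool_eq_iff)
    qed
  qed
  then have "AE x in \<mu>. \<forall>q :: rat. \<forall>a\<in>alph x. \<forall>b\<in>alph x. step_prob a x \<le> of_rat q \<longrightarrow> step_prob b x \<le> of_rat q"
    by (simp add: AE_all_countable)
  then show ?thesis using sum_step_prob step_prob_bounds
  proof eventually_elim
    case (elim x)
    have le: "step_prob b x \<le> step_prob a x" if ab: "a \<in> alph x" "b \<in> alph x" for a b
    proof (rule ccontr)
      assume "\<not> ?thesis"
      then obtain q where "step_prob a x < of_rat q" "of_rat q < step_prob b x" using of_rat_dense by (metis not_le)
      then show False using elim(1) ab by (meson less_imp_le not_le)
    qed
    have out: "step_prob a x = 0" if "a \<notin> alph x" for a
      using elim(3) that by (auto simp: alph_def not_less intro: antisym)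
    show ?case
    proof
      fix a
      show "step_prob a x = (if a \<in> alph x then 1 / card (alph x) else 0)"
      proof (cases "a \<in> alph x")
        case True
        have "1 = (\<Sum>b\<in>alph x. step_prob b x)"
          unfolding elim(2)[symmetric] by (rule sum.mono_neutral_right) (use out in auto)
        also have "\<dots> = (\<Sum>b\<in>alph x. step_prob a x)" using True le by (intro sum.cong refl antisym) auto
        finally have "step_prob a x * card (alph x) = 1" by (simp add: mult.commute)
        moreover have "card (alph x) \<noteq> 0" using True by auto
        ultimately show ?thesis using True by (simp add: field_simps)
      qed (use out in simp)
    qed
  qed
qed

end

text \<open>The mass of the cylinder of \<open>l\<close> under the product of the uniform distributions on the sets
  \<open>A 0, A 1, \<dots>\<close>.\<close>

primrec cyl_weight :: "'b list \<Rightarrow> (nat \<Rightarrow> 'b::finite set) \<Rightarrow> real" where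
  "cyl_weight [] A = 1"
| "cyl_weight (a # l) A = (if a \<in> first A then 1 / card (first A) else 0) * cyl_weight l (shift A)"

lemma measurable_finite_fun:
  fixes X :: "'m \<Rightarrow> 'c::finite"
  assumes "X \<in> M \<rightarrow>\<^sub>M count_space UNIV"
  shows "(\<lambda>x. f (X x)) \<in> M \<rightarrow>\<^sub>M count_space UNIV" "(\<lambda>x. g (X x) :: real) \<in> borel_measurable M"
  by (rule measurable_compose[OF assms], simp)+

lemma cyl_weight_measurable [measurable]: "cyl_weight l \<in> borel_measurable seq_borel"
proof (induction l)
  case (Cons a l)
  have "(\<lambda>A. (if a \<in> first A then 1 / card (first A) else 0) * cyl_weight l (shift A)) \<in> borel_measurable seq_borel"
    by (intro borel_measurable_times measurable_compose[OF measurable_shift Cons.IH]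
        measurable_finite_fun(2)[OF measurable_first])
  then show ?case by simp
qed simp

lemma cyl_weight_bounds: "0 \<le> cyl_weight l A \<and> cyl_weight l A \<le> 1"
proof (induction l arbitrary: A)
  case (Cons a l)
  have "(if a \<in> first A then 1 / real (card (first A)) else 0) \<le> 1" by (auto simp: divide_le_eq_1 card_gt_0_iff Suc_le_eq)
  moreover have "0 \<le> (if a \<in> first A then 1 / real (card (first A)) else 0)" by simp
  ultimately show ?case
    using Cons.IH[of "shift A"] by (simp add: mult_le_one del: divide_le_eq_1)
qed simp

context shift_measure
begin

lemma integral_shift: "f \<in> borel_measurable \<mu> \<Longrightarrow> (\<integral>x. f (shift x) \<partial>\<mu>) = (\<integral>x. f x \<partial>\<mu> :: real)"
  using integral_distr[OF S.T, of f] unfolding inv by simp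

lemma alph_seq_cong: "shift x = shift y \<Longrightarrow> alph_seq x = alph_seq y"
  by (rule seq_eqI) (simp_all add: first_alph_seq alph_seq_shift[symmetric] alph_shift[of x y])

lemma alph_seq_measurable_shift: "alph_seq \<in> shift_algebra \<rightarrow>\<^sub>M seq_borel"
proof -
  have "alph_seq \<in> seq_borel \<rightarrow>\<^sub>M seq_borel" using alph_seq_measurable unfolding measurable_M_eq .
  from measurable_comp_shift[OF measurable_compose[OF measurable_case_nat_seq[OF measurable_ident] this], of undefined]
  have "(\<lambda>x. alph_seq (case_nat undefined (shift x))) \<in> shift_algebra \<rightarrow>\<^sub>M seq_borel" by simp
  also have "(\<lambda>x. alph_seq (case_nat undefined (shift x))) = alph_seq"
    by (rule ext) (rule alph_seq_cong, simp)
  finally show ?thesis .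
qed

lemma alph_nonempty: "AE x in \<mu>. alph x \<noteq> {}"
  using step_prob_first_pos by eventually_elim (auto simp: alph_def)

definition alph_distr :: "(nat \<Rightarrow> 'b set) measure" where
  "alph_distr = distr \<mu> seq_borel alph_seq"

lemma sets_alph_distr: "sets alph_distr = sets seq_borel"
  by (simp add: alph_distr_def)

lemma alph_distr_shift_measure: "shift_measure alph_distr"
proof -
  interpret N: prob_space alph_distr unfolding alph_distr_def by (rule prob_space_distr) measurable
  have "distr alph_distr alph_distr shift = distr alph_distr seq_borel shift"
    by (rule distr_cong) (simp_all add: sets_alph_distr)
  also have "\<dots> = distr \<mu> seq_borel (shift \<circ> alph_seq)"
    unfolding alph_distr_def by (rule distr_distr) measurable
  also have "shift \<circ> alph_seq = alph_seq \<circ> shift" by (simp add: fun_eq_iff alph_seq_shift)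
  also have "distr \<mu> seq_borel (alph_seq \<circ> shift) = distr (distr \<mu> \<mu> shift) seq_borel alph_seq"
    by (rule distr_distr[symmetric]) measurable
  also have "\<dots> = alph_distr" unfolding inv alph_distr_def ..
  finally show ?thesis by unfold_locales (simp_all add: sets_alph_distr)
qed

end

section \<open>Measures whose alphabet process has zero entropy\<close>

locale zero_alphabet_ca = ca_measure \<mu> \<tau> r
  for \<mu> :: "(nat \<Rightarrow> 'a::finite) measure" and \<tau> :: "(nat \<Rightarrow> 'a) \<Rightarrow> nat \<Rightarrow> 'a" and r +
  assumes zero: "measure_entropy alph_distr shift = 0"
begin

sublocale N: shift_measure alph_distr
  by (rule alph_distr_shift_measure)

lemma AE_alph_distr: "AE A in alph_distr. P A \<Longrightarrow> AE x in \<mu>. P (alph_seq x)"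
  unfolding alph_distr_def by (rule AE_distrD[OF alph_seq_measurable])

lemma alph_determined:
  obtains G where "G \<in> seq_borel \<rightarrow>\<^sub>M count_space UNIV" "AE x in \<mu>. alph x = G (alph_seq (shift x))"
proof -
  obtain G where G: "G \<in> seq_borel \<rightarrow>\<^sub>M count_space UNIV" "AE A in alph_distr. first A = G (shift A)"
    using N.zero_entropy_deterministic[OF zero] by blast
  from AE_alph_distr[OF G(2)] have "AE x in \<mu>. alph x = G (alph_seq (shift x))"
    by (simp add: first_alph_seq alph_seq_shift)
  with G(1) show ?thesis by (rule that)
qed

lemma alph_tau_image: "AE x in \<mu>. alph (\<tau> x) = (\<lambda>b. r b (first (shift x))) ` alph x"
  using step_prob_tau
proof eventually_elim
  case (elim x)
  show ?case
  proof (intro set_eqI iffI)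
    fix b assume b: "b \<in> alph (\<tau> x)"
    obtain a where "b = r a (first (shift x))" using bij_is_surj[OF bij_left] by (metis surjD)
    with b elim show "b \<in> (\<lambda>b. r b (first (shift x))) ` alph x" by (auto simp: alph_def)
  qed (use elim in \<open>auto simp: alph_def\<close>)
qed

text \<open>By zero entropy both \<open>alph x\<close> and \<open>alph (\<tau> x)\<close> are functions of \<open>\<sigma>\<^sup>2 x\<close>, so the relation between
  them does not depend on the choice of \<open>x\<^sub>1\<close>.\<close>

lemma alph_tau_all: "AE x in \<mu>. \<forall>c\<in>alph (shift x). alph (\<tau> x) = (\<lambda>b. r b c) ` alph x"
proof -
  obtain G where Gm [measurable]: "G \<in> seq_borel \<rightarrow>\<^sub>M count_space UNIV"
    and G: "AE x in \<mu>. alph x = G (alph_seq (shift x))" by (rule alph_determined)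
  \<comment> \<open>With \<open>z = shift (shift x)\<close>, \<open>L z\<close> is
    \<open>alph x\<close> and \<open>U z\<close> is \<open>alph (\<tau> x)\<close> almost
    surely.\<close>
  define L where "L = (\<lambda>z. G (alph_seq (case_nat undefined z)))"
  define U where "U = (\<lambda>z. G (alph_seq (\<tau> (case_nat undefined z))))"
  define R where "R = (\<lambda>a z. U z = (\<lambda>b. r b a) ` L z)"
  have as: "alph_seq \<in> seq_borel \<rightarrow>\<^sub>M seq_borel" using alph_seq_measurable unfolding measurable_M_eq .
  have cn: "(\<lambda>z. case_nat undefined z) \<in> (seq_borel :: (nat \<Rightarrow> 'a) measure) \<rightarrow>\<^sub>M seq_borel"
    using measurable_case_nat_seq[OF measurable_ident] by simp
  have [measurable]: "L \<in> seq_borel \<rightarrow>\<^sub>M count_space UNIV"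
    unfolding L_def by (rule measurable_compose[OF measurable_compose[OF cn as] Gm])
  have [measurable]: "U \<in> seq_borel \<rightarrow>\<^sub>M count_space UNIV"
    unfolding U_def by (rule measurable_compose[OF measurable_compose[OF measurable_compose[OF cn measurable_tau] as] Gm])
  have R: "{z. R a z} \<in> sets seq_borel" for a
  proof -
    have "{z \<in> space seq_borel. U z = (\<lambda>S. (\<lambda>b. r b a) ` S) (L z)} \<in> sets seq_borel" by measurable
    then show ?thesis by (simp add: R_def)
  qed
  have Lx: "L (shift y) = G (alph_seq y)" for y
    unfolding L_def by (intro arg_cong[of _ _ G] alph_seq_cong) simp
  have Ux: "U (shift y) = G (alph_seq (\<tau> y))" for y
    unfolding U_def by (intro arg_cong[of _ _ G] alph_seq_cong) (simp add: shift_tau)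
  have "AE x in \<mu>. R (first (shift x)) (shift (shift x))"
    using G T.AE_T[OF G] alph_tau_image
    by eventually_elim (simp add: R_def Lx Ux shift_tau)
  \<comment> \<open>Measurability allows the almost sure statement about \<open>shift x\<close> to
    be read as one about a generic \<open>y\<close>, to which \<open>AE_step\<close>
    applies.\<close>
  moreover have "{y \<in> space \<mu>. R (first y) (shift y)} \<in> sets \<mu>"
  proof -
    have "{y \<in> space \<mu>. R (first y) (shift y)} = (\<Union>a. {y \<in> space \<mu>. first y = a} \<inter> shift -` {z. R a z})" by auto
    also have "\<dots> \<in> sets \<mu>"
      using measurable_sets[OF measurable_shift R] simple_function_fiber[OF simple_first]
      by (intro sets.finite_UN sets.Int) (simp_all add: sets_M)
    finally show ?thesis .
  qed
  ultimately have "AE y in \<mu>. R (first y) (shift y)"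
    using AE_distr_iff[OF S.T, of "\<lambda>y. R (first y) (shift y)"] unfolding inv by simp
  from S.AE_T[OF AE_step[OF this R]]
  have "AE x in \<mu>. \<forall>a. 0 < step_prob a (shift x) \<longrightarrow> R a (shift (shift x))" .
  with G T.AE_T[OF G] show ?thesis
    by eventually_elim (auto simp: alph_def[of "shift _"] R_def Lx Ux shift_tau)
qed

text \<open>For every \<open>c\<close> in the next alphabet the map sending \<open>b\<close> to
  \<open>r b c\<close> has the same image of \<open>alph x\<close>, so the union of these images is
  no larger than one of them; conversely a fixed \<open>a\<close> embeds the next alphabet into
  it.\<close>

lemma alph_tau: "AE x in \<mu>. alph (\<tau> x) = rset (alph x) (alph (shift x)) \<and> card (alph (\<tau> x)) = card (alph x)
    \<and> card (alph (shift x)) \<le> card (alph x)"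
  using alph_tau_all alph_nonempty S.AE_T[OF alph_nonempty]
proof eventually_elim
  case (elim x)
  obtain a c where a: "a \<in> alph x" and c: "c \<in> alph (shift x)" using elim by auto
  have im: "alph (\<tau> x) = (\<lambda>b. r b d) ` alph x" if "d \<in> alph (shift x)" for d using elim that by blast
  have "alph (\<tau> x) = (\<Union>d\<in>alph (shift x). (\<lambda>b. r b d) ` alph x)" using im c by blast
  then have 1: "alph (\<tau> x) = rset (alph x) (alph (shift x))" by (auto simp: rset_def)
  have 2: "card (alph (\<tau> x)) = card (alph x)"
    unfolding im[OF c] by (rule card_image) (simp add: inj_on_def inj_left)
  have "card (alph (shift x)) = card ((\<lambda>d. r a d) ` alph (shift x))"
    by (rule card_image[symmetric]) (simp add: inj_on_def inj_right)
  also have "\<dots> \<le> card (alph (\<tau> x))" by (rule card_mono) (use 1 a in \<open>auto simp: rset_def\<close>)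
  finally show ?case using 1 2 by simp
qed

text \<open>The cardinality does not increase along the shift and has the same integral before and
  after it.\<close>

lemma card_alph_shift: "AE x in \<mu>. card (alph (shift x)) = card (alph x)"
proof -
  let ?c = "\<lambda>x. real (card (alph x))"
  have m: "?c \<in> borel_measurable \<mu>" by (rule measurable_finite_fun(2)) measurable
  have le: "card (alph x) \<le> CARD('a)" for x by (rule card_mono) auto
  have i: "integrable \<mu> ?c"
    by (rule integrable_const_bound[where B = "real CARD('a)"]) (simp_all add: m le)
  have i2: "integrable \<mu> (\<lambda>x. ?c (shift x))"
    by (rule integrable_const_bound[where B = "real CARD('a)"]) (simp_all add: le measurable_compose[OF S.T m])
  have "(\<integral>x. ?c x - ?c (shift x) \<partial>\<mu>) = 0"
    using i i2 integral_shift[OF m] by simp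
  moreover have "AE x in \<mu>. 0 \<le> ?c x - ?c (shift x)" using alph_tau by eventually_elim simp
  ultimately have "AE x in \<mu>. ?c x - ?c (shift x) = 0"
    using integral_nonneg_eq_0_iff_AE[of \<mu> "\<lambda>x. ?c x - ?c (shift x)"] i i2 by simp
  then show ?thesis by eventually_elim simp
qed

lemma alph_seq_tau: "AE x in \<mu>. alph_seq (\<tau> x) = set_rule (alph_seq x)"
proof -
  have "AE x in \<mu>. alph (\<tau> x) = rset (alph x) (alph (shift x))" using alph_tau by eventually_elim simp
  from S.AE_T_pow[OF this]
  have "AE x in \<mu>. \<forall>i. alph (\<tau> ((shift ^^ i) x)) = rset (alph ((shift ^^ i) x)) (alph (shift ((shift ^^ i) x)))"
    by (simp add: AE_all_countable)
  then show ?thesis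
  proof eventually_elim
    case (elim x)
    have e: "(shift ^^ i) (\<tau> x) = \<tau> ((shift ^^ i) x)" for i by (induction i) (simp_all add: shift_tau)
    show ?case by (rule ext) (simp add: alph_seq_def set_rule_def e elim)
  qed
qed

text \<open>Both \<open>\<tau>\<close> and \<open>shift\<close> preserve the cardinality, so all
  entries of all iterates have the size of the first alphabet.\<close>

lemma alph_seq_Zk: "AE x in \<mu>. alph_seq x \<in> Zk \<tau> (card (alph x)) \<and> 0 < card (alph x)"
proof -
  have 1: "AE x in \<mu>. \<forall>n. alph_seq (\<tau> ((\<tau> ^^ n) x)) = set_rule (alph_seq ((\<tau> ^^ n) x))"
    using T.AE_T_pow[OF alph_seq_tau] by (simp add: AE_all_countable)
  have c1: "AE x in \<mu>. card (alph (\<tau> x)) = card (alph x)" using alph_tau by eventually_elim blast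
  have 2: "AE x in \<mu>. \<forall>n. card (alph (\<tau> ((\<tau> ^^ n) x))) = card (alph ((\<tau> ^^ n) x))"
    using T.AE_T_pow[OF c1] by (simp add: AE_all_countable)
  have "AE x in \<mu>. \<forall>i. card (alph (shift ((shift ^^ i) x))) = card (alph ((shift ^^ i) x))"
    using S.AE_T_pow[OF card_alph_shift] by (simp add: AE_all_countable)
  from T.AE_T_pow[OF this]
  have 3: "AE x in \<mu>. \<forall>n i. card (alph (shift ((shift ^^ i) ((\<tau> ^^ n) x)))) = card (alph ((shift ^^ i) ((\<tau> ^^ n) x)))"
    by (simp add: AE_all_countable)
  from 1 2 3 alph_nonempty show ?thesis
  proof eventually_elim
    case (elim x)
    have s: "alph_seq ((\<tau> ^^ n) x) = (set_rule ^^ n) (alph_seq x)" for n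
      by (induction n) (simp_all add: elim(1))
    have c: "card (alph ((\<tau> ^^ n) x)) = card (alph x)" for n
      by (induction n) (simp_all add: elim(2))
    have "card (alph ((shift ^^ i) ((\<tau> ^^ n) x))) = card (alph ((\<tau> ^^ n) x))" for i n
      by (induction i) (simp_all add: elim(3))
    then have "card ((set_rule ^^ n) (alph_seq x) i) = card (alph x)" for n i
      by (simp add: s[symmetric] alph_seq_def c)
    moreover have "0 < card (alph x)" using elim(4) by (simp add: card_gt_0_iff)
    ultimately show ?case by (simp add: Zk_iff)
  qed
qed

lemma alph_seq_Z: "AE x in \<mu>. alph_seq x \<in> Z \<tau>"
  using alph_seq_Zk
proof eventually_elim
  case (elim x)
  have "card (alph x) \<le> CARD('a)" by (rule card_mono) auto
  with elim show ?case unfolding Z_def by (auto intro!: bexI[of _ "card (alph x)"])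
qed

text \<open>The test function \<psi> is carried for the induction. Removing the first symbol must
  rewrite \<psi> as a function of the alphabets of \<open>shift x\<close>; \<open>G\<close> supplies
  the lost first alphabet, and this is where zero entropy enters.\<close>

lemma cyl_integral:
  assumes "\<psi> \<in> borel_measurable seq_borel" "\<And>A. 0 \<le> \<psi> A" "\<And>A. \<psi> A \<le> 1"
  shows "(\<integral>x. indicator (cyl l) x * \<psi> (alph_seq x) \<partial>\<mu>) = (\<integral>x. cyl_weight l (alph_seq x) * \<psi> (alph_seq x) \<partial>\<mu>)"
  using assms
proof (induction l arbitrary: \<psi>)
  case (Cons a l)
  obtain G where Gm: "G \<in> seq_borel \<rightarrow>\<^sub>M count_space UNIV"
    and G: "AE x in \<mu>. alph x = G (alph_seq (shift x))" by (rule alph_determined)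
  note [measurable] = Cons.prems(1)
  define u where "u = (\<lambda>S :: 'a set. if a \<in> S then 1 / real (card S) else 0)"
  have u: "0 \<le> u S" "u S \<le> 1" for S by (auto simp: u_def divide_le_eq_1 card_gt_0_iff Suc_le_eq)
  define \<psi>' where "\<psi>' = (\<lambda>B. \<psi> (case_nat (G B) B) * u (G B))"
  have cG: "(\<lambda>B. case_nat (G B) B) \<in> seq_borel \<rightarrow>\<^sub>M seq_borel"
  proof (rule measurable_seq_borelI)
    fix i show "(\<lambda>B. case_nat (G B) B i) \<in> seq_borel \<rightarrow>\<^sub>M count_space UNIV"
      using Gm by (cases i) auto
  qed
  have m': "\<psi>' \<in> borel_measurable seq_borel"
    unfolding \<psi>'_def
    by (intro borel_measurable_times measurable_compose[OF cG Cons.prems(1)] measurable_finite_fun(2)[OF Gm])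
  have b': "0 \<le> \<psi>' B" "\<psi>' B \<le> 1" for B
    unfolding \<psi>'_def using u Cons.prems(2,3) by (auto intro: mult_le_one)
  have as: "alph_seq \<in> \<mu> \<rightarrow>\<^sub>M seq_borel" by measurable
  define h where "h = (\<lambda>x. indicator (cyl l) (shift x) * \<psi> (alph_seq x))"
  have hF: "h \<in> borel_measurable shift_algebra"
    unfolding h_def
    by (intro borel_measurable_times measurable_comp_shift borel_measurable_indicator sets_cyl
        measurable_compose[OF alph_seq_measurable_shift Cons.prems(1)])
  have hm: "h \<in> borel_measurable \<mu>" using measurable_from_subalg[OF subalgebra_shift hF] .
  have hb: "\<bar>h x\<bar> \<le> 1" for x unfolding h_def using Cons.prems(2,3) by (simp add: indicator_def)
  have key: "AE x in \<mu>. u (first (alph_seq x)) * \<psi> (alph_seq x) = \<psi>' (alph_seq (shift x))"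
    using G
  proof eventually_elim
    case (elim x)
    have "case_nat (alph x) (alph_seq (shift x)) = alph_seq x"
      using case_nat_first_shift[of "alph_seq x"] by (simp only: first_alph_seq alph_seq_shift)
    then show ?case by (simp add: \<psi>'_def elim[symmetric] first_alph_seq)
  qed
  have m1: "(\<lambda>x. indicator (cyl l) (shift x) * \<psi>' (alph_seq (shift x))) \<in> borel_measurable \<mu>"
    and m2: "(\<lambda>x. indicator (cyl l) x * \<psi>' (alph_seq x)) \<in> borel_measurable \<mu>"
    and m3: "(\<lambda>x. cyl_weight l (alph_seq x) * \<psi>' (alph_seq x)) \<in> borel_measurable \<mu>"
    and m4: "(\<lambda>x. cyl_weight l (alph_seq (shift x)) * \<psi>' (alph_seq (shift x))) \<in> borel_measurable \<mu>"
    and m5: "(\<lambda>x. cyl_weight (a # l) (alph_seq x) * \<psi> (alph_seq x)) \<in> borel_measurable \<mu>"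
  proof -
    have i: "(indicator (cyl l) :: _ \<Rightarrow> real) \<in> borel_measurable \<mu>"
      using sets_cyl by (intro borel_measurable_indicator) (simp add: sets_M)
    note p = measurable_compose[OF as m'] and w = measurable_compose[OF as cyl_weight_measurable]
    show m2: "(\<lambda>x. indicator (cyl l) x * \<psi>' (alph_seq x)) \<in> borel_measurable \<mu>" by (rule borel_measurable_times[OF i p])
    show m3: "(\<lambda>x. cyl_weight l (alph_seq x) * \<psi>' (alph_seq x)) \<in> borel_measurable \<mu>" by (rule borel_measurable_times[OF w p])
    show "(\<lambda>x. indicator (cyl l) (shift x) * \<psi>' (alph_seq (shift x))) \<in> borel_measurable \<mu>"
      by (rule measurable_compose[OF S.T m2])
    show "(\<lambda>x. cyl_weight l (alph_seq (shift x)) * \<psi>' (alph_seq (shift x))) \<in> borel_measurable \<mu>"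
      by (rule measurable_compose[OF S.T m3])
    show "(\<lambda>x. cyl_weight (a # l) (alph_seq x) * \<psi> (alph_seq x)) \<in> borel_measurable \<mu>"
      by (rule borel_measurable_times[OF w measurable_compose[OF as Cons.prems(1)]])
  qed
  have "(\<integral>x. indicator (cyl (a # l)) x * \<psi> (alph_seq x) \<partial>\<mu>) = (\<integral>x. h x * indicator {x. first x = a} x \<partial>\<mu>)"
    by (intro Bochner_Integration.integral_cong) (auto simp: h_def indicator_def cyl_Cons)
  also have "\<dots> = (\<integral>x. h x * step_prob a x \<partial>\<mu>)" by (rule step_integral[OF hF]) (simp add: hb)
  also have "\<dots> = (\<integral>x. indicator (cyl l) (shift x) * \<psi>' (alph_seq (shift x)) \<partial>\<mu>)"
  proof (rule integral_cong_AE)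
    show "AE x in \<mu>. h x * step_prob a x = indicator (cyl l) (shift x) * \<psi>' (alph_seq (shift x))"
      using key step_prob_uniform
      by eventually_elim (simp add: h_def first_alph_seq u_def mult_ac)
  qed (use hm m1 in auto)
  also have "\<dots> = (\<integral>x. indicator (cyl l) x * \<psi>' (alph_seq x) \<partial>\<mu>)"
    using integral_shift[OF m2] .
  also have "\<dots> = (\<integral>x. cyl_weight l (alph_seq x) * \<psi>' (alph_seq x) \<partial>\<mu>)"
    by (rule Cons.IH[OF m' b'])
  also have "\<dots> = (\<integral>x. cyl_weight l (alph_seq (shift x)) * \<psi>' (alph_seq (shift x)) \<partial>\<mu>)"
    using integral_shift[OF m3] by simp
  also have "\<dots> = (\<integral>x. cyl_weight (a # l) (alph_seq x) * \<psi> (alph_seq x) \<partial>\<mu>)"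
  proof (rule integral_cong_AE)
    show "AE x in \<mu>. cyl_weight l (alph_seq (shift x)) * \<psi>' (alph_seq (shift x)) = cyl_weight (a # l) (alph_seq x) * \<psi> (alph_seq x)"
      using key by eventually_elim (simp add: u_def alph_seq_shift mult_ac)
  qed (use m4 m5 in auto)
  finally show ?case .
qed simp

text \<open>Recovers \<mu> from the law of its alphabets; injectivity of the correspondence rests on
  this.\<close>

lemma prob_cyl: "prob (cyl l) = (\<integral>A. cyl_weight l A \<partial>alph_distr)"
proof -
  have "prob (cyl l) = (\<integral>x. indicator (cyl l) x * 1 \<partial>\<mu>)" using sets_cyl[of l] by (simp add: sets_M)
  also have "\<dots> = (\<integral>x. cyl_weight l (alph_seq x) * 1 \<partial>\<mu>)" by (rule cyl_integral) auto
  also have "\<dots> = (\<integral>A. cyl_weight l A \<partial>alph_distr)"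
    unfolding alph_distr_def by (subst integral_distr) auto
  finally show ?thesis .
qed

lemma alph_distr_set_rule: "distr alph_distr alph_distr set_rule = alph_distr"
proof -
  have "distr alph_distr alph_distr set_rule = distr alph_distr seq_borel set_rule"
    by (rule distr_cong) (simp_all add: sets_alph_distr)
  also have "\<dots> = distr \<mu> seq_borel (set_rule \<circ> alph_seq)"
    unfolding alph_distr_def by (rule distr_distr) measurable
  also have "\<dots> = distr \<mu> seq_borel (alph_seq \<circ> \<tau>)"
    by (rule distr_cong_AE) (use alph_seq_tau in \<open>auto intro: measurable_comp\<close>)
  also have "\<dots> = distr (distr \<mu> \<mu> \<tau>) seq_borel alph_seq"
    by (rule distr_distr[symmetric]) measurable
  also have "\<dots> = alph_distr" unfolding inv_tau alph_distr_def ..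
  finally show ?thesis .
qed

end

section \<open>Measures on invariant subsets\<close>

text \<open>Arbitrarily late pairs of times are insensitive to one extra step in either direction;
  this gives the strict invariance in \<open>jointly_ergodic_AE\<close>.\<close>

lemma late_Suc:
  fixes P :: "nat \<Rightarrow> nat \<Rightarrow> bool"
  shows "(\<forall>N. \<exists>i\<ge>N. \<exists>j\<ge>N. P (Suc i) j) \<longleftrightarrow> (\<forall>N. \<exists>i\<ge>N. \<exists>j\<ge>N. P i j)" (is "?A \<longleftrightarrow> ?B")
    and "(\<forall>N. \<exists>i\<ge>N. \<exists>j\<ge>N. P i (Suc j)) \<longleftrightarrow> (\<forall>N. \<exists>i\<ge>N. \<exists>j\<ge>N. P i j)" (is "?C \<longleftrightarrow> ?B")
proof -
  have A: "?B" if "?A"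
  proof
    fix N
    from that obtain i j where "i \<ge> N" "j \<ge> N" "P (Suc i) j" by blast
    then show "\<exists>i\<ge>N. \<exists>j\<ge>N. P i j" by (intro exI[of _ "Suc i"] conjI exI[of _ j]) simp_all
  qed
  have C: "?B" if "?C"
  proof
    fix N
    from that obtain i j where "i \<ge> N" "j \<ge> N" "P i (Suc j)" by blast
    then show "\<exists>i\<ge>N. \<exists>j\<ge>N. P i j" by (intro exI[of _ i] conjI exI[of _ "Suc j"]) simp_all
  qed
  have B: "?A \<and> ?C" if "?B"
  proof (intro conjI allI)
    fix N
    from that obtain i j where ij: "i \<ge> Suc N" "j \<ge> Suc N" "P i j" by blast
    then show "\<exists>i\<ge>N. \<exists>j\<ge>N. P (Suc i) j" by (intro exI[of _ "i - 1"] conjI exI[of _ j]) simp_all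
    from ij show "\<exists>i\<ge>N. \<exists>j\<ge>N. P i (Suc j)" by (intro exI[of _ i] conjI exI[of _ "j - 1"]) simp_all
  qed
  show "?A \<longleftrightarrow> ?B" by (rule iffI[OF A conjunct1[OF B]])
  show "?C \<longleftrightarrow> ?B" by (rule iffI[OF C conjunct2[OF B]])
qed

text \<open>The set of points whose \<open>(S, T)\<close>-orbit visits \<open>B\<close> at arbitrarily late times in both directions is
  strictly invariant.\<close>

lemma jointly_ergodic_AE:
  assumes S: "measure_preserving_map M S" and T: "measure_preserving_map M T"
    and comm: "\<And>x. x \<in> space M \<Longrightarrow> S (T x) = T (S x)"
    and erg: "jointly_ergodic S T M" and B: "B \<in> sets M"
    and BS: "AE x in M. S x \<in> B \<longleftrightarrow> x \<in> B" and BT: "AE x in M. T x \<in> B \<longleftrightarrow> x \<in> B"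
  shows "measure M B = 0 \<or> measure M B = 1"
proof -
  interpret S: measure_preserving_map M S by fact
  interpret T: measure_preserving_map M T by fact
  define B' where "B' = {x \<in> space M. \<forall>N. \<exists>i\<ge>N. \<exists>j\<ge>N. (S ^^ i) ((T ^^ j) x) \<in> B}"
  have comm': "(T ^^ j) (S x) = S ((T ^^ j) x)" if "x \<in> space M" for x j
    using that by (induction j) (auto simp: comm T.T_pow_space)
  have meas: "{x \<in> space M. (S ^^ i) ((T ^^ j) x) \<in> B} \<in> sets M" for i j
  proof -
    have "(\<lambda>x. (S ^^ i) ((T ^^ j) x)) \<in> M \<rightarrow>\<^sub>M M" by (rule measurable_compose[OF T.T_pow S.T_pow])
    from measurable_sets[OF this B] show ?thesis by (simp add: vimage_def Int_def conj_commute)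
  qed
  have B'm: "B' \<in> sets M"
    unfolding B'_def
    by (intro sets.sets_Collect_countable_All sets.sets_Collect_countable_Ex sets.sets_Collect_conj meas sets.sets_Collect_const)
  have B'S: "S x \<in> B' \<longleftrightarrow> x \<in> B'" if x: "x \<in> space M" for x
  proof -
    have e: "(S ^^ i) ((T ^^ j) (S x)) = (S ^^ Suc i) ((T ^^ j) x)" for i j
      by (simp add: comm'[OF x] funpow_swap1)
    show ?thesis
      unfolding B'_def mem_Collect_eq e using late_Suc(1)[of "\<lambda>i j. (S ^^ i) ((T ^^ j) x) \<in> B"] x S.T_space[OF x]
      by (simp only: simp_thms)
  qed
  have B'T: "T x \<in> B' \<longleftrightarrow> x \<in> B'" if x: "x \<in> space M" for x
  proof -
    have e: "(S ^^ i) ((T ^^ j) (T x)) = (S ^^ i) ((T ^^ Suc j) x)" for i j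
      by (simp add: funpow_swap1)
    show ?thesis
      unfolding B'_def mem_Collect_eq e using late_Suc(2)[of "\<lambda>i j. (S ^^ i) ((T ^^ j) x) \<in> B"] x T.T_space[OF x]
      by (simp only: simp_thms)
  qed
  have SB: "AE x in M. (S ^^ i) x \<in> B \<longleftrightarrow> x \<in> B" for i
  proof (induction i)
    case (Suc i)
    from S.AE_T_pow[OF BS, of i] Suc.IH show ?case by eventually_elim simp
  qed simp
  have TB: "AE x in M. (T ^^ i) x \<in> B \<longleftrightarrow> x \<in> B" for i
  proof (induction i)
    case (Suc i)
    from T.AE_T_pow[OF BT, of i] Suc.IH show ?case by eventually_elim simp
  qed simp
  have "AE x in M. (S ^^ i) ((T ^^ j) x) \<in> B \<longleftrightarrow> x \<in> B" for i j
    using T.AE_T_pow[OF SB[of i], of j] TB[of j] by eventually_elim simp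
  then have "AE x in M. \<forall>i j. (S ^^ i) ((T ^^ j) x) \<in> B \<longleftrightarrow> x \<in> B" by (simp add: AE_all_countable)
  then have "AE x in M. x \<in> B' \<longleftrightarrow> x \<in> B"
    using AE_space by eventually_elim (auto simp: B'_def)
  then have "measure M B' = measure M B" by (intro S.finite_measure_eq_AE B B'm) auto
  moreover have "S -` B' \<inter> space M = B'" "T -` B' \<inter> space M = B'"
    using B'S B'T sets.sets_into_space[OF B'm] by auto
  ultimately show ?thesis using erg B'm unfolding jointly_ergodic_def by metis
qed

context bipermutative
begin

lemma set_rule_pow_measurable: "set_rule ^^ n \<in> seq_borel \<rightarrow>\<^sub>M seq_borel"
  by (induction n) (auto intro: measurable_comp)

lemma Zk_sets: "0 < k \<Longrightarrow> Zk \<tau> k \<in> sets seq_borel"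
proof -
  assume k: "0 < k"
  have "Zk \<tau> k = {A \<in> space seq_borel. \<forall>n i. card ((set_rule ^^ n) A i) = k}" by (simp add: Zk_iff[OF k] set_eq_iff)
  also have "\<dots> \<in> sets seq_borel"
  proof (intro sets.sets_Collect_countable_All)
    fix n i
    have "(\<lambda>A. card ((set_rule ^^ n) A i)) \<in> seq_borel \<rightarrow>\<^sub>M count_space UNIV"
      by (rule measurable_finite_fun(1)[OF measurable_compose[OF set_rule_pow_measurable measurable_seq_coord]])
    from measurable_sets[OF this, of "{k}"]
    show "{A \<in> space seq_borel. card ((set_rule ^^ n) A i) = k} \<in> sets seq_borel" by (simp add: vimage_def)
  qed
  finally show ?thesis .
qed

lemma Z_sets: "Z \<tau> \<in> sets seq_borel"
  unfolding Z_def by (intro sets.finite_UN) (auto intro: Zk_sets)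

lemma Z_iff: "A \<in> Z \<tau> \<longleftrightarrow> (\<exists>k\<in>{1..CARD('a)}. A \<in> Zk \<tau> k)"
  by (simp add: Z_def)

lemma Zk_card: "A \<in> Zk \<tau> k \<Longrightarrow> card (A i) = k"
  by (simp add: Zk_def)

lemma set_rule_pow_shift: "(set_rule ^^ n) (shift A) = shift ((set_rule ^^ n) A)"
  by (induction n) (simp_all add: shift_set_rule)

lemma Zk_shift: "0 < k \<Longrightarrow> A \<in> Zk \<tau> k \<Longrightarrow> shift A \<in> Zk \<tau> k"
  by (simp add: Zk_iff set_rule_pow_shift shift_def[of "(set_rule ^^ _) _"])

lemma Zk_set_rule: "0 < k \<Longrightarrow> A \<in> Zk \<tau> k \<Longrightarrow> set_rule A \<in> Zk \<tau> k"
proof -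
  assume k: "0 < k" and A: "A \<in> Zk \<tau> k"
  have "card ((set_rule ^^ n) (set_rule A) i) = k" for n i
    using A[unfolded Zk_iff[OF k], rule_format, of "Suc n" i] by (simp add: funpow_swap1)
  then show ?thesis by (simp add: Zk_iff[OF k])
qed

lemma Z_shift: "A \<in> Z \<tau> \<Longrightarrow> shift A \<in> Z \<tau>"
proof -
  assume "A \<in> Z \<tau>"
  then obtain k where k: "k \<in> {1..CARD('a)}" "A \<in> Zk \<tau> k" unfolding Z_iff by blast
  then have "shift A \<in> Zk \<tau> k" by (intro Zk_shift) auto
  with k(1) show ?thesis unfolding Z_iff by blast
qed

lemma Z_set_rule: "A \<in> Z \<tau> \<Longrightarrow> set_rule A \<in> Z \<tau>"
proof -
  assume "A \<in> Z \<tau>"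
  then obtain k where k: "k \<in> {1..CARD('a)}" "A \<in> Zk \<tau> k" unfolding Z_iff by blast
  then have "set_rule A \<in> Zk \<tau> k" by (intro Zk_set_rule) auto
  with k(1) show ?thesis unfolding Z_iff by blast
qed

lemma Z_set_ca: "A \<in> Z \<tau> \<Longrightarrow> set_ca \<tau> A = set_rule A"
proof (rule set_ca_eq)
  fix i assume "A \<in> Z \<tau>"
  then obtain k where "k \<in> {1..CARD('a)}" "A \<in> Zk \<tau> k" unfolding Z_iff by blast
  then show "A i \<noteq> {}" using Zk_card[of A k i] by auto
qed

end

section \<open>Extending a measure from a subset to the whole sequence space\<close>

locale restricted_measure = prob_space \<nu> for \<nu> :: "(nat \<Rightarrow> 'b::finite) measure" +
  fixes C
  assumes C: "C \<in> sets seq_borel" and sets_\<nu>: "sets \<nu> = sets (restrict_space seq_borel C)"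
begin

text \<open>The measure lives on the space \<open>C\<close>, while the results on
  \<open>seq_measure\<close> ask for the sigma-algebra \<open>seq_borel\<close> of all
  sequences.\<close>

definition extended :: "(nat \<Rightarrow> 'b) measure" where
  "extended = distr \<nu> seq_borel (\<lambda>x. x)"

lemma space_\<nu>: "space \<nu> = C"
  using sets_eq_imp_space_eq[OF sets_\<nu>] C by simp

lemma sets_\<nu>_iff: "E \<in> sets \<nu> \<longleftrightarrow> E \<subseteq> C \<and> E \<in> sets seq_borel"
  unfolding sets_\<nu> by (rule sets_restrict_space_iff) (simp add: C)

lemma id_measurable: "(\<lambda>x. x) \<in> \<nu> \<rightarrow>\<^sub>M seq_borel"
  unfolding measurable_cong_sets[OF sets_\<nu> refl] by (rule measurable_restrict_space1) simp

lemma seq_measure_extended: "seq_measure extended"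
proof -
  interpret E: prob_space extended unfolding extended_def by (rule prob_space_distr[OF id_measurable])
  show ?thesis by unfold_locales (simp add: extended_def)
qed

lemma emeasure_extended: "E \<in> sets seq_borel \<Longrightarrow> emeasure extended E = emeasure \<nu> (E \<inter> C)"
  unfolding extended_def by (simp add: emeasure_distr[OF id_measurable] space_\<nu>)

lemma AE_extended: "AE x in extended. x \<in> C"
proof -
  have "(AE x in distr \<nu> seq_borel (\<lambda>x. x). x \<in> C) \<longleftrightarrow> (AE x in \<nu>. x \<in> C)"
    by (rule AE_distr_iff[OF id_measurable]) (use C in simp)
  moreover have "AE x in \<nu>. x \<in> C" using AE_space[of \<nu>] by (simp add: space_\<nu>)
  ultimately show ?thesis unfolding extended_def by blast
qed

lemma restrict_extended: "restrict_space extended C = \<nu>"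
proof (rule measure_eqI)
  have se: "sets extended = sets seq_borel" by (simp add: extended_def)
  show "sets (restrict_space extended C) = sets \<nu>"
    unfolding sets_\<nu> by (rule sets_restrict_space_cong[OF se])
  fix E assume "E \<in> sets (restrict_space extended C)"
  then have E: "E \<in> sets \<nu>" unfolding sets_\<nu> sets_restrict_space_cong[OF se] .
  have "emeasure (restrict_space extended C) E = emeasure extended E"
    by (rule emeasure_restrict_space) (use E C in \<open>auto simp: se sets_\<nu>_iff extended_def\<close>)
  also have "\<dots> = emeasure \<nu> E" using E emeasure_extended[of E] by (simp add: sets_\<nu>_iff Int_absorb2)
  finally show "emeasure (restrict_space extended C) E = emeasure \<nu> E" .
qed

lemma distr_extended:
  assumes f: "f \<in> seq_borel \<rightarrow>\<^sub>M seq_borel" and g: "invariant_under g \<nu>" and fg: "\<And>x. x \<in> C \<Longrightarrow> f x = g x"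
  shows "distr extended extended f = extended"
proof -
  have gm: "g \<in> \<nu> \<rightarrow>\<^sub>M \<nu>" and gd: "distr \<nu> \<nu> g = \<nu>" using g by (auto simp: invariant_under_def)
  have "distr extended extended f = distr extended seq_borel f"
    by (rule distr_cong) (simp_all add: extended_def)
  also have "\<dots> = distr \<nu> seq_borel (f \<circ> (\<lambda>x. x))"
    unfolding extended_def by (rule distr_distr[OF f id_measurable])
  also have "\<dots> = distr \<nu> seq_borel ((\<lambda>x. x) \<circ> g)"
    by (rule distr_cong) (auto simp: space_\<nu> fg)
  also have "\<dots> = distr (distr \<nu> \<nu> g) seq_borel (\<lambda>x. x)"
    by (rule distr_distr[OF id_measurable gm, symmetric])
  finally show ?thesis unfolding gd extended_def[symmetric] .
qed

text \<open>Partitions of \<open>C\<close> and of the whole space are not compared directly. On both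
  sides zero entropy means that the first coordinate has rate 0, and its block entropies
  agree.\<close>

lemma entropy_extended:
  assumes shiftC: "\<And>x. x \<in> C \<Longrightarrow> shift x \<in> C" and inv: "invariant_under shift \<nu>"
  shows "measure_entropy \<nu> shift = 0 \<longleftrightarrow> measure_entropy extended shift = 0"
proof -
  interpret R: measure_preserving_map \<nu> shift
    by unfold_locales (use inv in \<open>auto simp: invariant_under_def\<close>)
  interpret SE: seq_measure extended by (rule seq_measure_extended)
  interpret E: shift_measure extended
    by unfold_locales (rule distr_extended[OF measurable_shift inv refl])
  have sR: "simple_function \<nu> first"
    unfolding simple_function_finite_type using measurable_compose[OF id_measurable measurable_first] .
  have ent: "ent extended (hist shift first n) = ent \<nu> (hist shift first n)" for n
  proof -
    have "simple_function (seq_borel :: (nat \<Rightarrow> 'b) measure) (hist shift first n)"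
      using E.S.simple_hist[OF SE.simple_first, of n] by (simp add: simple_function_def SE.sets_M)
    from ent_distr[OF id_measurable this] show ?thesis by (simp add: extended_def)
  qed
  have rate: "R.ent_rate first = E.S.ent_rate first"
    by (simp add: R.ent_rate_def E.S.ent_rate_def R.ent_incr_def E.S.ent_incr_def ent)
  have dense: "dense_in \<nu> (hist shift first) (sets \<nu>)"
    unfolding dense_in_def
  proof (intro ballI allI impI)
    fix A and e :: real assume A: "A \<in> sets \<nu>" and e: "0 < e"
    obtain m S where mS: "measure extended (sym_diff A {x \<in> space extended. hist shift first m x \<in> S}) < e"
      using SE.hist_dense A e unfolding dense_in_def sets_\<nu>_iff by blast
    have H: "{x. hist shift first m x \<in> S} \<in> sets seq_borel"
      using simple_functionD(2)[OF E.S.simple_hist[OF SE.simple_first], of m S] by (simp add: vimage_def SE.sets_M)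
    have "sym_diff A {x. hist shift first m x \<in> S} \<in> sets seq_borel" using A H by (auto simp: sets_\<nu>_iff)
    then have "measure extended (sym_diff A {x. hist shift first m x \<in> S})
      = measure \<nu> (sym_diff A {x. hist shift first m x \<in> S} \<inter> C)"
      unfolding measure_def by (simp only: emeasure_extended)
    also have "sym_diff A {x. hist shift first m x \<in> S} \<inter> C = sym_diff A {x \<in> space \<nu>. hist shift first m x \<in> S}"
      using A by (auto simp: space_\<nu> sets_\<nu>_iff)
    finally show "\<exists>m S. measure \<nu> (sym_diff A {x \<in> space \<nu>. hist shift first m x \<in> S}) < e"
      using mS by (intro exI[of _ m] exI[of _ S]) simp
  qed
  have denseE: "dense_in extended (hist shift first) (sets extended)"
    using SE.hist_dense by (simp add: SE.sets_M)
  show ?thesis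
  proof
    assume "measure_entropy \<nu> shift = 0"
    from R.ent_rate_zero_if_measure_entropy[OF sR this]
    show "measure_entropy extended shift = 0"
      by (intro E.S.measure_entropy_zero[OF SE.simple_first denseE]) (simp add: rate)
  next
    assume "measure_entropy extended shift = 0"
    from E.S.ent_rate_zero_if_measure_entropy[OF SE.simple_first this]
    show "measure_entropy \<nu> shift = 0"
      by (intro R.measure_entropy_zero[OF sR dense]) (simp add: rate)
  qed
qed

end

lemma (in seq_measure) restricted_measureI:
  assumes C: "C \<in> sets seq_borel" and AE: "AE x in \<mu>. x \<in> C"
  shows "restricted_measure (restrict_space \<mu> C) C"
    and "restricted_measure.extended (restrict_space \<mu> C) = \<mu>"
proof -
  have CM: "C \<in> sets \<mu>" using C by (simp add: sets_M)
  have "emeasure \<mu> C = 1" using AE CM emeasure_eq_1_AE by blast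
  then interpret R: prob_space "restrict_space \<mu> C" by (rule prob_space_restrict_space[OF CM])
  show rm: "restricted_measure (restrict_space \<mu> C) C"
    by unfold_locales (use C sets_restrict_space_cong[OF sets_M] in auto)
  interpret RM: restricted_measure "restrict_space \<mu> C" C by (rule rm)
  show "RM.extended = \<mu>"
  proof (rule measure_eqI)
    show "sets RM.extended = sets \<mu>" by (simp add: RM.extended_def sets_M)
    fix E assume "E \<in> sets RM.extended"
    then have E: "E \<in> sets seq_borel" by (simp add: RM.extended_def)
    have "emeasure RM.extended E = emeasure (restrict_space \<mu> C) (E \<inter> C)" by (rule RM.emeasure_extended[OF E])
    also have "\<dots> = emeasure \<mu> (E \<inter> C)" by (rule emeasure_restrict_space) (use CM in auto)
    also have "\<dots> = emeasure \<mu> E" by (rule emeasure_eq_AE) (use AE E C in \<open>auto simp: sets_M\<close>)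
    finally show "emeasure RM.extended E = emeasure \<mu> E" .
  qed
qed

lemma (in seq_measure) invariant_restrict:
  assumes C: "C \<in> sets seq_borel" and AE: "AE x in \<mu>. x \<in> C"
    and f: "f \<in> seq_borel \<rightarrow>\<^sub>M seq_borel" and inv: "distr \<mu> \<mu> f = \<mu>"
    and fg: "\<And>x. x \<in> C \<Longrightarrow> f x = g x" and fC: "\<And>x. x \<in> C \<Longrightarrow> f x \<in> C"
  shows "invariant_under g (restrict_space \<mu> C)"
proof -
  have CM: "C \<in> sets \<mu>" using C by (simp add: sets_M)
  have sp: "space (restrict_space \<mu> C) = C" using CM by simp
  have fm: "f \<in> \<mu> \<rightarrow>\<^sub>M \<mu>" using f unfolding measurable_cong_sets[OF sets_M sets_M] .
  have "f \<in> restrict_space \<mu> C \<rightarrow>\<^sub>M restrict_space \<mu> C"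
    by (rule measurable_restrict_space2) (use fC sp measurable_restrict_space1[OF fm] in auto)
  then have g: "g \<in> restrict_space \<mu> C \<rightarrow>\<^sub>M restrict_space \<mu> C"
    by (rule measurable_cong[THEN iffD1, rotated]) (simp add: sp fg)
  have "distr (restrict_space \<mu> C) (restrict_space \<mu> C) g = restrict_space \<mu> C"
  proof (rule measure_eqI)
    fix E assume "E \<in> sets (distr (restrict_space \<mu> C) (restrict_space \<mu> C) g)"
    then have E': "E \<in> sets (restrict_space \<mu> C)" by simp
    then have E: "E \<subseteq> C" "E \<in> sets \<mu>" using sets_restrict_space_iff[of C \<mu> E] CM by auto
    have "emeasure (distr (restrict_space \<mu> C) (restrict_space \<mu> C) g) E = emeasure (restrict_space \<mu> C) (g -` E \<inter> C)"
      using emeasure_distr[OF g E'] by (simp only: sp)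
    also have "g -` E \<inter> C = f -` E \<inter> C" using fg by auto
    also have "emeasure (restrict_space \<mu> C) (f -` E \<inter> C) = emeasure \<mu> (f -` E \<inter> C)"
      by (rule emeasure_restrict_space) (use CM in auto)
    also have "\<dots> = emeasure \<mu> (f -` E \<inter> space \<mu>)"
      by (rule emeasure_eq_AE) (use AE measurable_sets[OF fm E(2)] CM in auto)
    also have "\<dots> = emeasure (distr \<mu> \<mu> f) E" by (rule emeasure_distr[OF fm E(2), symmetric])
    also have "\<dots> = emeasure (restrict_space \<mu> C) E"
      unfolding inv by (rule emeasure_restrict_space[symmetric]) (use CM E in auto)
    finally show "emeasure (distr (restrict_space \<mu> C) (restrict_space \<mu> C) g) E = emeasure (restrict_space \<mu> C) E" .
  qed simp
  with g show ?thesis by (simp add: invariant_under_def)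
qed

lemma (in zero_alphabet_ca) alph_distr_restrict:
  assumes erg: "jointly_ergodic shift \<tau> \<mu>"
  shows "restrict_space alph_distr (Z \<tau>) \<in> zero_entropy_Z_measures \<tau>"
proof -
  have AE_Z: "AE A in alph_distr. A \<in> Z \<tau>"
    unfolding alph_distr_def using alph_seq_Z Z_sets
    by (subst AE_distr_iff[OF alph_seq_measurable]) auto
  let ?R = "restrict_space alph_distr (Z \<tau>)"
  have ext: "restricted_measure.extended ?R = alph_distr" and rm: "restricted_measure ?R (Z \<tau>)"
    using N.restricted_measureI[OF Z_sets AE_Z] by auto
  interpret R: restricted_measure ?R "Z \<tau>" by (rule rm)
  have invS: "invariant_under shift ?R"
    by (rule N.invariant_restrict[OF Z_sets AE_Z measurable_shift N.inv refl Z_shift])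
  have invT: "invariant_under (set_ca \<tau>) ?R"
    by (rule N.invariant_restrict[OF Z_sets AE_Z measurable_set_rule alph_distr_set_rule])
       (simp_all add: Z_set_ca Z_set_rule)
  have "measure_entropy ?R shift = 0"
    using R.entropy_extended[OF Z_shift invS] zero by (simp add: ext)
  moreover have "jointly_ergodic shift (set_ca \<tau>) ?R"
    unfolding jointly_ergodic_def
  proof (intro ballI impI)
    fix E assume E: "E \<in> sets ?R" and S: "shift -` E \<inter> space ?R = E" and T: "set_ca \<tau> -` E \<inter> space ?R = E"
    have EZ: "E \<subseteq> Z \<tau>" "E \<in> sets seq_borel" using E by (auto simp: R.sets_\<nu>_iff)
    \<comment> \<open>This preimage is invariant only up to null sets, because
      \<open>alph_seq\<close> takes values in \<open>Z \<tau>\<close> and intertwines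
      \<open>\<tau>\<close> with \<open>set_rule\<close> only almost surely.\<close>
    let ?B = "alph_seq -` E"
    have B: "?B \<in> sets \<mu>" using measurable_sets[OF alph_seq_measurable EZ(2)] by simp
    have "AE x in \<mu>. shift x \<in> ?B \<longleftrightarrow> x \<in> ?B"
      using alph_seq_Z
    proof eventually_elim
      case (elim x)
      then show ?case using S unfolding R.space_\<nu> by (auto simp: alph_seq_shift)
    qed
    moreover have "AE x in \<mu>. \<tau> x \<in> ?B \<longleftrightarrow> x \<in> ?B"
      using alph_seq_Z alph_seq_tau
    proof eventually_elim
      case (elim x)
      have "alph_seq x \<in> E \<longleftrightarrow> alph_seq x \<in> set_ca \<tau> -` E \<inter> Z \<tau>" using T unfolding R.space_\<nu> by simp
      then show ?case using elim by (simp add: Z_set_ca)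
    qed
    ultimately have "prob ?B = 0 \<or> prob ?B = 1"
      by (intro jointly_ergodic_AE[OF S.measure_preserving_map_axioms T.measure_preserving_map_axioms _ erg B])
         (simp_all add: shift_tau)
    moreover have "measure ?R E = prob ?B"
    proof -
      have "measure ?R E = measure alph_distr E"
        by (rule measure_restrict_space) (use EZ Z_sets in \<open>auto simp: sets_alph_distr\<close>)
      then show ?thesis
        unfolding alph_distr_def using measure_distr[OF alph_seq_measurable EZ(2)] by simp
    qed
    ultimately show "measure ?R E = 0 \<or> measure ?R E = 1" by simp
  qed
  ultimately show ?thesis
    unfolding zero_entropy_Z_measures_def
    using R.prob_space_axioms R.sets_\<nu> invS invT by simp
qed

section \<open>Products of uniform distributions\<close>

text \<open>At the empty set \<open>pmf_of_set\<close> is still some distribution, so this is a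
  probability kernel on all sequences of sets; it has the intended meaning when the sets are
  nonempty.\<close>

definition uniform_product :: "(nat \<Rightarrow> 'a::finite set) \<Rightarrow> (nat \<Rightarrow> 'a) measure" where
  "uniform_product A = PiM UNIV (\<lambda>i. measure_pmf (pmf_of_set (A i)))"

lemma sets_uniform_product: "sets (uniform_product A) = sets seq_borel"
  unfolding uniform_product_def sets_seq_borel_PiM by (rule sets_PiM_cong) simp_all

lemma prob_space_uniform_product: "prob_space (uniform_product A)"
  unfolding uniform_product_def by (rule prob_space_PiM) (rule prob_space_measure_pmf)

lemma seq_measure_uniform_product: "seq_measure (uniform_product A)"
  using prob_space_uniform_product[of A] sets_uniform_product[of A]
  by (simp add: seq_measure_def seq_measure_axioms_def)

abbreviation first_pmf :: "(nat \<Rightarrow> 'a set) \<Rightarrow> 'a \<Rightarrow> real" where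
  "first_pmf A a \<equiv> pmf (pmf_of_set (first A)) a"

lemma uniform_product_cyl:
  "measure (uniform_product A) (cyl l) = (\<Prod>i<length l. pmf (pmf_of_set (A i)) (l ! i))"
proof -
  let ?M = "\<lambda>i. measure_pmf (pmf_of_set (A i))"
  interpret P: product_prob_space ?M UNIV
    by (rule product_prob_spaceI) (rule prob_space_measure_pmf)
  have "cyl l = {x \<in> space (PiM UNIV ?M). \<forall>i\<in>{..<length l}. x i \<in> {l ! i}}"
    unfolding cyl_def by (simp add: space_PiM PiE_UNIV_domain Ball_def)
  then have "emeasure (uniform_product A) (cyl l) = (\<Prod>i<length l. emeasure (?M i) {l ! i})"
    unfolding uniform_product_def
    using P.emeasure_PiM_Collect[of "{..<length l}" "\<lambda>i. {l ! i}"] by simp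
  also have "\<dots> = ennreal (\<Prod>i<length l. pmf (pmf_of_set (A i)) (l ! i))"
    by (simp add: emeasure_pmf_single prod_ennreal)
  finally show ?thesis by (simp add: measure_def prod_nonneg)
qed

lemma uniform_product_cyl_Cons:
  "measure (uniform_product A) (cyl (a # l)) = first_pmf A a * measure (uniform_product (shift A)) (cyl l)"
  unfolding uniform_product_cyl length_Cons prod.lessThan_Suc_shift by (simp add: first_def shift_def)

lemma uniform_product_cyl_weight:
  assumes "\<And>i. A i \<noteq> {}"
  shows "measure (uniform_product A) (cyl l) = cyl_weight l A"
  using assms
proof (induction l arbitrary: A)
  case Nil
  interpret prob_space "uniform_product A" by (rule prob_space_uniform_product)
  show ?case using prob_space sets_eq_imp_space_eq[OF sets_uniform_product, of A] by simp
next
  case (Cons a l)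
  have "shift A i \<noteq> {}" for i using Cons.prems[of "Suc i"] by (simp add: shift_def)
  moreover have "first A \<noteq> {}" using Cons.prems[of 0] by (simp add: first_def)
  ultimately show ?case
    using Cons.IH[of "shift A"] by (simp add: uniform_product_cyl_Cons pmf_of_set indicator_def)
qed

text \<open>Independence of the first symbol and the tail: both sides are finite measures in
  \<open>C\<close> that agree on cylinders.\<close>

lemma uniform_product_step:
  assumes C: "C \<in> sets seq_borel"
  shows "measure (uniform_product A) ({x. first x = a} \<inter> shift -` C) = first_pmf A a * measure (uniform_product (shift A)) C"
proof -
  interpret L: seq_measure "uniform_product A" by (rule seq_measure_uniform_product)
  interpret R: seq_measure "uniform_product (shift A)" by (rule seq_measure_uniform_product)
  have fa [measurable]: "{x. first x = a} \<in> sets (uniform_product A)"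
    using simple_function_fiber[OF L.simple_first, of a] by simp
  define D where "D = density (uniform_product A) (indicator {x. first x = a})"
  have sh: "shift \<in> D \<rightarrow>\<^sub>M seq_borel"
    unfolding D_def using measurable_shift by (simp add: measurable_cong_sets[OF sets_uniform_product refl])
  have em: "emeasure (distr D seq_borel shift) C = ennreal (measure (uniform_product A) ({x. first x = a} \<inter> shift -` C))"
    if "C \<in> sets seq_borel" for C
  proof -
    have sC: "shift -` C \<in> sets (uniform_product A)"
      using measurable_sets[OF measurable_shift that] by (simp add: L.sets_M)
    have "emeasure (distr D seq_borel shift) C = emeasure D (shift -` C)"
      using emeasure_distr[OF sh that] by (simp add: D_def)
    also have "\<dots> = emeasure (uniform_product A) ({x. first x = a} \<inter> shift -` C)"
      unfolding D_def using sC by (subst emeasure_density) (auto simp: indicator_inter_arith[symmetric])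
    finally show ?thesis by (simp add: L.emeasure_eq_measure)
  qed
  have "distr D seq_borel shift = scale_measure (ennreal (first_pmf A a)) (uniform_product (shift A))"
  proof (rule measure_eqI_cyl)
    show "finite_measure (distr D seq_borel shift)"
    proof
      have "UNIV \<in> sets (seq_borel :: (nat \<Rightarrow> 'a) measure)" using sets_cyl[of "[]"] by simp
      from em[OF this] show "emeasure (distr D seq_borel shift) (space (distr D seq_borel shift)) \<noteq> \<infinity>" by simp
    qed
    fix l :: "'a list"
    have "{x. first x = a} \<inter> shift -` cyl l = cyl (a # l)" by (auto simp: cyl_Cons)
    then show "emeasure (distr D seq_borel shift) (cyl l) = emeasure (scale_measure (ennreal (first_pmf A a)) (uniform_product (shift A))) (cyl l)"
      unfolding em[OF sets_cyl] by (simp add: uniform_product_cyl_Cons R.emeasure_eq_measure ennreal_mult)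
  qed (simp_all add: sets_uniform_product)
  from arg_cong[OF this, of "\<lambda>M. emeasure M C"]
  have "ennreal (measure (uniform_product A) ({x. first x = a} \<inter> shift -` C))
      = ennreal (first_pmf A a * measure (uniform_product (shift A)) C)"
    unfolding em[OF C] by (simp add: R.emeasure_eq_measure ennreal_mult)
  then show ?thesis by (subst (asm) ennreal_inj) auto
qed

lemma uniform_product_split:
  assumes B: "B \<in> sets seq_borel"
  shows "measure (uniform_product A) B = (\<Sum>a\<in>UNIV. measure (uniform_product A) ({x. first x = a} \<inter> B))"
proof -
  interpret L: seq_measure "uniform_product A" by (rule seq_measure_uniform_product)
  have "{x \<in> B. first x = a} = {x. first x = a} \<inter> B" for a by auto
  then show ?thesis using L.sum_fibers[OF L.simple_first finite subset_UNIV, of B] B by (simp add: L.sets_M)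
qed

lemma sum_first_pmf:
  fixes A :: "nat \<Rightarrow> 'a::finite set"
  shows "(\<Sum>a\<in>UNIV. first_pmf A a) = 1"
  by (rule sum_pmf_eq_1) auto

lemma uniform_product_shift:
  assumes C: "C \<in> sets seq_borel"
  shows "measure (uniform_product A) (shift -` C) = measure (uniform_product (shift A)) C"
proof -
  have "shift -` C \<in> sets (seq_borel :: (nat \<Rightarrow> 'a) measure)" using measurable_sets[OF measurable_shift C] by simp
  from uniform_product_split[OF this, of A] show ?thesis
    by (simp add: uniform_product_step[OF C] sum_distrib_right[symmetric] sum_first_pmf)
qed

lemma distr_uniform_product_shift: "distr (uniform_product A) seq_borel shift = uniform_product (shift A)"
proof -
  interpret L: seq_measure "uniform_product A" by (rule seq_measure_uniform_product)
  interpret R: seq_measure "uniform_product (shift A)" by (rule seq_measure_uniform_product)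
  have sm: "shift \<in> uniform_product A \<rightarrow>\<^sub>M seq_borel" unfolding L.measurable_M_eq by (rule measurable_shift)
  show ?thesis
  proof (rule measure_eqI)
    fix C assume "C \<in> sets (distr (uniform_product A) seq_borel shift)"
    then have C: "C \<in> sets seq_borel" by simp
    show "emeasure (distr (uniform_product A) seq_borel shift) C = emeasure (uniform_product (shift A)) C"
      using emeasure_distr[OF sm C] uniform_product_shift[OF C, of A]
      by (simp add: L.emeasure_eq_measure R.emeasure_eq_measure)
  qed (simp add: sets_uniform_product)
qed

lemma AE_uniform_product_shift_pow:
  assumes "AE x in uniform_product ((shift ^^ i) A). P x"
  shows "AE x in uniform_product A. P ((shift ^^ i) x)"
  using assms
proof (induction i arbitrary: A)
  case (Suc i)
  interpret L: seq_measure "uniform_product A" by (rule seq_measure_uniform_product)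
  have sm: "shift \<in> uniform_product A \<rightarrow>\<^sub>M seq_borel" unfolding L.measurable_M_eq by (rule measurable_shift)
  have "AE x in uniform_product ((shift ^^ i) (shift A)). P x" using Suc.prems unfolding funpow_Suc_right comp_apply .
  from Suc.IH[OF this] have "AE x in distr (uniform_product A) seq_borel shift. P ((shift ^^ i) x)"
    unfolding distr_uniform_product_shift .
  from AE_distrD[OF sm this] show ?case unfolding funpow_Suc_right comp_apply .
next
  case 0
  then show ?case unfolding funpow_0 .
qed

lemma uniform_product_measurable:
  "(uniform_product :: (nat \<Rightarrow> 'a::finite set) \<Rightarrow> _) \<in> seq_borel \<rightarrow>\<^sub>M prob_algebra seq_borel"
proof (rule measurable_prob_algebraI)
  show "(uniform_product :: (nat \<Rightarrow> 'a set) \<Rightarrow> _) \<in> seq_borel \<rightarrow>\<^sub>M subprob_algebra seq_borel"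
  proof (rule measurable_subprob_algebra_generated[OF sets_seq_borel_cyl Int_stable_cyl])
    fix B :: "(nat \<Rightarrow> 'a) set" assume "B \<in> insert {} (range cyl)"
    then consider "B = {}" | l where "B = cyl l" by auto
    then show "(\<lambda>A. emeasure (uniform_product A) B) \<in> borel_measurable seq_borel"
    proof cases
      case 2
      have "emeasure (uniform_product A) B = ennreal (\<Prod>i<length l. pmf (pmf_of_set (A i)) (l ! i))" for A
        unfolding 2 uniform_product_cyl[symmetric]
        by (rule finite_measure.emeasure_eq_measure[OF prob_space.finite_measure[OF prob_space_uniform_product]])
      moreover have "(\<lambda>A. \<Prod>i<length l. pmf (pmf_of_set (A i)) (l ! i)) \<in> borel_measurable seq_borel"
        by (intro borel_measurable_prod measurable_finite_fun(2)[OF measurable_seq_coord])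
      ultimately show ?thesis by simp
    qed simp
  next
    have e: "(\<lambda>A :: nat \<Rightarrow> 'a set. emeasure (uniform_product A) UNIV) = (\<lambda>_. 1)"
    proof
      fix A :: "nat \<Rightarrow> 'a set"
      show "emeasure (uniform_product A) UNIV = 1"
        using prob_space.emeasure_space_1[OF prob_space_uniform_product, of A]
          sets_eq_imp_space_eq[OF sets_uniform_product, of A] by simp
    qed
    show "(\<lambda>A :: nat \<Rightarrow> 'a set. emeasure (uniform_product A) UNIV) \<in> borel_measurable seq_borel"
      unfolding e by simp
  qed (simp_all add: sets_uniform_product prob_space_imp_subprob_space[OF prob_space_uniform_product])
qed (rule prob_space_uniform_product)

text \<open>A shift-invariant set is independent of every cylinder, hence of itself.\<close>

lemma uniform_product_zero_one:
  assumes B: "B \<in> sets seq_borel" and inv: "shift -` B = B"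
  shows "measure (uniform_product A) B = 0 \<or> measure (uniform_product A) B = 1"
proof -
  interpret L: seq_measure "uniform_product A" by (rule seq_measure_uniform_product)
  have BM: "B \<in> sets (uniform_product A)" using B by (simp add: L.sets_M)
  have cyl: "measure (uniform_product A) (cyl l \<inter> B) = measure (uniform_product A) (cyl l) * measure (uniform_product A) B" for l A
  proof (induction l arbitrary: A)
    case Nil
    interpret prob_space "uniform_product A" by (rule prob_space_uniform_product)
    show ?case using prob_space sets_eq_imp_space_eq[OF sets_uniform_product, of A] by simp
  next
    case (Cons a l)
    have "cyl (a # l) \<inter> B = {x. first x = a} \<inter> shift -` (cyl l \<inter> B)" using inv by (auto simp: cyl_Cons)
    then have "measure (uniform_product A) (cyl (a # l) \<inter> B) = first_pmf A a * measure (uniform_product (shift A)) (cyl l \<inter> B)"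
      using uniform_product_step[of "cyl l \<inter> B" A a] B by simp
    also have "\<dots> = first_pmf A a * measure (uniform_product (shift A)) (cyl l) * measure (uniform_product (shift A)) B"
      by (simp add: Cons.IH)
    also have "measure (uniform_product (shift A)) B = measure (uniform_product A) B"
      using uniform_product_shift[OF B, of A] inv by simp
    finally show ?case by (simp add: uniform_product_cyl_Cons)
  qed
  define D where "D = density (uniform_product A) (indicator B)"
  have em: "emeasure D E = ennreal (measure (uniform_product A) (E \<inter> B))" if "E \<in> sets seq_borel" for E
    unfolding D_def using that BM
    by (subst emeasure_density) (auto simp: indicator_inter_arith[symmetric] L.sets_M L.emeasure_eq_measure Int_commute)
  have "D = scale_measure (ennreal (measure (uniform_product A) B)) (uniform_product A)"
  proof (rule measure_eqI_cyl)
    show "finite_measure D"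
    proof
      have "UNIV \<in> sets (seq_borel :: (nat \<Rightarrow> 'a) measure)" using sets_cyl[of "[]"] by simp
      from em[OF this] show "emeasure D (space D) \<noteq> \<infinity>" by (simp add: D_def)
    qed
    show "emeasure D (cyl l) = emeasure (scale_measure (ennreal (measure (uniform_product A) B)) (uniform_product A)) (cyl l)" for l
      unfolding em[OF sets_cyl] cyl by (simp add: L.emeasure_eq_measure ennreal_mult mult.commute)
  qed (simp_all add: D_def L.sets_M)
  from arg_cong[OF this, of "\<lambda>M. emeasure M B"]
  have "ennreal (measure (uniform_product A) B) = ennreal (measure (uniform_product A) B * measure (uniform_product A) B)"
    unfolding em[OF B] by (simp add: L.emeasure_eq_measure ennreal_mult)
  then have "measure (uniform_product A) B = measure (uniform_product A) B * measure (uniform_product A) B"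
    by (subst (asm) ennreal_inj) auto
  then show ?thesis by simp
qed

context bipermutative
begin

text \<open>Given first symbol \<open>a\<close>, the image starts with \<open>v\<close> exactly when
  the next symbol is the solution \<open>b\<close> of \<open>r a b = v\<close>. Constant cardinality
  \<open>k\<close> makes \<open>r a\<close> a bijection from \<open>first (shift A)\<close> to
  \<open>first (set_rule A)\<close> for \<open>a\<close> in \<open>first A\<close>, so the weights 1
  / k match.\<close>

lemma uniform_product_tau:
  assumes k: "0 < k" and A: "A \<in> Zk \<tau> k"
  shows "distr (uniform_product A) seq_borel \<tau> = uniform_product (set_rule A)"
proof -
  have pmf: "first_pmf A a = (if a \<in> first A then 1 / k else 0)" if "A \<in> Zk \<tau> k" for A a
    using Zk_card[OF that, of 0] k by (subst pmf_of_set) (auto simp: first_def indicator_def)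
  have tauC: "\<tau> -` cyl l \<in> sets seq_borel" for l using measurable_sets[OF measurable_tau sets_cyl] by simp
  \<comment> \<open>The stronger claim that the first symbol is independent of the image; fixing it
    lets the induction pass to the next symbol.\<close>
  have G: "measure (uniform_product A) ({x. first x = a} \<inter> \<tau> -` cyl l)
      = first_pmf A a * measure (uniform_product (set_rule A)) (cyl l)" if "A \<in> Zk \<tau> k" for A a l
    using that
  proof (induction l arbitrary: A a)
    case Nil
    interpret prob_space "uniform_product B" for B :: "nat \<Rightarrow> 'a set" by (rule prob_space_uniform_product)
    have U: "measure (uniform_product B) UNIV = 1" for B :: "nat \<Rightarrow> 'a set"
      using prob_space[of B] sets_eq_imp_space_eq[OF sets_uniform_product, of B] by simp
    show ?case using uniform_product_step[OF sets_cyl[of "[]"], of A a] by (simp add: U)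
  next
    case (Cons v l)
    obtain b where b: "r a b = v" using bij_is_surj[OF bij_right[of a]] by (metis surjD)
    have "{x. first x = a} \<inter> \<tau> -` cyl (v # l) = {x. first x = a} \<inter> shift -` ({x. first x = b} \<inter> \<tau> -` cyl l)"
      by (auto simp: cyl_Cons first_tau shift_tau inj_right b[symmetric])
    moreover have "{x. first x = b} \<inter> \<tau> -` cyl l \<in> sets seq_borel"
    proof -
      have "{x \<in> space seq_borel. first x = b} \<in> sets seq_borel" by measurable
      then show ?thesis using tauC by auto
    qed
    ultimately have "measure (uniform_product A) ({x. first x = a} \<inter> \<tau> -` cyl (v # l))
      = first_pmf A a * measure (uniform_product (shift A)) ({x. first x = b} \<inter> \<tau> -` cyl l)"
      using uniform_product_step[of "{x. first x = b} \<inter> \<tau> -` cyl l" A a] by simp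
    also have "\<dots> = first_pmf A a * (first_pmf (shift A) b * measure (uniform_product (set_rule (shift A))) (cyl l))"
      using Cons.IH[OF Zk_shift[OF k Cons.prems]] by simp
    also have "\<dots> = first_pmf A a * (first_pmf (set_rule A) v * measure (uniform_product (shift (set_rule A))) (cyl l))"
    proof (cases "a \<in> first A")
      case True
      have "(\<lambda>b. r a b) ` first (shift A) = first (set_rule A)"
      proof (rule card_subset_eq)
        show "(\<lambda>b. r a b) ` first (shift A) \<subseteq> first (set_rule A)"
          using True by (auto simp: first_set_rule rset_def)
        have "card ((\<lambda>b. r a b) ` first (shift A)) = card (first (shift A))"
          by (rule card_image) (simp add: inj_on_def inj_right)
        then show "card ((\<lambda>b. r a b) ` first (shift A)) = card (first (set_rule A))"
          using Zk_card[OF Zk_shift[OF k Cons.prems], of 0] Zk_card[OF Zk_set_rule[OF k Cons.prems], of 0]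
          by (simp add: first_def)
      qed simp
      moreover have "v \<in> (\<lambda>b. r a b) ` first (shift A) \<longleftrightarrow> b \<in> first (shift A)"
        unfolding b[symmetric] by (auto simp: inj_right)
      ultimately have "v \<in> first (set_rule A) \<longleftrightarrow> b \<in> first (shift A)" by simp
      then have "first_pmf (shift A) b = first_pmf (set_rule A) v"
        unfolding pmf[OF Zk_shift[OF k Cons.prems]] pmf[OF Zk_set_rule[OF k Cons.prems]] by simp
      then show ?thesis by (simp add: shift_set_rule)
    qed (simp add: pmf[OF Cons.prems])
    finally show ?case by (simp add: uniform_product_cyl_Cons)
  qed
  interpret L: seq_measure "uniform_product A" by (rule seq_measure_uniform_product)
  interpret R: seq_measure "uniform_product (set_rule A)" by (rule seq_measure_uniform_product)
  have tm: "\<tau> \<in> uniform_product A \<rightarrow>\<^sub>M seq_borel" unfolding L.measurable_M_eq by (rule measurable_tau)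
  show ?thesis
  proof (rule measure_eqI_cyl)
    show "finite_measure (distr (uniform_product A) seq_borel \<tau>)"
      using L.prob_space_distr[OF tm] by (rule prob_space.finite_measure)
    fix l
    have "emeasure (distr (uniform_product A) seq_borel \<tau>) (cyl l) = emeasure (uniform_product A) (\<tau> -` cyl l)"
      using emeasure_distr[OF tm sets_cyl] by simp
    also have "\<dots> = ennreal (measure (uniform_product (set_rule A)) (cyl l))"
      unfolding L.emeasure_eq_measure uniform_product_split[OF tauC] G[OF A]
      by (simp add: sum_distrib_right[symmetric] sum_first_pmf)
    finally show "emeasure (distr (uniform_product A) seq_borel \<tau>) (cyl l) = emeasure (uniform_product (set_rule A)) (cyl l)"
      by (simp add: R.emeasure_eq_measure)
  qed (simp_all add: sets_uniform_product)
qed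

end

section \<open>From measures on $Z_\tau$ to measures on sequences\<close>

locale zero_Z_measure = restricted_measure \<nu> "Z \<tau>" + bipermutative \<tau> r
  for \<nu> :: "(nat \<Rightarrow> 'a::finite set) measure" and \<tau> :: "(nat \<Rightarrow> 'a) \<Rightarrow> nat \<Rightarrow> 'a" and r +
  assumes invS: "invariant_under shift \<nu>" and invT: "invariant_under (set_ca \<tau>) \<nu>"
    and erg: "jointly_ergodic shift (set_ca \<tau>) \<nu>" and zero: "measure_entropy \<nu> shift = 0"
begin

sublocale SE: seq_measure extended
  by (rule seq_measure_extended)

sublocale E: shift_measure extended
  by unfold_locales (rule distr_extended[OF measurable_shift invS refl])

lemma extended_set_rule: "distr extended extended set_rule = extended"
  by (rule distr_extended[OF measurable_set_rule invT]) (simp add: Z_set_ca)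

lemma zero_extended: "measure_entropy extended shift = 0"
  using entropy_extended[OF Z_shift invS] zero by simp

text \<open>The sets \<open>Zk \<tau> k\<close> divide \<open>Z \<tau>\<close> into finitely many
  strictly invariant pieces, so ergodicity selects one of them.\<close>

lemma ex_card: "\<exists>k. 0 < k \<and> (AE A in extended. A \<in> Zk \<tau> k)"
proof -
  have sub: "Zk \<tau> k \<subseteq> Z \<tau>" if "k \<in> {1..CARD('a)}" for k
    using that unfolding Z_def by blast
  have sets: "Zk \<tau> k \<in> sets \<nu>" if "k \<in> {1..CARD('a)}" for k
    using sub[OF that] Zk_sets[of k] that by (simp add: sets_\<nu>_iff)
  \<comment> \<open>\<open>B\<close> remembers the constant cardinality of \<open>A\<close>, so
    preimages stay in the same piece.\<close>
  have pull_back: "A \<in> Zk \<tau> k" if A: "A \<in> Z \<tau>" and B: "B = shift A \<or> B = set_rule A" "B \<in> Zk \<tau> k" for A B k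
  proof -
    obtain j where j: "j \<in> {1..CARD('a)}" "A \<in> Zk \<tau> j" using A unfolding Z_iff by blast
    then have "B \<in> Zk \<tau> j" using B(1) Zk_shift[of j A] Zk_set_rule[of j A] by auto
    then have "j = k" using Zk_card[of B j 0] Zk_card[OF B(2), of 0] by simp
    with j show ?thesis by simp
  qed
  have zero_one: "prob (Zk \<tau> k) = 0 \<or> prob (Zk \<tau> k) = 1" if k: "k \<in> {1..CARD('a)}" for k
  proof -
    have "shift -` Zk \<tau> k \<inter> space \<nu> = Zk \<tau> k"
    proof (intro set_eqI iffI)
      fix A assume "A \<in> shift -` Zk \<tau> k \<inter> space \<nu>"
      then have "A \<in> Z \<tau>" "shift A \<in> Zk \<tau> k" unfolding space_\<nu> by auto
      then show "A \<in> Zk \<tau> k" by (rule pull_back[OF _ disjI1[OF refl]])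
    next
      fix A assume A: "A \<in> Zk \<tau> k"
      then have "A \<in> Z \<tau>" using sub[OF k] by blast
      then show "A \<in> shift -` Zk \<tau> k \<inter> space \<nu>"
        using Zk_shift[OF _ A] k unfolding space_\<nu> by simp
    qed
    moreover have "set_ca \<tau> -` Zk \<tau> k \<inter> space \<nu> = Zk \<tau> k"
    proof (intro set_eqI iffI)
      fix A assume "A \<in> set_ca \<tau> -` Zk \<tau> k \<inter> space \<nu>"
      then have A: "A \<in> Z \<tau>" "set_ca \<tau> A \<in> Zk \<tau> k" unfolding space_\<nu> by auto
      then have "set_rule A \<in> Zk \<tau> k" using Z_set_ca[OF A(1)] by simp
      then show "A \<in> Zk \<tau> k" by (rule pull_back[OF A(1) disjI2[OF refl]])
    next
      fix A assume A: "A \<in> Zk \<tau> k"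
      then have "A \<in> Z \<tau>" using sub[OF k] by blast
      then show "A \<in> set_ca \<tau> -` Zk \<tau> k \<inter> space \<nu>"
        using Zk_set_rule[OF _ A] k unfolding space_\<nu> by (simp add: Z_set_ca)
    qed
    ultimately show ?thesis using erg sets[OF k] unfolding jointly_ergodic_def by blast
  qed
  have "\<exists>k\<in>{1..CARD('a)}. prob (Zk \<tau> k) \<noteq> 0"
  proof (rule ccontr)
    assume "\<not> ?thesis"
    then have z: "prob (Zk \<tau> k) = 0" if "k \<in> {1..CARD('a)}" for k using that by blast
    have "prob (Z \<tau>) \<le> (\<Sum>k\<in>{1..CARD('a)}. prob (Zk \<tau> k))"
      unfolding Z_def by (rule finite_measure_subadditive_finite) (use sets in auto)
    also have "\<dots> = 0" using z by (intro sum.neutral) blast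
    finally show False using prob_space by (simp add: space_\<nu>)
  qed
  then obtain k where k: "k \<in> {1..CARD('a)}" "prob (Zk \<tau> k) = 1" using zero_one by blast
  have ks: "Zk \<tau> k \<in> sets seq_borel" using k by (intro Zk_sets) auto
  have "emeasure extended (Zk \<tau> k) = emeasure \<nu> (Zk \<tau> k)"
    using emeasure_extended[OF ks] sub[OF k(1)] by (simp add: Int_absorb2)
  then have "SE.prob (Zk \<tau> k) = 1" using k(2) by (simp add: measure_def)
  then have "AE A in extended. A \<in> Zk \<tau> k" using SE.prob_eq_1[of "Zk \<tau> k"] ks by (simp add: SE.sets_M)
  with k(1) show ?thesis by (intro exI[of _ k]) simp
qed

end

section \<open>The mixture of uniform products and its alphabets\<close>

locale zero_Z_measure_card = zero_Z_measure \<nu> \<tau> r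
  for \<nu> :: "(nat \<Rightarrow> 'a::finite set) measure" and \<tau> :: "(nat \<Rightarrow> 'a) \<Rightarrow> nat \<Rightarrow> 'a" and r +
  fixes k :: nat
  assumes k: "0 < k" and AE_k: "AE A in extended. A \<in> Zk \<tau> k"
begin

definition mu :: "(nat \<Rightarrow> 'a) measure" where
  "mu = extended \<bind> uniform_product"

lemma kernel: "uniform_product \<in> extended \<rightarrow>\<^sub>M subprob_algebra (seq_borel :: (nat \<Rightarrow> 'a) measure)"
  unfolding SE.measurable_M_eq by (rule measurable_prob_algebraD[OF uniform_product_measurable])

lemma sets_mu: "sets mu = sets seq_borel"
  unfolding mu_def by (rule sets_bind) (simp_all add: sets_uniform_product)

lemma seq_measure_mu: "seq_measure mu"
proof -
  interpret MU: prob_space mu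
    unfolding mu_def by (rule SE.prob_space_bind[OF _ kernel]) (simp add: prob_space_uniform_product)
  show ?thesis by unfold_locales (rule sets_mu)
qed

lemma emeasure_mu: "B \<in> sets seq_borel \<Longrightarrow> emeasure mu B = (\<integral>\<^sup>+A. emeasure (uniform_product A) B \<partial>extended)"
  unfolding mu_def by (rule emeasure_bind[OF _ kernel]) simp_all

lemma up_measurable: "B \<in> sets seq_borel \<Longrightarrow> (\<lambda>A. measure (uniform_product A) B) \<in> borel_measurable extended"
  by (rule measurable_compose[OF kernel measurable_measure_subprob_algebra])

lemma up_integrable: "B \<in> sets seq_borel \<Longrightarrow> integrable extended (\<lambda>A. measure (uniform_product A) B)"
  by (rule SE.integrable_le_1[OF up_measurable]) (simp_all add: prob_space.prob_le_1[OF prob_space_uniform_product])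

lemma measure_mu: "B \<in> sets seq_borel \<Longrightarrow> measure mu B = (\<integral>A. measure (uniform_product A) B \<partial>extended)"
  unfolding mu_def
  by (rule subprob_space.measure_bind[OF prob_space_imp_subprob_space[OF SE.prob_space_axioms] kernel])

text \<open>The kernel \<open>uniform_product\<close> intertwines \<open>f\<close> with
  \<open>g\<close>, so invariance passes from the law of the sets to the mixture.\<close>

lemma mu_invariant:
  assumes f: "f \<in> seq_borel \<rightarrow>\<^sub>M seq_borel" and g: "g \<in> extended \<rightarrow>\<^sub>M extended" and inv: "distr extended extended g = extended"
    and eq: "AE A in extended. distr (uniform_product A) seq_borel f = uniform_product (g A)"
  shows "distr mu mu f = mu"
proof (rule measure_eqI)
  have fm: "f \<in> mu \<rightarrow>\<^sub>M mu" using f unfolding measurable_cong_sets[OF sets_mu sets_mu] .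
  fix B assume "B \<in> sets (distr mu mu f)"
  then have B: "B \<in> sets seq_borel" by (simp add: sets_mu)
  have sp: "space mu = UNIV" using sets_eq_imp_space_eq[OF sets_mu] by simp
  have fB: "f -` B \<in> sets seq_borel" using measurable_sets[OF f B] by simp
  have "emeasure (distr mu mu f) B = emeasure mu (f -` B)"
    using emeasure_distr[OF fm, of B] B by (simp add: sets_mu sp)
  also have "\<dots> = (\<integral>\<^sup>+A. emeasure (uniform_product A) (f -` B) \<partial>extended)" by (rule emeasure_mu[OF fB])
  also have "\<dots> = (\<integral>\<^sup>+A. emeasure (uniform_product (g A)) B \<partial>extended)"
  proof (rule nn_integral_cong_AE)
    show "AE A in extended. emeasure (uniform_product A) (f -` B) = emeasure (uniform_product (g A)) B"
      using eq
    proof eventually_elim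
      case (elim A)
      have "f \<in> uniform_product A \<rightarrow>\<^sub>M seq_borel" using f by (simp add: measurable_cong_sets[OF sets_uniform_product refl])
      from emeasure_distr[OF this B] show ?case
        using sets_eq_imp_space_eq[OF sets_uniform_product, of A] by (simp add: elim)
    qed
  qed
  also have "\<dots> = (\<integral>\<^sup>+A. emeasure (uniform_product A) B \<partial>(distr extended extended g))"
    using measurable_compose[OF kernel measurable_emeasure_subprob_algebra[OF B]]
    by (intro nn_integral_distr[OF g, symmetric]) simp
  also have "\<dots> = emeasure mu B" unfolding inv by (rule emeasure_mu[OF B, symmetric])
  finally show "emeasure (distr mu mu f) B = emeasure mu B" .
qed simp

sublocale M: ca_measure mu \<tau> r
proof -
  interpret MU: seq_measure mu by (rule seq_measure_mu)
  have 1: "distr mu mu shift = mu"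
    by (intro mu_invariant[OF measurable_shift E.S.T E.inv]) (simp add: distr_uniform_product_shift)
  have 2: "distr mu mu \<tau> = mu"
  proof (rule mu_invariant[OF measurable_tau _ extended_set_rule])
    show "set_rule \<in> extended \<rightarrow>\<^sub>M extended"
      unfolding measurable_cong_sets[OF SE.sets_M SE.sets_M] by (rule measurable_set_rule)
    show "AE A in extended. distr (uniform_product A) seq_borel \<tau> = uniform_product (set_rule A)"
      using AE_k by eventually_elim (rule uniform_product_tau[OF k])
  qed
  show "ca_measure mu \<tau> r" by unfold_locales (rule 1, rule 2)
qed

text \<open>By the zero-one law each product gives \<open>B\<close> mass 0 or 1. The set of
  \<open>A\<close> with mass 1 is strictly invariant in \<open>Z \<tau>\<close>, and its probability
  is that of \<open>B\<close>.\<close>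

lemma mu_ergodic: "jointly_ergodic shift \<tau> mu"
  unfolding jointly_ergodic_def
proof (intro ballI impI)
  fix B assume "B \<in> sets mu" and "shift -` B \<inter> space mu = B" and "\<tau> -` B \<inter> space mu = B"
  then have B: "B \<in> sets seq_borel" and S: "shift -` B = B" and T: "\<tau> -` B = B" by (simp_all add: sets_mu)
  define D where "D = {A \<in> Z \<tau>. measure (uniform_product A) B = 1}"
  have "{A \<in> space seq_borel. measure (uniform_product A) B = 1} \<in> sets seq_borel"
    using up_measurable[OF B] unfolding SE.measurable_M_eq by measurable
  from sets.Int[OF Z_sets this] have Ds: "D \<in> sets seq_borel" by (simp add: D_def Int_def)
  then have D: "D \<in> sets \<nu>" by (auto simp: sets_\<nu>_iff D_def)
  have sh: "measure (uniform_product (shift A)) B = measure (uniform_product A) B" for A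
    using uniform_product_shift[OF B, of A] S by simp
  have ta: "measure (uniform_product (set_rule A)) B = measure (uniform_product A) B" if A: "A \<in> Z \<tau>" for A
  proof -
    obtain j where "j \<in> {1..CARD('a)}" and j2: "A \<in> Zk \<tau> j" using A unfolding Z_iff by blast
    then have "0 < j" by simp
    note j = this j2
    have "\<tau> \<in> uniform_product A \<rightarrow>\<^sub>M seq_borel" by (simp add: measurable_cong_sets[OF sets_uniform_product refl])
    from measure_distr[OF this B] show ?thesis
      unfolding uniform_product_tau[OF j] using T sets_eq_imp_space_eq[OF sets_uniform_product, of A] by simp
  qed
  have "shift -` D \<inter> space \<nu> = D" unfolding space_\<nu> D_def using sh Z_shift by auto
  moreover have "set_ca \<tau> -` D \<inter> space \<nu> = D"
    unfolding space_\<nu> D_def using ta Z_set_rule by (auto simp: Z_set_ca)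
  ultimately have "prob D = 0 \<or> prob D = 1" using erg D unfolding jointly_ergodic_def by blast
  moreover have "measure mu B = prob D"
  proof -
    have "measure mu B = (\<integral>A. indicator D A \<partial>extended)"
      unfolding measure_mu[OF B]
    proof (rule integral_cong_AE)
      show "AE A in extended. measure (uniform_product A) B = indicator D A"
        using AE_extended
      proof eventually_elim
        case (elim A)
        then show ?case using uniform_product_zero_one[OF B S, of A] by (auto simp: D_def)
      qed
      show "indicator D \<in> borel_measurable extended" using Ds by (intro borel_measurable_indicator) (simp add: SE.sets_M)
    qed (rule up_measurable[OF B])
    also have "\<dots> = SE.prob D" by simp
    also have "\<dots> = prob D"
      using emeasure_extended[OF Ds] by (simp add: measure_def Int_absorb2 D_def)
    finally show ?thesis .
  qed
  ultimately show "measure mu B = 0 \<or> measure mu B = 1" by simp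
qed

lemma Zk_nonempty: "A \<in> Zk \<tau> k \<Longrightarrow> A i \<noteq> {}"
  using Zk_card[of A k i] k by auto

lemma first_pmf_Zk: "A \<in> Zk \<tau> k \<Longrightarrow> first_pmf A a = (if a \<in> first A then 1 / k else 0)"
  using Zk_card[of A k 0] k by (subst pmf_of_set) (auto simp: first_def indicator_def)

text \<open>For each \<open>A\<close> the first symbol is independent of the tail and has weights at
  most 1 / k; the bound survives integration over \<open>A\<close>. Both \<open>step_prob_le\<close>
  and \<open>fiber_avg_le\<close> follow from it.\<close>

lemma mu_step_le:
  assumes C: "C \<in> sets seq_borel"
  shows "measure mu ({x. first x = a} \<inter> shift -` C) \<le> measure mu (shift -` C) / k"
proof -
  have fa: "{x :: nat \<Rightarrow> 'a. first x = a} \<in> sets seq_borel" using M.first_sets by (simp add: sets_mu)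
  have sC: "shift -` C \<in> sets seq_borel" using measurable_sets[OF measurable_shift C] by simp
  have "measure mu ({x. first x = a} \<inter> shift -` C) = (\<integral>A. measure (uniform_product A) ({x. first x = a} \<inter> shift -` C) \<partial>extended)"
    using fa sC by (intro measure_mu) auto
  also have "\<dots> \<le> (\<integral>A. measure (uniform_product A) (shift -` C) / k \<partial>extended)"
  proof (rule integral_mono_AE)
    show "AE A in extended. measure (uniform_product A) ({x. first x = a} \<inter> shift -` C) \<le> measure (uniform_product A) (shift -` C) / k"
      using AE_k by eventually_elim (simp add: uniform_product_step[OF C] uniform_product_shift[OF C] first_pmf_Zk)
  qed (use up_integrable fa sC in auto)
  also have "\<dots> = measure mu (shift -` C) / k" by (simp add: measure_mu[OF sC])
  finally show ?thesis .
qed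

lemma step_prob_le: "AE x in mu. \<forall>a. M.step_prob a x \<le> 1 / k"
proof -
  have "AE x in mu. M.step_prob a x \<le> 1 / k" for a
  proof -
    \<comment> \<open>The tails where the bound fails; a strict excess there is compatible with
      \<open>mu_step_le\<close> only on a null set.\<close>
    define D where "D = {y. 1 / real k < M.stepP a y}"
    have D: "D \<in> sets seq_borel"
    proof -
      have "{y \<in> space seq_borel. 1 / real k < M.stepP a y} \<in> sets seq_borel" by measurable
      then show ?thesis by (simp add: D_def)
    qed
    let ?h = "\<lambda>x. indicator D (shift x) :: real"
    have h: "?h \<in> borel_measurable shift_algebra"
      by (rule M.measurable_comp_shift[OF borel_measurable_indicator[OF D]])
    have sD: "shift -` D \<in> sets mu" using measurable_sets[OF measurable_shift D] by (simp add: sets_mu)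
    have ih: "integrable mu ?h"
      by (rule M.integrable_le_1[OF measurable_from_subalg[OF M.subalgebra_shift h]]) (simp add: indicator_def)
    have ihs: "integrable mu (\<lambda>x. ?h x * M.step_prob a x)"
    proof (rule Bochner_Integration.integrable_bound[OF M.step_prob_integrable[of a]])
      show "(\<lambda>x. ?h x * M.step_prob a x) \<in> borel_measurable mu"
        using measurable_from_subalg[OF M.subalgebra_shift h] by (intro borel_measurable_times) auto
    qed (simp add: indicator_def)
    have e: "(indicator (shift -` D) :: (nat \<Rightarrow> 'a) \<Rightarrow> real) = ?h" by (simp add: fun_eq_iff indicator_def)
    have "(\<integral>x. ?h x * M.step_prob a x \<partial>mu) = (\<integral>x. ?h x * indicator {x. first x = a} x \<partial>mu)"
      by (rule M.step_integral[symmetric, OF h]) (simp add: indicator_def)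
    also have "\<dots> = (\<integral>x. indicator ({x. first x = a} \<inter> shift -` D) x \<partial>mu)"
      by (intro Bochner_Integration.integral_cong) (auto simp: indicator_def)
    also have "\<dots> = measure mu ({x. first x = a} \<inter> shift -` D)" by simp
    also have "\<dots> \<le> measure mu (shift -` D) / k" by (rule mu_step_le[OF D])
    also have "measure mu (shift -` D) = (\<integral>x. ?h x \<partial>mu)" unfolding e[symmetric] by simp
    finally have "(\<integral>x. ?h x * M.step_prob a x - ?h x / k \<partial>mu) \<le> 0" using ih ihs by simp
    moreover have nn: "0 \<le> ?h x * M.step_prob a x - ?h x / k" for x
      by (simp add: indicator_def D_def M.step_prob_eq)
    ultimately have "(\<integral>x. ?h x * M.step_prob a x - ?h x / k \<partial>mu) = 0"
      by (intro antisym Bochner_Integration.integral_nonneg) auto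
    then have "AE x in mu. ?h x * M.step_prob a x - ?h x / k = 0"
      using integral_nonneg_eq_0_iff_AE[of mu "\<lambda>x. ?h x * M.step_prob a x - ?h x / k"] nn ih ihs by simp
    then show ?thesis
    proof eventually_elim
      case (elim x)
      then show ?case
        by (cases "1 / real k < M.stepP a (shift x)") (auto simp: indicator_def D_def M.step_prob_eq)
    qed
  qed
  then show ?thesis by (simp add: AE_all_countable)
qed

text \<open>A cylinder that meets the product of the first \<open>n\<close> sets of \<open>A\<close> has \<open>mu\<close>-mass at least \<open>k\<^sup>-\<^sup>n\<close> times the mass
  of the cylinder of \<open>A\<close>.\<close>

lemma ent_mu_le: "ent mu (hist shift first n) \<le> ent extended (hist shift first n) + n * ln k"
proof -
  let ?HM = "hist shift first n :: (nat \<Rightarrow> 'a) \<Rightarrow> _" and ?HE = "hist shift first n :: (nat \<Rightarrow> 'a set) \<Rightarrow> _"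
  have sM: "simple_function mu ?HM" by (rule M.S.simple_hist[OF M.simple_first])
  have sE: "simple_function extended ?HE" by (rule E.S.simple_hist[OF SE.simple_first])
  have fibM: "fiber_prob mu ?HM x = measure mu (cyl (?HM x))" for x by (simp add: fiber_prob_def cyl_eq)
  have cw: "cyl_weight l A = (1 / k) ^ length l" if "A \<in> Zk \<tau> k" "0 < cyl_weight l A" for l A
    using that
  proof (induction l arbitrary: A)
    case (Cons a l)
    have "0 < cyl_weight l (shift A)" "a \<in> first A"
      using Cons.prems(2) cyl_weight_bounds[of l "shift A"] by (auto simp: zero_less_mult_iff split: if_splits)
    then show ?case using Cons.IH[OF Zk_shift[OF k Cons.prems(1)]] Zk_card[OF Cons.prems(1), of 0]
      by (simp add: first_def)
  qed simp
  have cw_cong: "cyl_weight l A = cyl_weight l A'" if "hist shift first (length l) A = hist shift first (length l) A'" for l and A A' :: "nat \<Rightarrow> 'a set"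
    using that
  proof (induction l arbitrary: A A')
    case (Cons a l)
    from Cons.prems have 1: "first A = first A'"
      and 2: "hist shift first (length l) (shift A) = hist shift first (length l) (shift A')"
      by (simp_all add: hist_Suc)
    show ?case unfolding cyl_weight.simps 1 Cons.IH[OF 2] ..
  qed simp
  have key: "AE A in extended. AE x in uniform_product A. fiber_prob extended ?HE A * (1 / k) ^ n \<le> measure mu (cyl (?HM x))"
    using AE_k
  proof eventually_elim
    case (elim A)
    interpret L: seq_measure "uniform_product A" by (rule seq_measure_uniform_product)
    have sL: "simple_function (uniform_product A) ?HM"
      using sM by (simp add: simple_function_def L.sets_M sets_mu)
    show ?case using L.fiber_prob_pos[OF sL]
    proof eventually_elim
      case (elim x)
      let ?w = "?HM x"
      have up: "measure (uniform_product A) (cyl ?w) = cyl_weight ?w A"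
        by (rule uniform_product_cyl_weight[OF Zk_nonempty[OF \<open>A \<in> Zk \<tau> k\<close>]])
      have "fiber_prob (uniform_product A) ?HM x = measure (uniform_product A) (cyl ?w)"
        by (simp add: fiber_prob_def cyl_eq)
      then have pos: "0 < cyl_weight ?w A" using elim up by simp
      then have c: "cyl_weight ?w A = (1 / k) ^ n" using cw[OF \<open>A \<in> Zk \<tau> k\<close> pos] by simp
      define D where "D = {A'. ?HE A' = ?HE A}"
      have Dm: "D \<in> sets extended" using simple_function_fiber[OF sE, of "?HE A"] by (simp add: D_def)
      have "fiber_prob extended ?HE A * (1 / k) ^ n = (\<integral>A'. indicator D A' * (1 / k) ^ n \<partial>extended)"
        by (simp add: fiber_prob_def D_def)
      also have "\<dots> \<le> (\<integral>A'. measure (uniform_product A') (cyl ?w) \<partial>extended)"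
      proof (rule integral_mono_AE)
        show "AE A' in extended. indicator D A' * (1 / k) ^ n \<le> measure (uniform_product A') (cyl ?w)"
          using AE_k
        proof eventually_elim
          case (elim A')
          have "measure (uniform_product A') (cyl ?w) = cyl_weight ?w A'"
            by (rule uniform_product_cyl_weight[OF Zk_nonempty[OF elim]])
          moreover have "cyl_weight ?w A' = cyl_weight ?w A" if "A' \<in> D"
            using that by (intro cw_cong) (simp add: D_def)
          ultimately have "measure (uniform_product A') (cyl ?w) = (1 / k) ^ n" if "A' \<in> D"
            using that c by simp
          then show ?case by (simp add: indicator_def)
        qed
        show "integrable extended (\<lambda>A'. indicator D A' * (1 / k) ^ n)"
          using Dm by (simp add: SE.emeasure_eq_measure)
      qed (rule up_integrable[OF sets_cyl])
      also have "\<dots> = measure mu (cyl ?w)" by (rule measure_mu[OF sets_cyl, symmetric])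
      finally show ?case .
    qed
  qed
  let ?f = "\<lambda>x. ennreal (- ln (fiber_prob mu ?HM x))"
  have fb: "0 \<le> - ln (fiber_prob mu ?HM x)" if "0 < fiber_prob mu ?HM x" for x
    using that M.fiber_prob_le_1[of ?HM x] by simp
  have eb: "AE A in extended. 0 \<le> - ln (fiber_prob extended ?HE A)"
    using SE.fiber_prob_pos[OF sE] by eventually_elim (simp add: SE.fiber_prob_le_1)
  have "ennreal (ent mu ?HM) = (\<integral>\<^sup>+x. ?f x \<partial>mu)"
    unfolding ent_def
  proof (rule nn_integral_eq_integral[symmetric])
    show "AE x in mu. 0 \<le> - ln (fiber_prob mu ?HM x)" using M.fiber_prob_pos[OF sM] by eventually_elim (rule fb)
  qed (use M.ent_integrable[OF sM] in simp)
  also have "\<dots> = (\<integral>\<^sup>+A. \<integral>\<^sup>+x. ?f x \<partial>uniform_product A \<partial>extended)"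
  proof -
    have "?f \<in> borel_measurable seq_borel"
      using borel_measurable_integrable[OF M.ent_integrable[OF sM]] unfolding M.measurable_M_eq by measurable
    from nn_integral_bind[OF this kernel] show ?thesis unfolding mu_def .
  qed
  also have "\<dots> \<le> (\<integral>\<^sup>+A. ennreal (- ln (fiber_prob extended ?HE A) + n * ln k) \<partial>extended)"
  proof (rule nn_integral_mono_AE)
    show "AE A in extended. (\<integral>\<^sup>+x. ?f x \<partial>uniform_product A) \<le> ennreal (- ln (fiber_prob extended ?HE A) + n * ln k)"
      using key SE.fiber_prob_pos[OF sE]
    proof eventually_elim
      case (elim A)
      interpret L: seq_measure "uniform_product A" by (rule seq_measure_uniform_product)
      have "(\<integral>\<^sup>+x. ?f x \<partial>uniform_product A) \<le> (\<integral>\<^sup>+x. ennreal (- ln (fiber_prob extended ?HE A) + n * ln k) \<partial>uniform_product A)"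
      proof (rule nn_integral_mono_AE)
        show "AE x in uniform_product A. ?f x \<le> ennreal (- ln (fiber_prob extended ?HE A) + n * ln k)"
          using elim(1)
        proof eventually_elim
          case (elim x)
          have p: "0 < fiber_prob extended ?HE A * (1 / k) ^ n" using \<open>0 < fiber_prob extended ?HE A\<close> k by simp
          have "ln (fiber_prob extended ?HE A * (1 / k) ^ n) \<le> ln (measure mu (cyl (?HM x)))"
            using elim p by (intro ln_mono) auto
          moreover have "ln (fiber_prob extended ?HE A * (1 / k) ^ n) = ln (fiber_prob extended ?HE A) - n * ln k"
            using \<open>0 < fiber_prob extended ?HE A\<close> k by (simp add: ln_mult ln_realpow ln_div)
          ultimately show ?case unfolding fibM by (intro ennreal_leI) linarith
        qed
      qed
      also have "\<dots> = ennreal (- ln (fiber_prob extended ?HE A) + n * ln k)"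
        using L.emeasure_space_1 by simp
      finally show ?case .
    qed
  qed
  also have "\<dots> = ennreal (ent extended ?HE + n * ln k)"
  proof -
    have "(\<integral>\<^sup>+A. ennreal (- ln (fiber_prob extended ?HE A) + n * ln k) \<partial>extended)
      = ennreal (\<integral>A. - ln (fiber_prob extended ?HE A) + n * ln k \<partial>extended)"
    proof (rule nn_integral_eq_integral)
      have "0 \<le> n * ln k" using k by simp
      with eb show "AE A in extended. 0 \<le> - ln (fiber_prob extended ?HE A) + n * ln k"
        by (auto elim!: eventually_mono)
    qed (use SE.ent_integrable[OF sE] in simp)
    also have "(\<integral>A. - ln (fiber_prob extended ?HE A) + n * ln k \<partial>extended) = ent extended ?HE + n * ln k"
      unfolding ent_def using SE.ent_integrable[OF sE] SE.prob_space by simp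
    finally show ?thesis .
  qed
  finally show ?thesis
    using SE.ent_nonneg[OF sE] k by (subst (asm) ennreal_le_iff) auto
qed

lemma rate_mu_le: "M.S.ent_rate first \<le> ln k"
proof -
  have "E.S.ent_rate first = 0"
    by (rule E.S.ent_rate_zero_if_measure_entropy[OF SE.simple_first zero_extended])
  then have lim: "(\<lambda>n. ent extended (hist shift first n) / n + ln k) \<longlonglongrightarrow> 0 + ln k"
    using E.S.ent_hist_tendsto[OF SE.simple_first] by (intro tendsto_add tendsto_const) simp
  have "eventually (\<lambda>n. ent mu (hist shift first n) / n \<le> ent extended (hist shift first n) / n + ln k) sequentially"
    using eventually_gt_at_top[of 0]
  proof eventually_elim
    case (elim n)
    have "ent mu (hist shift first n) / n \<le> (ent extended (hist shift first n) + n * ln k) / n"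
      by (rule divide_right_mono[OF ent_mu_le]) simp
    then show ?case using elim by (simp add: add_divide_distrib)
  qed
  then have "M.S.ent_rate first \<le> 0 + ln k"
    by (rule tendsto_le[OF sequentially_bot lim M.S.ent_hist_tendsto[OF M.simple_first]])
  then show ?thesis by simp
qed

end

context zero_Z_measure_card
begin

lemma fiber_avg_le:
  "fiber_avg mu (\<lambda>x. hist shift first m (shift x)) {x. first x = a} x \<le> 1 / k"
proof -
  let ?Y = "\<lambda>x :: nat \<Rightarrow> 'a. hist shift first m (shift x)"
  have e1: "{y \<in> {x. first x = a}. ?Y y = ?Y x} = {x. first x = a} \<inter> shift -` cyl (?Y x)" by (auto simp: cyl_eq)
  have e2: "{y \<in> space mu. ?Y y = ?Y x} = shift -` cyl (?Y x)" by (auto simp: cyl_eq)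
  have "measure mu {y \<in> {x. first x = a}. ?Y y = ?Y x} \<le> fiber_prob mu ?Y x / k"
    unfolding fiber_prob_def e1 e2 by (rule mu_step_le[OF sets_cyl])
  moreover have "0 \<le> fiber_prob mu ?Y x" by (simp add: fiber_prob_def)
  ultimately show ?thesis
    unfolding fiber_avg_def using k
    by (cases "fiber_prob mu ?Y x = 0") (simp_all add: field_simps)
qed

text \<open>Conditional probabilities \<open>c\<^sub>a \<le> 1 / k\<close> have entropy at least \<open>ln k + (\<Sum>a. c\<^sub>a (1 - k c\<^sub>a))\<close>, while the entropy
  rate is at most \<open>ln k\<close>.\<close>

lemma step_prob_values: "AE x in mu. \<forall>a. M.step_prob a x = 0 \<or> M.step_prob a x = 1 / k"
proof -
  define Y where "Y = (\<lambda>m (x :: nat \<Rightarrow> 'a). hist shift first m (shift x))"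
  define c where "c = (\<lambda>m a. fiber_avg mu (Y m) {x. first x = a})"
  \<comment> \<open>\<phi> t = t (ln k + 1 - k t) lies below -t ln t, by ln (k t) \<le> k t - 1, and
    unlike the latter it is Lipschitz on [0, 1 / k].\<close>
  define \<phi> where "\<phi> = (\<lambda>t :: real. t * ln k + t - k * (t * t))"
  \<comment> \<open>\<open>step_prob\<close> clipped to its almost sure range, so that the Lipschitz
    estimate applies at every point.\<close>
  define p where "p = (\<lambda>a x. max 0 (min (1 / k) (M.step_prob a x)))"
  have lnk: "0 \<le> ln k" using k by simp
  have sY: "simple_function mu (Y m)" for m
    unfolding Y_def by (rule M.S.simple_T[OF M.S.simple_hist[OF M.simple_first]])
  have c0: "0 \<le> c m a x" and c1: "c m a x \<le> 1 / k" for m a x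
    unfolding c_def using M.fiber_avg_bounds[OF sY M.first_sets] fiber_avg_le unfolding Y_def by auto
  have k1: "1 / real k \<le> 1" using k by simp
  have p0: "0 \<le> p a x" and p1: "p a x \<le> 1 / k" for a x by (auto simp: p_def)
  have p_eq: "AE x in mu. \<forall>a. p a x = M.step_prob a x"
    using M.step_prob_bounds step_prob_le by eventually_elim (simp add: p_def)
  have pm: "p a \<in> borel_measurable mu" for a unfolding p_def by measurable
  have pi: "integrable mu (p a)" for a
    by (rule M.integrable_le_1[OF pm]) (use p0 p1 k1 in \<open>metis abs_of_nonneg order_trans\<close>)
  have cs: "simple_function mu (c m a)" for m a unfolding c_def by (rule M.simple_function_fiber_avg[OF sY])
  have ci: "integrable mu (c m a)" for m a by (rule M.simple_function_integrable[OF cs])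
  have phi_c: "integrable mu (\<lambda>x. \<phi> (c m a x))" for m a by (rule M.integrable_comp_simple[OF cs])
  have pp: "integrable mu (\<lambda>x. p a x * p a x)" for a
  proof (rule M.integrable_le_1)
    show "(\<lambda>x. p a x * p a x) \<in> borel_measurable mu" using pm by measurable
    fix x show "\<bar>p a x * p a x\<bar> \<le> 1" using p0[of a x] order_trans[OF p1 k1, of a x] by (simp add: abs_mult mult_le_one)
  qed
  have phi_p: "integrable mu (\<lambda>x. \<phi> (p a x))" for a unfolding \<phi>_def using pi[of a] pp[of a] by simp
  define D where "D = (\<lambda>a m. \<integral>x. \<bar>c m a x - p a x\<bar> \<partial>mu)"
  have D: "D a \<longlonglongrightarrow> 0" for a
  proof -
    have "D a m = (\<integral>x. \<bar>fiber_avg mu (Y m) {x. first x = a} x - real_cond_exp mu shift_algebra (indicator {x. first x = a}) x\<bar> \<partial>mu)" for m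
      unfolding D_def c_def
    proof (rule integral_cong_AE)
      show "AE x in mu. \<bar>fiber_avg mu (Y m) {x. first x = a} x - p a x\<bar> =
          \<bar>fiber_avg mu (Y m) {x. first x = a} x - real_cond_exp mu shift_algebra (indicator {x. first x = a}) x\<bar>"
        using p_eq by eventually_elim (simp add: M.step_prob_def)
    qed (use borel_measurable_integrable[OF ci[unfolded c_def]] pm in auto)
    then have "D a = (\<lambda>m. \<integral>x. \<bar>fiber_avg mu (Y m) {x. first x = a} x - real_cond_exp mu shift_algebra (indicator {x. first x = a}) x\<bar> \<partial>mu)"
      by (rule ext)
    then show ?thesis using M.FF.fiber_avg_tendsto[OF M.first_sets[of a]] by (simp only: Y_def)
  qed
  \<comment> \<open>A Lipschitz constant for \<phi>: the difference quotient is ln k + 1 - k (s +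
    t), with 0 \<le> k (s + t) \<le> 2.\<close>
  define L where "L = ln k + 1 + 2"
  have lip: "\<bar>\<phi> s - \<phi> t\<bar> \<le> L * \<bar>s - t\<bar>" if "0 \<le> s" "s \<le> 1 / k" "0 \<le> t" "t \<le> 1 / k" for s t
  proof -
    have "\<phi> s - \<phi> t = (ln k + 1 - k * (s + t)) * (s - t)" by (simp add: \<phi>_def algebra_simps)
    moreover have "0 \<le> k * (s + t)" using that by simp
    moreover have "k * (s + t) \<le> 2"
    proof -
      have "k * (s + t) \<le> k * (1 / k + 1 / k)" using that by (intro mult_left_mono) auto
      then show ?thesis using k by simp
    qed
    ultimately have "\<bar>ln k + 1 - k * (s + t)\<bar> \<le> L" using lnk unfolding L_def by linarith
    then show ?thesis unfolding \<open>\<phi> s - \<phi> t = _\<close> abs_mult by (rule mult_right_mono) simp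
  qed
  have lim: "(\<lambda>m. \<integral>x. \<phi> (c m a x) \<partial>mu) \<longlonglongrightarrow> (\<integral>x. \<phi> (p a x) \<partial>mu)" for a
  proof (rule LIM_zero_cancel, rule Lim_null_comparison)
    show "eventually (\<lambda>m. norm ((\<integral>x. \<phi> (c m a x) \<partial>mu) - (\<integral>x. \<phi> (p a x) \<partial>mu)) \<le> L * D a m) sequentially"
    proof (rule always_eventually, rule allI)
      fix m
      have "norm ((\<integral>x. \<phi> (c m a x) \<partial>mu) - (\<integral>x. \<phi> (p a x) \<partial>mu)) = norm (\<integral>x. \<phi> (c m a x) - \<phi> (p a x) \<partial>mu)"
        using phi_c[of m a] phi_p[of a] by simp
      also have "\<dots> \<le> (\<integral>x. norm (\<phi> (c m a x) - \<phi> (p a x)) \<partial>mu)" by (rule integral_norm_bound)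
      also have "\<dots> \<le> (\<integral>x. L * \<bar>c m a x - p a x\<bar> \<partial>mu)"
      proof (rule integral_mono)
        show "integrable mu (\<lambda>x. norm (\<phi> (c m a x) - \<phi> (p a x)))" using phi_c[of m a] phi_p[of a] by simp
        show "integrable mu (\<lambda>x. L * \<bar>c m a x - p a x\<bar>)" using ci[of m a] pi[of a] by simp
      qed (use lip[OF c0 c1 p0 p1] in simp)
      also have "\<dots> = L * D a m" by (simp add: D_def)
      finally show "norm ((\<integral>x. \<phi> (c m a x) \<partial>mu) - (\<integral>x. \<phi> (p a x) \<partial>mu)) \<le> L * D a m" .
    qed
    show "(\<lambda>m. L * D a m) \<longlonglongrightarrow> 0" using tendsto_mult_right_zero[OF D[of a], of L] .
  qed
  have range: "first ` space mu = UNIV"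
  proof -
    have "a = first (\<lambda>_. a)" for a :: 'a by (simp add: first_def)
    then show ?thesis by auto
  qed
  have incr: "(\<Sum>a\<in>UNIV. \<integral>x. \<phi> (c m a x) \<partial>mu) \<le> M.S.ent_incr first m" for m
  proof -
    have "M.S.ent_incr first m = ent mu (\<lambda>x. (first x, Y m x)) - ent mu (Y m)"
      unfolding Y_def by (rule M.S.ent_incr_eq[OF M.simple_first])
    also have "\<dots> = (\<Sum>a\<in>UNIV. \<integral>x. - (c m a x * ln (c m a x)) \<partial>mu)"
      unfolding M.ent_cond_eq_sum[OF M.simple_first sY] range c_def by simp
    also have "(\<Sum>a\<in>UNIV. \<integral>x. \<phi> (c m a x) \<partial>mu) \<le> \<dots>"
    proof (intro sum_mono integral_mono phi_c)
      fix a x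
      show "integrable mu (\<lambda>x. - (c m a x * ln (c m a x)))"
        using M.integrable_comp_simple[OF cs, of "\<lambda>t. - (t * ln t)"] .
      show "\<phi> (c m a x) \<le> - (c m a x * ln (c m a x))"
      proof (cases "c m a x = 0")
        case False
        then have cp: "0 < c m a x" using c0[of m a x] by simp
        have "ln (k * c m a x) \<le> k * c m a x - 1" using cp k by (intro ln_le_minus_one) simp
        then have "ln k + 1 - k * c m a x \<le> - ln (c m a x)" using cp k by (simp add: ln_mult)
        from mult_left_mono[OF this, of "c m a x"] show ?thesis using cp by (simp add: \<phi>_def algebra_simps)
      qed (simp add: \<phi>_def)
    qed
    finally show ?thesis .
  qed
  have "(\<lambda>m. \<Sum>a\<in>UNIV. \<integral>x. \<phi> (c m a x) \<partial>mu) \<longlonglongrightarrow> (\<Sum>a\<in>UNIV. \<integral>x. \<phi> (p a x) \<partial>mu)"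
    by (intro tendsto_sum lim)
  then have "(\<Sum>a\<in>UNIV. \<integral>x. \<phi> (p a x) \<partial>mu) \<le> M.S.ent_rate first"
    by (rule LIMSEQ_le[OF _ M.S.ent_incr_tendsto[OF M.simple_first]]) (use incr in blast)
  also have "\<dots> \<le> ln k" by (rule rate_mu_le)
  finally have le: "(\<Sum>a\<in>UNIV. \<integral>x. \<phi> (p a x) \<partial>mu) \<le> ln k" .
  \<comment> \<open>The surplus of \<phi> over p ln k. It is nonnegative and vanishes only at 0 and
    1 / k; since the p sum to 1, the terms p ln k already exhaust the bound ln k.\<close>
  define g where "g = (\<lambda>a x. p a x - k * (p a x * p a x))"
  have g0: "0 \<le> g a x" for a x
  proof -
    have "k * p a x \<le> 1" using p1[of a x] k by (simp add: field_simps)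
    from mult_right_mono[OF this p0[of a x]] show ?thesis by (simp add: g_def mult_ac)
  qed
  have gi: "integrable mu (g a)" for a unfolding g_def using pi[of a] pp[of a] by simp
  have sp: "(\<Sum>a\<in>UNIV. \<integral>x. p a x \<partial>mu) = 1"
  proof -
    have "(\<Sum>a\<in>UNIV. \<integral>x. p a x \<partial>mu) = (\<integral>x. (\<Sum>a\<in>UNIV. p a x) \<partial>mu)"
      by (rule Bochner_Integration.integral_sum[symmetric]) (rule pi)
    also have "\<dots> = (\<integral>x. 1 \<partial>mu)"
    proof (rule integral_cong_AE)
      show "AE x in mu. (\<Sum>a\<in>UNIV. p a x) = 1" using p_eq M.sum_step_prob by eventually_elim simp
    qed (use pm in auto)
    finally show ?thesis using M.prob_space by simp
  qed
  have "(\<Sum>a\<in>UNIV. \<integral>x. \<phi> (p a x) \<partial>mu) = (\<Sum>a\<in>UNIV. (\<integral>x. p a x \<partial>mu) * ln k + (\<integral>x. g a x \<partial>mu))"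
  proof (intro sum.cong refl)
    fix a
    have "(\<integral>x. \<phi> (p a x) \<partial>mu) = (\<integral>x. p a x * ln k + g a x \<partial>mu)" by (simp add: \<phi>_def g_def algebra_simps)
    also have "\<dots> = (\<integral>x. p a x \<partial>mu) * ln k + (\<integral>x. g a x \<partial>mu)" using pi[of a] gi[of a] by simp
    finally show "(\<integral>x. \<phi> (p a x) \<partial>mu) = (\<integral>x. p a x \<partial>mu) * ln k + (\<integral>x. g a x \<partial>mu)" .
  qed
  also have "\<dots> = ln k + (\<Sum>a\<in>UNIV. \<integral>x. g a x \<partial>mu)"
    by (simp add: sum.distrib sum_distrib_right[symmetric] sp)
  finally have "(\<Sum>a\<in>UNIV. \<integral>x. g a x \<partial>mu) \<le> 0" using le by simp
  moreover have gn: "0 \<le> (\<integral>x. g a x \<partial>mu)" for a by (rule Bochner_Integration.integral_nonneg) (rule g0)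
  ultimately have "(\<Sum>a\<in>UNIV. \<integral>x. g a x \<partial>mu) = 0" by (intro antisym sum_nonneg) auto
  then have gz: "(\<integral>x. g a x \<partial>mu) = 0" for a
    using sum_nonneg_eq_0_iff[of UNIV "\<lambda>a. \<integral>x. g a x \<partial>mu"] gn by simp
  have "AE x in mu. g a x = 0" for a
    using integral_nonneg_eq_0_iff_AE[OF gi, of a] g0 gz by simp
  then have "AE x in mu. \<forall>a. g a x = 0" by (simp add: AE_all_countable)
  then show ?thesis using p_eq
  proof eventually_elim
    case (elim x)
    show ?case
    proof
      fix a
      have "M.step_prob a x * (1 - k * M.step_prob a x) = 0"
        using elim by (simp add: g_def algebra_simps)
      then show "M.step_prob a x = 0 \<or> M.step_prob a x = 1 / k" using k by (auto simp: field_simps)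
    qed
  qed
qed

lemma AE_mu:
  assumes m: "{x. P x} \<in> sets seq_borel" and P: "AE x in mu. P x"
  shows "AE A in extended. AE x in uniform_product A. P x"
proof -
  have "Measurable.pred seq_borel P" using m by (simp add: pred_def)
  from AE_bind[OF kernel this] show ?thesis using P unfolding mu_def by simp
qed

text \<open>For \<open>a\<close> in \<open>first A\<close> the first symbol equals \<open>a\<close>
  with probability 1 / k independently of the tail, so the tails where \<open>step_prob a\<close> is
  not positive are null. This gives one inclusion; values in {0, 1 / k} summing to 1 give
  \<open>k\<close> elements on both sides.\<close>

lemma alph_eq_first: "AE A in extended. AE x in uniform_product A. M.alph x = first A"
proof -
  have spm [measurable]: "M.step_prob a \<in> borel_measurable seq_borel" for a
    using M.step_prob_measurable(2)[of a] unfolding M.measurable_M_eq .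
  have pos: "AE A in extended. AE x in uniform_product A. a \<in> first A \<longrightarrow> 0 < M.step_prob a x" for a
  proof -
    define D where "D = {y. \<not> 0 < M.stepP a y}"
    have D: "D \<in> sets seq_borel"
    proof -
      have "{y \<in> space seq_borel. \<not> 0 < M.stepP a y} \<in> sets seq_borel" by measurable
      then show ?thesis by (simp add: D_def)
    qed
    let ?B = "{x. first x = a} \<inter> shift -` D"
    have fa: "{x :: nat \<Rightarrow> 'a. first x = a} \<in> sets seq_borel" using M.first_sets by (simp add: sets_mu)
    have sD: "shift -` D \<in> sets seq_borel" using measurable_sets[OF measurable_shift D] by simp
    have B: "?B \<in> sets seq_borel" using fa sD by auto
    have "AE x in mu. x \<notin> ?B"
      using M.step_prob_first_pos by eventually_elim (auto simp: D_def M.step_prob_eq)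
    then have "measure mu ?B = 0" using M.prob_eq_0[of ?B] B by (simp add: sets_mu)
    then have "(\<integral>A. measure (uniform_product A) ?B \<partial>extended) = 0" using measure_mu[OF B] by simp
    then have "AE A in extended. measure (uniform_product A) ?B = 0"
      using integral_nonneg_eq_0_iff_AE[OF up_integrable[OF B]] by simp
    then show ?thesis using AE_k
    proof eventually_elim
      case (elim A)
      interpret L: seq_measure "uniform_product A" by (rule seq_measure_uniform_product)
      show ?case
      proof (cases "a \<in> first A")
        case True
        then have "measure (uniform_product A) (shift -` D) = 0"
          using elim k by (simp add: uniform_product_step[OF D] uniform_product_shift[OF D] first_pmf_Zk)
        then have "AE x in uniform_product A. x \<notin> shift -` D"
          using L.prob_eq_0[of "shift -` D"] sD by (simp add: L.sets_M)
        then show ?thesis by eventually_elim (simp add: D_def M.step_prob_eq)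
      qed simp
    qed
  qed
  have pos': "AE A in extended. AE x in uniform_product A. \<forall>a. a \<in> first A \<longrightarrow> 0 < M.step_prob a x"
  proof -
    have "AE A in extended. \<forall>a. AE x in uniform_product A. a \<in> first A \<longrightarrow> 0 < M.step_prob a x"
      using pos by (simp add: AE_all_countable)
    then show ?thesis by (simp add: AE_all_countable)
  qed
  have vals: "AE A in extended. AE x in uniform_product A. \<forall>a. M.step_prob a x = 0 \<or> M.step_prob a x = 1 / k"
  proof (rule AE_mu[OF _ step_prob_values])
    have "{x \<in> space seq_borel. \<forall>a. M.step_prob a x = 0 \<or> M.step_prob a x = 1 / k} \<in> sets seq_borel" by measurable
    then show "{x. \<forall>a. M.step_prob a x = 0 \<or> M.step_prob a x = 1 / k} \<in> sets seq_borel" by simp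
  qed
  have sum1: "AE A in extended. AE x in uniform_product A. (\<Sum>a\<in>UNIV. M.step_prob a x) = 1"
  proof (rule AE_mu[OF _ M.sum_step_prob])
    have "{x \<in> space seq_borel. (\<Sum>a\<in>UNIV. M.step_prob a x) = 1} \<in> sets seq_borel" by measurable
    then show "{x. (\<Sum>a\<in>UNIV. M.step_prob a x) = 1} \<in> sets seq_borel" by simp
  qed
  from AE_k pos' vals sum1 show ?thesis
  proof eventually_elim
    case (elim A)
    from elim(2,3,4) show ?case
    proof eventually_elim
      case (elim x)
      have sub: "first A \<subseteq> M.alph x" using elim(1) by (auto simp: M.alph_def)
      have out: "M.step_prob a x = 0" if "a \<notin> M.alph x" for a
        using elim(2)[rule_format, of a] that k by (auto simp: M.alph_def)
      have ins: "M.step_prob a x = 1 / k" if "a \<in> M.alph x" for a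
        using elim(2)[rule_format, of a] that by (auto simp: M.alph_def)
      have "1 = (\<Sum>a\<in>M.alph x. M.step_prob a x)"
        unfolding elim(3)[symmetric] by (rule sum.mono_neutral_right) (use out in auto)
      also have "\<dots> = card (M.alph x) / k" using ins by simp
      finally have "card (M.alph x) = k" using k by simp
      then have "card (first A) = card (M.alph x)"
        using Zk_card[OF \<open>A \<in> Zk \<tau> k\<close>, of 0] by (simp add: first_def)
      from card_subset_eq[OF finite sub this] show ?case by simp
    qed
  qed
qed

text \<open>The alphabets at later times are those of shifted products, since \<open>shift\<close>
  carries the product over \<open>A\<close> to the product over \<open>shift A\<close>.\<close>

lemma alph_seq_eq: "AE A in extended. AE x in uniform_product A. M.alph_seq x = A"
proof -
  have "AE A in extended. \<forall>i. AE x in uniform_product ((shift ^^ i) A). M.alph x = first ((shift ^^ i) A)"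
    using E.S.AE_T_pow[OF alph_eq_first] by (simp add: AE_all_countable)
  then show ?thesis
  proof eventually_elim
    case (elim A)
    have "AE x in uniform_product A. M.alph ((shift ^^ i) x) = first ((shift ^^ i) A)" for i
      by (rule AE_uniform_product_shift_pow[OF elim[rule_format]])
    then have "AE x in uniform_product A. \<forall>i. M.alph ((shift ^^ i) x) = first ((shift ^^ i) A)"
      by (simp add: AE_all_countable)
    then show ?case
      by eventually_elim (simp add: M.alph_seq_def fun_eq_iff first_def shift_pow)
  qed
qed

text \<open>Under the product over \<open>A\<close> the alphabet sequence is almost surely
  \<open>A\<close>, so the preimage of \<open>B\<close> has mass 1 or 0 according to whether
  \<open>A\<close> lies in \<open>B\<close>.\<close>

lemma alph_distr_mu: "M.alph_distr = extended"
proof (rule measure_eqI)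
  show "sets M.alph_distr = sets extended" by (simp add: M.sets_alph_distr SE.sets_M)
  fix B assume "B \<in> sets M.alph_distr"
  then have B: "B \<in> sets seq_borel" by (simp add: M.sets_alph_distr)
  have "M.alph_seq -` B \<in> sets mu" using measurable_sets[OF M.alph_seq_measurable B] by simp
  then have aB: "M.alph_seq -` B \<in> sets seq_borel" by (simp add: sets_mu)
  have "emeasure M.alph_distr B = emeasure mu (M.alph_seq -` B)"
    unfolding M.alph_distr_def using emeasure_distr[OF M.alph_seq_measurable B] by simp
  also have "\<dots> = (\<integral>\<^sup>+A. emeasure (uniform_product A) (M.alph_seq -` B) \<partial>extended)" by (rule emeasure_mu[OF aB])
  also have "\<dots> = (\<integral>\<^sup>+A. indicator B A \<partial>extended)"
  proof (rule nn_integral_cong_AE)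
    show "AE A in extended. emeasure (uniform_product A) (M.alph_seq -` B) = indicator B A"
      using alph_seq_eq
    proof eventually_elim
      case (elim A)
      interpret L: seq_measure "uniform_product A" by (rule seq_measure_uniform_product)
      have aL: "M.alph_seq -` B \<in> L.events" using aB by (simp add: L.sets_M)
      show ?case
      proof (cases "A \<in> B")
        case True
        have "AE x in uniform_product A. x \<in> M.alph_seq -` B" using elim by eventually_elim (simp add: True)
        then show ?thesis using True L.prob_eq_1[OF aL] by (simp add: L.emeasure_eq_measure)
      next
        case False
        have "AE x in uniform_product A. x \<notin> M.alph_seq -` B" using elim by eventually_elim (simp add: False)
        then show ?thesis using False L.prob_eq_0[OF aL] by (simp add: L.emeasure_eq_measure)
      qed
    qed
  qed
  also have "\<dots> = emeasure extended B" using B by (simp add: SE.sets_M)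
  finally show "emeasure M.alph_distr B = emeasure extended B" .
qed

lemma mu_mem: "mu \<in> zero_entropy_alphabet_measures \<tau>"
proof -
  have "distr mu seq_borel (alphabet_map mu) = extended"
    unfolding M.distr_alphabet_map M.alph_distr_def[symmetric] by (rule alph_distr_mu)
  then show ?thesis
    unfolding zero_entropy_alphabet_measures_def invariant_under_def
    using M.prob_space_axioms sets_mu M.S.T M.inv M.T.T M.inv_tau mu_ergodic zero_extended by simp
qed

end

theorem corollary6p8:
  fixes \<tau> :: "(nat \<Rightarrow> 'a::finite) \<Rightarrow> nat \<Rightarrow> 'a"
  assumes "bipermutative_ca \<tau>"
  shows "\<exists>\<Phi>. bij_betw \<Phi> (zero_entropy_alphabet_measures \<tau>) (zero_entropy_Z_measures \<tau>)"
proof -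
  obtain r where r: "bipermutative \<tau> r"
    using assms unfolding bipermutative_ca_def bipermutative_def by blast
  interpret bipermutative \<tau> r by (rule r)
  \<comment> \<open>The law of the alphabets lives on all sequences of sets, while the target
    consists of measures on the space \<open>Z \<tau>\<close>; hence the restriction.\<close>
  define \<Phi> where "\<Phi> = (\<lambda>\<mu>. restrict_space (distr \<mu> seq_borel (alphabet_map \<mu>)) (Z \<tau>))"
  have left: "zero_alphabet_ca \<mu> \<tau> r" and distr: "distr \<mu> seq_borel (alphabet_map \<mu>) = shift_measure.alph_distr \<mu>"
    if "\<mu> \<in> zero_entropy_alphabet_measures \<tau>" for \<mu>
  proof -
    from that have \<mu>: "prob_space \<mu>" "sets \<mu> = sets seq_borel" "distr \<mu> \<mu> shift = \<mu>" "distr \<mu> \<mu> \<tau> = \<mu>"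
      "measure_entropy (distr \<mu> seq_borel (alphabet_map \<mu>)) shift = 0"
      by (auto simp: zero_entropy_alphabet_measures_def invariant_under_def)
    interpret prob_space \<mu> by (rule \<mu>(1))
    interpret ca_measure \<mu> \<tau> r by unfold_locales (use \<mu> in auto)
    show d: "distr \<mu> seq_borel (alphabet_map \<mu>) = alph_distr"
      unfolding distr_alphabet_map alph_distr_def ..
    show "zero_alphabet_ca \<mu> \<tau> r" by unfold_locales (use \<mu>(5) d in simp)
  qed
  have mem: "\<Phi> \<mu> \<in> zero_entropy_Z_measures \<tau>" if \<mu>: "\<mu> \<in> zero_entropy_alphabet_measures \<tau>" for \<mu>
  proof -
    interpret zero_alphabet_ca \<mu> \<tau> r by (rule left[OF \<mu>])
    show ?thesis
      unfolding \<Phi>_def distr[OF \<mu>]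
      by (rule alph_distr_restrict) (use \<mu> in \<open>simp add: zero_entropy_alphabet_measures_def\<close>)
  qed
  have alph_eq: "restricted_measure.extended (\<Phi> \<mu>) = shift_measure.alph_distr \<mu>"
    if \<mu>: "\<mu> \<in> zero_entropy_alphabet_measures \<tau>" for \<mu>
  proof -
    interpret zero_alphabet_ca \<mu> \<tau> r by (rule left[OF \<mu>])
    have "AE A in alph_distr. A \<in> Z \<tau>"
      unfolding alph_distr_def using alph_seq_Z Z_sets by (subst AE_distr_iff[OF alph_seq_measurable]) auto
    from N.restricted_measureI(2)[OF Z_sets this] show ?thesis unfolding \<Phi>_def distr[OF \<mu>] .
  qed
  have "inj_on \<Phi> (zero_entropy_alphabet_measures \<tau>)"
  proof (rule inj_onI)
    fix \<mu> \<mu>' assume \<mu>: "\<mu> \<in> zero_entropy_alphabet_measures \<tau>" and \<mu>': "\<mu>' \<in> zero_entropy_alphabet_measures \<tau>"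
      and eq: "\<Phi> \<mu> = \<Phi> \<mu>'"
    interpret A: zero_alphabet_ca \<mu> \<tau> r by (rule left[OF \<mu>])
    interpret B: zero_alphabet_ca \<mu>' \<tau> r by (rule left[OF \<mu>'])
    \<comment> \<open>Extending the restricted measure recovers the law of the alphabets, and this
      law fixes all cylinder masses.\<close>
    have "A.alph_distr = B.alph_distr" using alph_eq[OF \<mu>] alph_eq[OF \<mu>'] eq by simp
    then have "A.prob (cyl l) = B.prob (cyl l)" for l unfolding A.prob_cyl B.prob_cyl by simp
    then show "\<mu> = \<mu>'"
      by (intro measure_eqI_cyl A.sets_M B.sets_M A.finite_measure_axioms)
         (simp add: A.emeasure_eq_measure B.emeasure_eq_measure)
  qed
  moreover have "\<exists>\<mu>\<in>zero_entropy_alphabet_measures \<tau>. \<Phi> \<mu> = \<nu>" if \<nu>: "\<nu> \<in> zero_entropy_Z_measures \<tau>" for \<nu>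
  proof -
    interpret prob_space \<nu> using \<nu> by (simp add: zero_entropy_Z_measures_def)
    interpret R: zero_Z_measure \<nu> \<tau> r
      by unfold_locales (use \<nu> Z_sets in \<open>auto simp: zero_entropy_Z_measures_def\<close>)
    obtain k where k: "0 < k" "AE A in R.extended. A \<in> Zk \<tau> k" using R.ex_card by blast
    interpret K: zero_Z_measure_card \<nu> \<tau> r k by unfold_locales (use k in auto)
    \<comment> \<open>The preimage of \<open>\<nu>\<close> is the mixture, whose alphabets have the
      extension of \<open>\<nu>\<close> as their law.\<close>
    have "\<Phi> K.mu = restrict_space R.extended (Z \<tau>)"
      unfolding \<Phi>_def distr[OF K.mu_mem] K.alph_distr_mu ..
    then show ?thesis using K.mu_mem R.restrict_extended by auto
  qed
  ultimately have "bij_betw \<Phi> (zero_entropy_alphabet_measures \<tau>) (zero_entropy_Z_measures \<tau>)"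
    unfolding bij_betw_def using mem by blast
  then show ?thesis by blast
qed

end
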